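(* Let $\delta>0$ and $K>0$, and let $$H_{\delta,K}=\{x\in\mathbb C\ |\ \text{either }\delta\le\mathrm{Re}\,x\le\pi-\delta,\text{ or }|\mathrm{Re}\,x|\le K\text{ and }|\mathrm{Im}\,x|\ge\delta\}.$$ There exists a constant $B=B_{\delta,K}>0$ independent of $b$ such that for all $b\in(0,1)$ and all $x\in H_{\delta,K}$, $$\Big|2\pi\mathbf i\,b^2\log S_b\Big(\frac{x}{\pi b}+\frac b2\Big)-L(x)\Big|<Bb^4.$$ Equivalently, $|\nu_b(x)|<B$, where $\nu_b$ is defined by $2\pi\mathbf i\,b^2\log S_b\big(\frac{x}{\pi b}+\frac b2\big)-L(x)=\nu_b(x)b^4$.
   Context: For $b\in(0,1)$ and $Q=b+b^{-1}$, the double sine function is defined for $0<\mathrm{Re}\,z<Q$ by $S_b(z)=\exp\big(\int_\Omega\frac{\sinh((\frac Q2-z)t)}{4t\sinh(\frac{bt}{2})\sinh(\frac{t}{2b})}dt\big)$, where the contour $\Omega$ goes along the real line and passes above the pole at the origin; it extends to a meromorphic function on $\mathbb C$ by $S_b(z+b^{\pm1})=2\sin(\pi b^{\pm1}z)S_b(z)$, with poles $\{-nb-mb^{-1}\}$ and zeros $\{Q+nb+mb^{-1}\}$, $m,n\in\mathbb Z_{\ge0}$. The function $\log S_b\big(\frac{x}{\pi b}+\frac b2\big)$ is $\int_\Omega\frac{\sinh((\frac1{2b}-\frac{x}{\pi b})t)}{4t\sinh(\frac{bt}{2})\sinh(\frac{t}{2b})}dt$ for $-\frac{\pi b^2}2<\mathrm{Re}\,x<\pi+\frac{\pi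 b^2}2$, and is extended holomorphically to $\mathbb C\setminus((-\infty,0]\cup[\pi,\infty))$. The dilogarithm is $\mathrm{Li}_2(z)=-\int_0^z\frac{\log(1-u)}{u}du$ on $\mathbb C\setminus(1,\infty)$ (principal logarithm). The function $\mathrm{Li}_2(e^{2\mathbf ix})$, defined for $0<\mathrm{Re}\,x<\pi$ by this formula, is extended by analytic continuation to a holomorphic function on $\mathbb C\setminus((-\infty,0]\cup[\pi,\infty))$, still denoted $\mathrm{Li}_2(e^{2\mathbf ix})$, and $L(x)=x^2-\pi x+\frac{\pi^2}6-\mathrm{Li}_2(e^{2\mathbf ix})$. *)

theory Defs
  imports "HOL-Complex_Analysis.Complex_Analysis"
begin

text \<open>
  The integral of \<open>f\<close> along the contour that follows the real line from \<open>-\<infinity>\<close> to \<open>\<infinity>\<close>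
  and avoids the origin by the half circle of radius \<open>r\<close> in the upper half plane
  (traversed from \<open>-r\<close> to \<open>r\<close>, i.e. with the angle decreasing from \<open>pi\<close> to \<open>0\<close>).
\<close>
definition indented_line_integral :: "real \<Rightarrow> (complex \<Rightarrow> complex) \<Rightarrow> complex" where
  "indented_line_integral r f =
     (LINT t:{..-r}|lborel. f (of_real t))
     + contour_integral (part_circlepath 0 r pi 0) f
     + (LINT t:{r..}|lborel. f (of_real t))"

text \<open>
  The integral defining \<open>log S\<^sub>b(z)\<close>, \<open>S\<^sub>b\<close> the double sine function, for \<open>0 < Re z < Q\<close>, where
  \<open>Q = b + 1/b\<close>.  The nonzero poles of the integrand lie at integer multiples of
  \<open>2 * pi * \<i> * b\<close> and \<open>2 * pi * \<i> / b\<close>.  For \<open>0 < b < 1\<close> the half circle of radius \<open>b\<close>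
  therefore separates the origin from all of those in the upper half plane.
\<close>
definition log_double_sine_strip :: "real \<Rightarrow> complex \<Rightarrow> complex" where
  "log_double_sine_strip b z =
     indented_line_integral b
       (\<lambda>t. sinh ((of_real ((b + 1 / b) / 2) - z) * t)
            / (4 * t * sinh (of_real b * t / 2) * sinh (t / (2 * of_real b))))"

definition slit_plane :: "complex set" where
  "slit_plane = - (of_real ` ({..0} \<union> {pi..}))"

text \<open>
  Holomorphic extension of \<open>f\<close> from \<open>U\<close> to \<open>D\<close>.  If such an extension exists, \<open>D\<close> is open and
  connected and \<open>U\<close> is a nonempty open subset of \<open>D\<close>, then its values on \<open>D\<close> are unique.
\<close>
definition holomorphic_extension ::
  "complex set \<Rightarrow> complex set \<Rightarrow> (complex \<Rightarrow> complex) \<Rightarrow> complex \<Rightarrow> complex" where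
  "holomorphic_extension D U f = (SOME g. g holomorphic_on D \<and> (\<forall>z\<in>U. g z = f z))"

text \<open>
  The function \<open>log S\<^sub>b (x / (pi * b) + b / 2)\<close> of \<open>x\<close> on the slit plane.  The strip
  below is where \<open>0 < Re z < Q\<close> for \<open>z = x / (pi * b) + b / 2\<close>.
\<close>
definition log_double_sine :: "real \<Rightarrow> complex \<Rightarrow> complex" where
  "log_double_sine b =
     holomorphic_extension slit_plane
       ({x. - (pi * b\<^sup>2 / 2) < Re x \<and> Re x < pi + pi * b\<^sup>2 / 2} \<inter> slit_plane)
       (\<lambda>x. log_double_sine_strip b (x / of_real (pi * b) + of_real (b / 2)))"

text \<open>
  The integrand has a removable singularity at \<open>0\<close>, where HOL gives it the value \<open>0\<close>;
  this does not affect the integral.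
\<close>
definition dilog :: "complex \<Rightarrow> complex" where
  "dilog z = - contour_integral (linepath 0 z) (\<lambda>u. Ln (1 - u) / u)"

text \<open>
  \<open>dilog_exp x\<close> is the analytic continuation of \<open>dilog (exp (2 * \<i> * x))\<close> from the strip
  \<open>0 < Re x < pi\<close>; it is not the composition outside of that strip.
\<close>
definition dilog_exp :: "complex \<Rightarrow> complex" where
  "dilog_exp = holomorphic_extension slit_plane {x. 0 < Re x \<and> Re x < pi}
     (\<lambda>x. dilog (exp (2 * \<i> * x)))"

definition L_fun :: "complex \<Rightarrow> complex" where
  "L_fun x = x\<^sup>2 - of_real pi * x + of_real (pi\<^sup>2 / 6) - dilog_exp x"

definition H_region :: "real \<Rightarrow> real \<Rightarrow> complex set" where
  "H_region \<delta> K = {x. (\<delta> \<le> Re x \<and> Re x \<le> pi - \<delta>) \<or> (\<bar>Re x\<bar> \<le> K \<and> \<bar>Im x\<bar> \<ge> \<delta>)}"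

definition nu :: "real \<Rightarrow> complex \<Rightarrow> complex" where
  "nu b x = (2 * of_real pi * \<i> * of_real (b\<^sup>2) * log_double_sine b x - L_fun x) / of_real (b ^ 4)"

end

theory Submission
  imports Defs "HOL-Real_Asymp.Real_Asymp"
begin

text \<open>
  Put \<open>c = 1 - 2 x / pi\<close>.  After rescaling the variable of integration, \<open>log S\<^sub>b\<close> is the integral over the
  indented line of \<open>sinh (c s) G\<^sub>b s\<close>, where \<open>G\<^sub>b s = 1 / (4 s sinh s sinh (b\<^sup>2 s))\<close> is odd.  Splitting \<open>sinh\<close>
  into exponentials turns this into the mean of the integrals of \<open>exp (c s) G\<^sub>b s\<close> over the lines
  \<open>Im s = pi / 2\<close> and \<open>Im s = - pi / 2\<close>.  These differ by the residue at \<open>0\<close>, a quadratic polynomial in \<open>c\<close>;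
  and for \<open>Im c < 0\<close> the lower line may be bent into the parabola \<open>s = u - \<i> (pi / 2 + u\<^sup>2)\<close>, on which \<open>exp (c s)\<close>
  has Gaussian decay.  So the integral over the parabola provides the continuation to the whole half plane, and
  oddness in \<open>c\<close> the one to the other half plane.

  The same construction with \<open>G\<^sub>0 s = 1 / (4 s\<^sup>2 sinh s)\<close> gives \<open>L\<close>: the integral over the lower line has the same
  second derivative in \<open>x\<close> as \<open>Li\<^sub>2 (exp (2 \<i> x))\<close>, up to a constant factor, and both vanish as \<open>Im x \<rightarrow> \<infinity>\<close>.  The
  error is therefore the integral for the kernel \<open>b\<^sup>2 G\<^sub>b - G\<^sub>0\<close>, which is \<open>O(b\<^sup>4)\<close> because
  \<open>1 / sinh v - 1 / v = O(v)\<close>; the lines are used near the real segment and the parabola elsewhere.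
\<close>

section \<open>Contour and parameter integrals over the real line\<close>

text \<open>The constant has to be uniform in b, although the poles of 1 / sinh (b^2 s), at nonzero
  multiples of i pi / b^2, move with b. A horizontal line gives convergence only while |Re c| stays
  below the decay rate of the kernel. Bending it into two rays would gain decay proportional to |u|,
  with a slope that depends on the ratio of |Re c| to |Im c|; a quadratic descent beats every linear
  term, so one curve serves a whole half plane. The parabola also keeps off the poles at a
  controlled rate: where b^2 s is far from the real axis, b^2 u^2 is bounded below, hence |Re (b^2
  s)| = b^2 |u| is at least a multiple of 1 / |u|. Nearness to a pole thus costs one factor of order
  |u|, uniformly in b, and the Gaussian absorbs it. The Gaussian rate degenerates as Im c tends to
  0, which is why the lines are kept for small |Im c|. The height pi / 2 is midway between the pole
  at 0 and the next ones of 1 / sinh s at distance pi; there |sinh s| = cosh (Re s), and since b < 1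
  the other family of poles is no nearer.\<close>

lemma integrable_exp_neg_abs:
  assumes "a > 0"
  shows "integrable lborel (\<lambda>u::real. exp (- a * \<bar>u\<bar>))"
proof -
  have "set_integrable lebesgue {0::real..} (\<lambda>u. exp (- a * u))"
    using assms by (intro nonnegative_absolutely_integrable_1 integrable_on_exp_minus_to_infinity) auto
  then have "integrable lebesgue (\<lambda>u. indicator {0::real..} u *\<^sub>R exp (- a * u))"
    by (simp add: set_integrable_def)
  then have "integrable lborel (\<lambda>u. indicator {0::real..} u *\<^sub>R exp (- a * u))"
    by (subst (asm) integrable_completion) auto
  also have "(\<lambda>u. indicator {0::real..} u *\<^sub>R exp (- a * u)) = (\<lambda>u. indicator {0..} u *\<^sub>R exp (- a * \<bar>u\<bar>))"
    by (auto simp: indicator_def fun_eq_iff)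
  finally obtain v where "has_bochner_integral lborel (\<lambda>u. indicator {0::real..} u *\<^sub>R exp (- a * \<bar>u\<bar>)) v"
    by (auto simp: integrable.simps)
  from has_bochner_integral_even_function[OF this] show ?thesis
    by (auto simp: integrable.simps)
qed

text \<open>Completing the square: \<open>(B + 1) * \<bar>u\<bar> - a * u\<^sup>2\<close> has
  maximum at most \<open>(B + 1)\<^sup>2 / (4 * a)\<close>. This replaces Gaussian majorants by
  multiples of the one function exp (- |u|).\<close>

lemma exp_neg_square_le_exp_neg_abs:
  fixes a B u :: real
  assumes "a > 0"
  shows "exp (B * \<bar>u\<bar> - a * u\<^sup>2) \<le> exp ((B + 1)\<^sup>2 / (4 * a)) * exp (- 1 * \<bar>u\<bar>)"
proof -
  have "0 \<le> a * (\<bar>u\<bar> - (B + 1) / (2 * a))\<^sup>2"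
    using assms by simp
  also have "\<dots> = a * u\<^sup>2 - (B + 1) * \<bar>u\<bar> + (B + 1)\<^sup>2 / (4 * a)"
    using assms by (simp add: power2_eq_square field_simps)
  finally have "B * \<bar>u\<bar> - a * u\<^sup>2 \<le> (B + 1)\<^sup>2 / (4 * a) + - 1 * \<bar>u\<bar>"
    by (simp add: algebra_simps)
  then show ?thesis
    by (simp flip: exp_add)
qed

text \<open>Dominated convergence on the truncations to [-R, R], combined with the fundamental
  theorem of calculus. Shifts of the infinite contours are carried out on such differences of a
  primitive.\<close>

lemma primitive_tendsto_integral:
  fixes F P :: "complex \<Rightarrow> complex" and \<gamma> \<gamma>' :: "real \<Rightarrow> complex"
  assumes "\<And>u. (\<gamma> has_vector_derivative \<gamma>' u) (at u)"
    and "\<And>u. (P has_field_derivative F (\<gamma> u)) (at (\<gamma> u))"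
    and int: "integrable lborel (\<lambda>u. F (\<gamma> u) * \<gamma>' u)"
  shows "((\<lambda>R. P (\<gamma> R) - P (\<gamma> (- R))) \<longlongrightarrow> (LINT u|lborel. F (\<gamma> u) * \<gamma>' u)) at_top"
proof -
  let ?f = "\<lambda>u. F (\<gamma> u) * \<gamma>' u"
  have [measurable]: "?f \<in> borel_measurable borel"
    using int by (simp add: integrable_iff_bounded)
  have lim: "((\<lambda>R. LINT u|lborel. indicator {- R..R} u *\<^sub>R ?f u) \<longlongrightarrow> (LINT u|lborel. ?f u)) at_top"
  proof (rule integral_dominated_convergence_at_top[where w = "\<lambda>u. norm (?f u)"])
    have "((\<lambda>R. indicator {- R..R} u *\<^sub>R ?f u) \<longlongrightarrow> ?f u) at_top" for u
      by (intro tendsto_eventually eventually_mono[OF eventually_ge_at_top[of "\<bar>u\<bar>"]])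
         (auto simp: indicator_def)
    then show "AE u in lborel. ((\<lambda>R. indicator {- R..R} u *\<^sub>R ?f u) \<longlongrightarrow> ?f u) at_top"
      by simp
  qed (use int in \<open>auto simp: indicator_def\<close>)
  have "(LINT u|lborel. indicator {- R..R} u *\<^sub>R ?f u) = P (\<gamma> R) - P (\<gamma> (- R))" if "R \<ge> 0" for R
  proof -
    have "((\<lambda>u. (P \<circ> \<gamma>) u) has_vector_derivative (\<gamma>' u * F (\<gamma> u))) (at u)" for u
      using field_vector_diff_chain_at[OF assms(1,2)] by (simp add: o_def)
    then have "(?f has_integral (P \<circ> \<gamma>) R - (P \<circ> \<gamma>) (- R)) {- R..R}"
      using that
      by (intro fundamental_theorem_of_calculus) (auto simp: mult.commute intro: has_vector_derivative_at_within)
    moreover have "set_integrable lborel {- R..R} ?f"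
      unfolding set_integrable_def by (rule integrable_mult_indicator[OF _ int]) simp
    ultimately show ?thesis
      using set_borel_integral_eq_integral(2)[of "{- R..R}" ?f]
      by (simp add: set_lebesgue_integral_def integral_unique)
  qed
  then have "\<forall>\<^sub>F R in at_top. (LINT u|lborel. indicator {- R..R} u *\<^sub>R ?f u) = P (\<gamma> R) - P (\<gamma> (- R))"
    using eventually_ge_at_top by (rule eventually_mono[rotated])
  with lim show ?thesis
    by (rule Lim_transform_eventually)
qed

text \<open>The principle of contour shifting: the two curves lie in a region with a common
  primitive, and the last two hypotheses say that the arcs joining their ends contribute nothing in
  the limit.\<close>

lemma integral_eq_of_common_primitive:
  fixes F P :: "complex \<Rightarrow> complex" and \<gamma> \<gamma>' \<eta> \<eta>' :: "real \<Rightarrow> complex"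
  assumes "\<And>u. (\<gamma> has_vector_derivative \<gamma>' u) (at u)" "\<And>u. (\<eta> has_vector_derivative \<eta>' u) (at u)"
    and "\<And>u. (P has_field_derivative F (\<gamma> u)) (at (\<gamma> u))"
    and "\<And>u. (P has_field_derivative F (\<eta> u)) (at (\<eta> u))"
    and "integrable lborel (\<lambda>u. F (\<gamma> u) * \<gamma>' u)" "integrable lborel (\<lambda>u. F (\<eta> u) * \<eta>' u)"
    and l1: "((\<lambda>R. P (\<gamma> R) - P (\<eta> R)) \<longlongrightarrow> 0) at_top"
    and l2: "((\<lambda>R. P (\<gamma> (- R)) - P (\<eta> (- R))) \<longlongrightarrow> 0) at_top"
  shows "(LINT u|lborel. F (\<gamma> u) * \<gamma>' u) = (LINT u|lborel. F (\<eta> u) * \<eta>' u)"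
proof -
  have A1: "((\<lambda>R. P (\<gamma> R) - P (\<gamma> (- R))) \<longlongrightarrow> (LINT u|lborel. F (\<gamma> u) * \<gamma>' u)) at_top"
    by (rule primitive_tendsto_integral[of \<gamma> \<gamma>' P F]) fact+
  have A2: "((\<lambda>R. P (\<eta> R) - P (\<eta> (- R))) \<longlongrightarrow> (LINT u|lborel. F (\<eta> u) * \<eta>' u)) at_top"
    by (rule primitive_tendsto_integral[of \<eta> \<eta>' P F]) fact+
  have A: "((\<lambda>R. (P (\<gamma> R) - P (\<gamma> (- R))) - (P (\<eta> R) - P (\<eta> (- R)))) \<longlongrightarrow>
           (LINT u|lborel. F (\<gamma> u) * \<gamma>' u) - (LINT u|lborel. F (\<eta> u) * \<eta>' u)) at_top"
    using A1 A2 by (rule tendsto_diff)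
  have "(P (\<gamma> R) - P (\<eta> R)) - (P (\<gamma> (- R)) - P (\<eta> (- R)))
      = (P (\<gamma> R) - P (\<gamma> (- R))) - (P (\<eta> R) - P (\<eta> (- R)))" for R
    by simp
  then have B: "((\<lambda>R. (P (\<gamma> R) - P (\<gamma> (- R))) - (P (\<eta> R) - P (\<eta> (- R)))) \<longlongrightarrow> 0 - 0) at_top"
    using tendsto_diff[OF l1 l2] by (simp only:)
  from tendsto_unique[OF trivial_limit_at_top_linorder A B] show ?thesis
    by simp
qed

section \<open>Differentiation under the integral sign with respect to the exponent\<close>

lemma norm_exp_minus_1_minus_id_le:
  fixes z :: complex
  shows "norm (exp z - 1 - z) \<le> (norm z)\<^sup>2 * exp (norm z)"
proof -
  have "norm (exp z - 1 - z) \<le> exp \<bar>Re z\<bar> * (norm z)\<^sup>2"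
    using Taylor_exp[of z 1] by (simp add: algebra_simps numeral_2_eq_2)
  also have "\<dots> \<le> exp (norm z) * (norm z)\<^sup>2"
    by (intro mult_right_mono) (auto simp: abs_Re_le_cmod)
  finally show ?thesis
    by (simp add: mult.commute)
qed

text \<open>The slack \<open>\<rho> * norm (s u)\<close> in the single integrability hypothesis does
  all the work: it dominates the integrand for every parameter within \<open>\<rho>\<close> of
  \<open>c\<close>, and it absorbs the factors \<open>s u\<close> and \<open>(s u)\<^sup>2\<close>
  of the derivative and of the Taylor remainder. The result is an explicit quadratic remainder
  estimate.\<close>

lemma exp_integral_has_field_derivative:
  fixes k s :: "real \<Rightarrow> complex" and c :: complex
  assumes [measurable]: "k \<in> borel_measurable borel" "s \<in> borel_measurable borel"
    and \<rho>: "\<rho> > 0"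
    and int: "integrable lborel (\<lambda>u. norm (k u) * exp (Re (c * s u) + \<rho> * norm (s u)))"
  shows "integrable lborel (\<lambda>u. k u * exp (c * s u))"
    and "integrable lborel (\<lambda>u. k u * s u * exp (c * s u))"
    and "((\<lambda>c. LINT u|lborel. k u * exp (c * s u)) has_field_derivative
           (LINT u|lborel. k u * s u * exp (c * s u))) (at c)"
proof -
  let ?m = "\<lambda>u. norm (k u) * exp (Re (c * s u) + \<rho> * norm (s u))"
  have A: "integrable lborel (\<lambda>u. k u * exp ((c + h) * s u))" if "norm h \<le> \<rho>" for h
  proof (rule Bochner_Integration.integrable_bound[OF int])
    have "Re ((c + h) * s u) \<le> Re (c * s u) + \<rho> * norm (s u)" for u
    proof -
      have "Re (h * s u) \<le> norm (h * s u)"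
        by (rule complex_Re_le_cmod)
      also have "\<dots> \<le> \<rho> * norm (s u)"
        using that by (simp add: norm_mult mult_right_mono)
      finally show ?thesis
        by (simp add: algebra_simps)
    qed
    then show "AE u in lborel. norm (k u * exp ((c + h) * s u)) \<le> norm (?m u)"
      by (intro AE_I2) (auto simp: norm_mult intro!: mult_left_mono)
  qed simp
  from A[of 0] \<rho> show I0: "integrable lborel (\<lambda>u. k u * exp (c * s u))"
    by simp
  have le: "norm (s u) \<le> exp (\<rho> * norm (s u)) / \<rho>" for u
  proof -
    have "\<rho> * norm (s u) \<le> exp (\<rho> * norm (s u))"
      using exp_ge_add_one_self[of "\<rho> * norm (s u)"] by linarith
    then show ?thesis
      using \<rho> by (simp add: pos_le_divide_eq mult.commute)
  qed
  have "integrable lborel (\<lambda>u. ?m u / \<rho>)"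
    using int by simp
  then show I1: "integrable lborel (\<lambda>u. k u * s u * exp (c * s u))"
  proof (rule Bochner_Integration.integrable_bound)
    have "norm (k u * s u * exp (c * s u)) \<le> ?m u / \<rho>" for u
    proof -
      have "norm (k u * s u * exp (c * s u)) = norm (k u) * exp (Re (c * s u)) * norm (s u)"
        by (simp add: norm_mult)
      also have "\<dots> \<le> norm (k u) * exp (Re (c * s u)) * (exp (\<rho> * norm (s u)) / \<rho>)"
        by (intro mult_left_mono le) auto
      finally show ?thesis
        by (simp add: exp_add mult.assoc)
    qed
    then show "AE u in lborel. norm (k u * s u * exp (c * s u)) \<le> norm (?m u / \<rho>)"
      using \<rho> by (intro AE_I2) (simp add: order_trans[OF _ abs_ge_self])
  qed simp
  \<comment> \<open>The slack is split in two halves. From x^2 / 2 <= exp x at x =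
    \<open>\<rho> / 2 * norm (s u)\<close> comes the factor \<open>8 / \<rho>\<^sup>2\<close>; the
    other half pays for exp |h s|, which is why \<open>norm h \<le> \<rho> / 2\<close> is
    required.\<close>
  define C where "C = 8 / \<rho>\<^sup>2 * (LINT u|lborel. ?m u)"
  let ?I = "\<lambda>c. LINT u|lborel. k u * exp (c * s u)"
  let ?D = "LINT u|lborel. k u * s u * exp (c * s u)"
  have bound: "norm (?I (c + h) - ?I c - h * ?D) \<le> C * (norm h)\<^sup>2" if h: "norm h \<le> \<rho> / 2" for h
  proof -
    have h': "norm h \<le> \<rho>"
      using h \<rho> by simp
    have "?I (c + h) - ?I c - h * ?D =
        (LINT u|lborel. k u * exp ((c + h) * s u) - k u * exp (c * s u) - h * (k u * s u * exp (c * s u)))"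
      unfolding Bochner_Integration.integral_diff[OF Bochner_Integration.integrable_diff[OF A[OF h'] I0]
            integrable_mult_right[OF I1, of h]] Bochner_Integration.integral_diff[OF A[OF h'] I0]
      by (subst Bochner_Integration.integral_mult_right[OF I1]) (rule refl)
    also have "norm \<dots> \<le> (LINT u|lborel. (norm h)\<^sup>2 * (8 / \<rho>\<^sup>2) * ?m u)"
    proof (rule order_trans[OF integral_norm_bound integral_mono])
      show "integrable lborel (\<lambda>u. norm (k u * exp ((c + h) * s u) - k u * exp (c * s u) - h * (k u * s u * exp (c * s u))))"
        by (intro integrable_norm Bochner_Integration.integrable_diff integrable_mult_right A[OF h'] I0 I1)
      show "integrable lborel (\<lambda>u. (norm h)\<^sup>2 * (8 / \<rho>\<^sup>2) * ?m u)"
        by (intro integrable_mult_right int)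
      fix u
      have "k u * exp ((c + h) * s u) - k u * exp (c * s u) - h * (k u * s u * exp (c * s u))
          = k u * exp (c * s u) * (exp (h * s u) - 1 - h * s u)"
        by (simp add: algebra_simps exp_add)
      also have "norm \<dots> \<le> norm (k u) * exp (Re (c * s u)) * ((norm (h * s u))\<^sup>2 * exp (norm (h * s u)))"
        unfolding norm_mult[of "k u * exp (c * s u)"]
        by (intro mult_mono norm_exp_minus_1_minus_id_le) (auto simp: norm_mult)
      also have "\<dots> \<le> norm (k u) * exp (Re (c * s u)) * ((norm h)\<^sup>2 * (8 / \<rho>\<^sup>2) * exp (\<rho> * norm (s u)))"
      proof (rule mult_left_mono)
        have "(norm (s u))\<^sup>2 \<le> 8 / \<rho>\<^sup>2 * exp (\<rho> / 2 * norm (s u))"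
        proof -
          have "(\<rho> / 2 * norm (s u))\<^sup>2 / 2 \<le> exp (\<rho> / 2 * norm (s u))"
            using exp_lower_Taylor_quadratic[of "\<rho> / 2 * norm (s u)"] \<rho> norm_ge_zero[of "s u"]
            by (smt (verit, best) divide_nonneg_nonneg mult_nonneg_nonneg)
          then have "8 / \<rho>\<^sup>2 * ((\<rho> / 2 * norm (s u))\<^sup>2 / 2) \<le> 8 / \<rho>\<^sup>2 * exp (\<rho> / 2 * norm (s u))"
            by (rule mult_left_mono) simp
          then show ?thesis
            using \<rho> by (simp add: power_mult_distrib power_divide)
        qed
        moreover have "exp (norm (h * s u)) \<le> exp (\<rho> / 2 * norm (s u))"
          using mult_right_mono[OF h norm_ge_zero[of "s u"]] by (simp add: norm_mult)
        ultimately have "(norm (s u))\<^sup>2 * exp (norm (h * s u)) \<le>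
            8 / \<rho>\<^sup>2 * exp (\<rho> / 2 * norm (s u)) * exp (\<rho> / 2 * norm (s u))"
          by (intro mult_mono) auto
        also have "\<dots> = 8 / \<rho>\<^sup>2 * exp (\<rho> * norm (s u))"
          by (simp flip: exp_add)
        finally have "(norm h)\<^sup>2 * ((norm (s u))\<^sup>2 * exp (norm (h * s u))) \<le> (norm h)\<^sup>2 * (8 / \<rho>\<^sup>2 * exp (\<rho> * norm (s u)))"
          by (rule mult_left_mono) simp
        then show "(norm (h * s u))\<^sup>2 * exp (norm (h * s u)) \<le> (norm h)\<^sup>2 * (8 / \<rho>\<^sup>2) * exp (\<rho> * norm (s u))"
          by (simp add: norm_mult power_mult_distrib mult.assoc)
      qed auto
      also have "\<dots> = (norm h)\<^sup>2 * (8 / \<rho>\<^sup>2) * ?m u"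
        by (simp only: exp_add mult_ac)
      finally show "norm (k u * exp ((c + h) * s u) - k u * exp (c * s u) - h * (k u * s u * exp (c * s u)))
        \<le> (norm h)\<^sup>2 * (8 / \<rho>\<^sup>2) * ?m u" .
    qed
    also have "\<dots> = C * (norm h)\<^sup>2"
      by (simp add: C_def)
    finally show ?thesis .
  qed
  show "(?I has_field_derivative ?D) (at c)"
    unfolding DERIV_def
  proof (rule LIM_zero_cancel, rule Lim_null_comparison)
    show "\<forall>\<^sub>F h in at 0. norm ((?I (c + h) - ?I c) / h - ?D) \<le> C * norm h"
    proof (rule eventually_at_le[THEN iffD2, OF exI[of _ "\<rho> / 2"]])
      have "norm ((?I (c + h) - ?I c) / h - ?D) \<le> C * norm h" if "h \<noteq> 0" "norm h \<le> \<rho> / 2" for h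
      proof -
        have "(?I (c + h) - ?I c) / h - ?D = (?I (c + h) - ?I c - h * ?D) / h"
          using that by (simp add: field_simps)
        then show ?thesis
          using bound[OF that(2)] that(1) by (simp add: norm_divide field_simps power2_eq_square)
      qed
      then show "0 < \<rho> / 2 \<and> (\<forall>h\<in>UNIV. h \<noteq> 0 \<and> dist h 0 \<le> \<rho> / 2 \<longrightarrow>
          norm ((?I (c + h) - ?I c) / h - ?D) \<le> C * norm h)"
        using \<rho> by simp
    qed
    show "((\<lambda>h. C * norm h) \<longlongrightarrow> 0) (at 0)"
      by (intro tendsto_eq_intros) auto
  qed
qed

text \<open>The previous result applied to the kernel \<open>k u * s u\<close>; the additional
  factor \<open>s u\<close> is paid for with half of the slack.\<close>

lemma exp_integral_has_second_field_derivative: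
  fixes k s :: "real \<Rightarrow> complex" and c :: complex
  assumes [measurable]: "k \<in> borel_measurable borel" "s \<in> borel_measurable borel"
    and \<rho>: "\<rho> > 0"
    and int: "integrable lborel (\<lambda>u. norm (k u) * exp (Re (c * s u) + \<rho> * norm (s u)))"
  shows "((\<lambda>c. LINT u|lborel. k u * s u * exp (c * s u)) has_field_derivative
           (LINT u|lborel. k u * s u * s u * exp (c * s u))) (at c)"
proof (rule exp_integral_has_field_derivative(3)[where \<rho> = "\<rho> / 2"])
  let ?m = "\<lambda>u. norm (k u) * exp (Re (c * s u) + \<rho> * norm (s u))"
  show "integrable lborel (\<lambda>u. norm (k u * s u) * exp (Re (c * s u) + \<rho> / 2 * norm (s u)))"
  proof (rule Bochner_Integration.integrable_bound)
    show "integrable lborel (\<lambda>u. 2 / \<rho> * ?m u)"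
      by (intro integrable_mult_right int)
    have "norm (k u * s u) * exp (Re (c * s u) + \<rho> / 2 * norm (s u)) \<le> 2 / \<rho> * ?m u" for u
    proof -
      have "\<rho> / 2 * norm (s u) \<le> exp (\<rho> / 2 * norm (s u))"
        using exp_ge_add_one_self[of "\<rho> / 2 * norm (s u)"] by linarith
      then have "norm (s u) \<le> 2 / \<rho> * exp (\<rho> / 2 * norm (s u))"
        using \<rho> by (simp add: field_simps)
      then have "norm (k u) * exp (Re (c * s u) + \<rho> / 2 * norm (s u)) * norm (s u)
          \<le> norm (k u) * exp (Re (c * s u) + \<rho> / 2 * norm (s u)) * (2 / \<rho> * exp (\<rho> / 2 * norm (s u)))"
        by (rule mult_left_mono) simp
      also have "\<dots> = 2 / \<rho> * (norm (k u) * (exp (Re (c * s u) + \<rho> / 2 * norm (s u)) * exp (\<rho> / 2 * norm (s u))))"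
        by (simp only: mult_ac)
      also have "exp (Re (c * s u) + \<rho> / 2 * norm (s u)) * exp (\<rho> / 2 * norm (s u)) = exp (Re (c * s u) + \<rho> * norm (s u))"
        unfolding exp_add[symmetric] by simp
      finally show ?thesis
        by (simp only: norm_mult mult_ac)
    qed
    then show "AE u in lborel. norm (norm (k u * s u) * exp (Re (c * s u) + \<rho> / 2 * norm (s u)))
        \<le> norm (2 / \<rho> * ?m u)"
      using \<rho> by (intro AE_I2) (simp add: abs_mult)
  qed measurable
qed (use \<rho> in auto)

section \<open>Bounds for the hyperbolic sine\<close>

lemma Re_sinh: "Re (sinh z) = sinh (Re z) * cos (Im z)"
  by (simp add: sinh_field_def Re_exp algebra_simps diff_divide_distrib)

lemma Im_sinh: "Im (sinh z) = cosh (Re z) * sin (Im z)"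
  by (simp add: sinh_field_def cosh_field_def Im_exp algebra_simps add_divide_distrib)

lemma norm_sinh_squared: "(norm (sinh z))\<^sup>2 = (sinh (Re z))\<^sup>2 + (sin (Im z))\<^sup>2"
  by (simp add: cmod_power2 Re_sinh Im_sinh power_mult_distrib cosh_square_eq cos_squared_eq algebra_simps)

lemma abs_le_abs_sinh: "\<bar>x\<bar> \<le> \<bar>sinh x\<bar>" for x :: real
  using real_le_abs_sinh[of x] by (simp add: sinh_field_def exp_minus)

lemma abs_sinh_Re_le_norm_sinh: "\<bar>sinh (Re z)\<bar> \<le> norm (sinh z)"
  by (rule abs_le_square_iff[THEN iffD2, of _ "norm (sinh z)", simplified]) (simp add: norm_sinh_squared)

lemma abs_Re_le_norm_sinh: "\<bar>Re z\<bar> \<le> norm (sinh z)"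
  using abs_le_abs_sinh abs_sinh_Re_le_norm_sinh by (rule order_trans)

lemma abs_sin_Im_le_norm_sinh: "\<bar>sin (Im z)\<bar> \<le> norm (sinh z)"
  by (rule abs_le_square_iff[THEN iffD2, of _ "norm (sinh z)", simplified]) (simp add: norm_sinh_squared)

lemma sinh_neq_0:
  fixes z :: complex
  assumes "Re z \<noteq> 0 \<or> (0 < \<bar>Im z\<bar> \<and> \<bar>Im z\<bar> < pi)"
  shows "sinh z \<noteq> 0"
proof
  assume "sinh z = 0"
  then have "Re z = 0" "sin (Im z) = 0"
    using abs_Re_le_norm_sinh[of z] abs_sin_Im_le_norm_sinh[of z] by simp_all
  moreover from this have "sin \<bar>Im z\<bar> > 0"
    using assms by (intro sin_gt_zero) auto
  ultimately show False
    by (auto simp: abs_if split: if_splits)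
qed

text \<open>For r = a |Re z| >= a one has exp (-r) <= exp (-2a) exp r, hence the constant. It
  degenerates as a tends to 0, which is harmless: it serves only for decay at a fixed b, not for the
  uniform estimate.\<close>

lemma norm_sinh_ge_exp:
  fixes z :: complex
  assumes "a > 0" and "\<bar>Re z\<bar> \<ge> 1"
  shows "(1 - exp (- 2 * a)) / 2 * exp (a * \<bar>Re z\<bar>) \<le> norm (sinh (of_real a * z))"
proof -
  let ?r = "a * \<bar>Re z\<bar>"
  have "a \<le> ?r"
    using assms by simp
  then have "exp (- ?r) \<le> exp (- 2 * a) * exp ?r"
    by (simp flip: exp_add)
  then have "(1 - exp (- 2 * a)) / 2 * exp ?r \<le> sinh ?r"
    by (simp add: sinh_field_def field_simps)
  also have "sinh ?r \<le> \<bar>sinh (Re (of_real a * z))\<bar>"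
    by (cases "Re z \<ge> 0") auto
  also have "\<dots> \<le> norm (sinh (of_real a * z))"
    by (rule abs_sinh_Re_le_norm_sinh)
  finally show ?thesis .
qed

text \<open>From sin x >= x - x^3 / 6 and x^2 <= 4. The bound 2 lies between pi / 2, the height of
  the lines, and pi, where the sine vanishes.\<close>

lemma third_le_sin:
  fixes x :: real
  assumes "0 \<le> x" "x \<le> 2"
  shows "x / 3 \<le> sin x"
proof -
  have "\<bar>sin x - x\<bar> \<le> x ^ 3 / 6"
    using Maclaurin_sin_bound[of x 3] assms
    by (simp add: sin_coeff_def numeral_3_eq_3 lessThan_Suc fact_numeral)
  moreover have "x ^ 3 \<le> 4 * x"
    using mult_mono[of x 2 x 2] assms by (simp add: power3_eq_cube mult_right_mono)
  ultimately show ?thesis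
    by linarith
qed

lemma norm_sinh_ge:
  fixes z :: complex
  assumes "\<bar>Im z\<bar> \<le> 2"
  shows "norm z / 3 \<le> norm (sinh z)"
proof (rule power2_le_imp_le)
  have "\<bar>Im z\<bar> / 3 \<le> \<bar>sin (Im z)\<bar>"
    using third_le_sin[of "\<bar>Im z\<bar>"] assms by (auto simp: abs_if split: if_splits)
  then have "(\<bar>Im z\<bar> / 3)\<^sup>2 \<le> \<bar>sin (Im z)\<bar>\<^sup>2"
    by (intro power_mono) auto
  moreover have "\<bar>Re z\<bar>\<^sup>2 \<le> \<bar>sinh (Re z)\<bar>\<^sup>2"
    by (intro power_mono abs_le_abs_sinh) auto
  moreover have "(norm z / 3)\<^sup>2 = \<bar>Re z\<bar>\<^sup>2 / 9 + (\<bar>Im z\<bar> / 3)\<^sup>2"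
    by (simp add: power_divide cmod_power2)
  moreover have "0 \<le> \<bar>Re z\<bar>\<^sup>2"
    by simp
  ultimately show "(norm z / 3)\<^sup>2 \<le> (norm (sinh z))\<^sup>2"
    unfolding norm_sinh_squared power2_abs by linarith
qed simp

lemma norm_sinh_Taylor_le:
  fixes z :: complex
  assumes "norm z \<le> 1"
  shows "norm (sinh z - z - z ^ 3 / 6) \<le> norm z ^ 5 / 8"
proof -
  \<comment> \<open>The remainder of sinh is the odd part of that of exp, so stopping after degree
    four leaves order five. The factor 1/8 is 3 / 4!, with exp 1 <= 3.\<close>
  define E where "E w = exp w - (\<Sum>i\<le>4. w ^ i / fact i)" for w :: complex
  have E: "norm (E w) \<le> norm z ^ 5 / 8" if "norm w = norm z" for w
  proof -
    have "norm (E w) \<le> exp (norm z) * norm z ^ 5 / 24"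
      using Taylor_exp_field[of w 4] that by (simp add: E_def fact_numeral)
    also have "\<dots> \<le> 3 * norm z ^ 5 / 24"
      using assms exp_le by (intro divide_right_mono mult_right_mono) (auto intro: order_trans[of _ "exp 1"])
    finally show ?thesis
      by simp
  qed
  have "sinh z - z - z ^ 3 / 6 = (E z - E (- z)) / 2"
    by (simp add: E_def sinh_field_def fact_numeral numeral_eq_Suc field_simps)
  also have "norm \<dots> \<le> (norm (E z) + norm (E (- z))) / 2"
    using norm_triangle_ineq4[of "E z" "E (- z)"] by (simp add: norm_divide)
  also have "\<dots> \<le> norm z ^ 5 / 8"
    using E[of z] E[of "- z"] by simp
  finally show ?thesis .
qed

text \<open>The source of the order b^4: it is applied at b^2 s. For |z| <= 1 the cubic numerator z
  - sinh z meets a denominator of size at least |z|^2 / 3; for |z| > 1 the two terms are estimated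
  separately, by 3 / |z| and 1 / |z|.\<close>

lemma norm_inverse_sinh_minus_le:
  fixes z :: complex
  assumes "\<bar>Im z\<bar> \<le> 2" "z \<noteq> 0"
  shows "norm (1 / sinh z - 1 / z) \<le> 4 * norm z"
proof -
  have ge: "norm z / 3 \<le> norm (sinh z)" and pos: "0 < norm z"
    using norm_sinh_ge[OF assms(1)] assms(2) by auto
  then have nz: "sinh z \<noteq> 0"
    by auto
  show ?thesis
  proof (cases "norm z \<le> 1")
    case True
    have "norm (z - sinh z) = norm ((sinh z - z - z ^ 3 / 6) + z ^ 3 / 6)"
      by (simp add: norm_minus_commute)
    also have "\<dots> \<le> norm z ^ 5 / 8 + norm z ^ 3 / 6"
      using norm_sinh_Taylor_le[OF True]
      by (intro order_trans[OF norm_triangle_ineq] add_mono) (auto simp: norm_divide norm_power)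
    also have "\<dots> \<le> norm z ^ 3"
    proof -
      have "norm z ^ 5 \<le> norm z ^ 3" "0 \<le> norm z ^ 3"
        using power_decreasing[of 3 5 "norm z"] True by auto
      then show ?thesis
        by linarith
    qed
    finally have num: "norm (z - sinh z) \<le> norm z ^ 3" .
    have "1 / sinh z - 1 / z = (z - sinh z) / (z * sinh z)"
      using nz assms by (simp add: field_simps)
    also have "norm \<dots> \<le> norm z ^ 3 / (norm z * (norm z / 3))"
      unfolding norm_divide norm_mult using ge pos num by (intro frac_le mult_left_mono) auto
    also have "\<dots> \<le> 4 * norm z"
      using pos by (simp add: power3_eq_cube)
    finally show ?thesis .
  next
    case False
    have "norm (1 / sinh z - 1 / z) \<le> 1 / norm (sinh z) + 1 / norm z"
      using norm_triangle_ineq4[of "1 / sinh z" "1 / z"] by (simp add: norm_divide)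
    also have "\<dots> \<le> 1 / (norm z / 3) + 1 / norm z"
      using ge pos by (intro add_mono divide_left_mono mult_pos_pos) auto
    also have "\<dots> \<le> 4"
      using False pos by (simp add: field_simps)
    also have "\<dots> \<le> 4 * norm z"
      using False by simp
    finally show ?thesis .
  qed
qed

text \<open>One more term than in the previous bound; it is what determines the 1 / s coefficients
  of the kernels at the origin.\<close>

lemma norm_inverse_sinh_expansion_le:
  fixes z :: complex
  assumes "norm z \<le> 1" "z \<noteq> 0"
  shows "norm (1 / sinh z - 1 / z + z / 6) \<le> norm z ^ 3"
proof -
  have "\<bar>Im z\<bar> \<le> 2"
    using abs_Im_le_cmod[of z] assms by simp
  then have ge: "norm z / 3 \<le> norm (sinh z)" and pos: "0 < norm z"
    using norm_sinh_ge assms(2) by auto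
  then have nz: "sinh z \<noteq> 0"
    by auto
  define \<rho> where "\<rho> = sinh z - z - z ^ 3 / 6"
  have \<rho>: "norm \<rho> \<le> norm z ^ 5 / 8"
    unfolding \<rho>_def by (rule norm_sinh_Taylor_le) fact
  have sq: "norm z ^ 2 \<le> 1"
    using assms by (simp add: power_le_one)
  have "norm (z ^ 5 / 6 + z\<^sup>2 * \<rho> - 6 * \<rho>) \<le> norm (z ^ 5 / 6) + norm (z\<^sup>2 * \<rho>) + norm (6 * \<rho>)"
    using norm_triangle_ineq4[of "z ^ 5 / 6 + z\<^sup>2 * \<rho>" "6 * \<rho>"] norm_triangle_ineq[of "z ^ 5 / 6" "z\<^sup>2 * \<rho>"]
    by linarith
  also have "\<dots> = norm z ^ 5 / 6 + (norm z)\<^sup>2 * norm \<rho> + 6 * norm \<rho>"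
    by (simp add: norm_mult norm_divide norm_power)
  also have "\<dots> \<le> norm z ^ 5 / 6 + 1 * norm \<rho> + 6 * norm \<rho>"
    using sq by (intro add_mono mult_right_mono) auto
  also have "\<dots> \<le> 2 * norm z ^ 5"
  proof -
    have "0 \<le> norm z ^ 5"
      by simp
    with \<rho> show ?thesis
      by linarith
  qed
  finally have num: "norm (z ^ 5 / 6 + z\<^sup>2 * \<rho> - 6 * \<rho>) \<le> 2 * norm z ^ 5" .
  have s: "sinh z = z + z ^ 3 / 6 + \<rho>"
    by (simp add: \<rho>_def)
  have "1 / sinh z - 1 / z + z / 6 = (6 * z - 6 * sinh z + z\<^sup>2 * sinh z) / (6 * z * sinh z)"
    using nz assms by (simp add: field_simps power2_eq_square)
  also have "6 * z - 6 * sinh z + z\<^sup>2 * sinh z = z ^ 5 / 6 + z\<^sup>2 * \<rho> - 6 * \<rho>"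
    unfolding s by (simp add: algebra_simps numeral_eq_Suc)
  also have "norm ((z ^ 5 / 6 + z\<^sup>2 * \<rho> - 6 * \<rho>) / (6 * z * sinh z)) \<le> 2 * norm z ^ 5 / (6 * norm z * (norm z / 3))"
    unfolding norm_divide norm_mult using ge pos num by (intro frac_le mult_left_mono) auto
  also have "\<dots> = norm z ^ 3"
    using pos by (simp add: field_simps numeral_eq_Suc)
  finally show ?thesis .
qed

section \<open>Exponential integrals of odd kernels\<close>

text \<open>Removing 0 and the part of the imaginary axis beyond i pi and - i pi removes all zeros
  of sinh s and, as b < 1, also those of sinh (b^2 s). One domain therefore serves all
  kernels.\<close>

definition kernel_domain :: "complex set" where
  "kernel_domain = {s. Re s \<noteq> 0 \<or> (0 < \<bar>Im s\<bar> \<and> \<bar>Im s\<bar> < pi)}"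

definition hline :: "real \<Rightarrow> real \<Rightarrow> complex" where
  "hline y u = Complex u y"

definition parab :: "real \<Rightarrow> complex" where
  "parab u = Complex u (- (pi / 2 + u\<^sup>2))"

definition parab' :: "real \<Rightarrow> complex" where
  "parab' u = Complex 1 (- (2 * u))"

text \<open>Each of the two slit regions keeps only one window of the imaginary axis, below or above
  the pole at 0. This makes them star-shaped, so that holomorphic functions have primitives
  there.\<close>

definition lower_slit :: "complex set" where
  "lower_slit = {s. Re s \<noteq> 0 \<or> (- pi < Im s \<and> Im s < 0)}"

definition upper_slit :: "complex set" where
  "upper_slit = {s. Re s \<noteq> 0 \<or> (0 < Im s \<and> Im s < pi)}"

lemma Re_hline [simp]: "Re (hline y u) = u" and Im_hline [simp]: "Im (hline y u) = y"
  by (simp_all add: hline_def)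

lemma Re_parab [simp]: "Re (parab u) = u" and Im_parab [simp]: "Im (parab u) = - (pi / 2 + u\<^sup>2)"
  by (simp_all add: parab_def)

lemma hline_has_vector_derivative: "(hline y has_vector_derivative 1) (at u)"
  unfolding hline_def has_vector_derivative_complex_iff by (auto intro!: derivative_eq_intros)

lemma parab_has_vector_derivative: "(parab has_vector_derivative parab' u) (at u)"
  unfolding parab_def parab'_def has_vector_derivative_complex_iff by (auto intro!: derivative_eq_intros)

lemma continuous_on_hline: "continuous_on S (hline y)"
  unfolding hline_def Complex_eq by (intro continuous_intros)

lemma continuous_on_parab: "continuous_on S parab"
  unfolding parab_def Complex_eq by (intro continuous_intros)

lemma continuous_on_parab': "continuous_on S parab'"
  unfolding parab'_def Complex_eq by (intro continuous_intros)

lemma hline_in: "\<bar>y\<bar> = pi / 2 \<Longrightarrow> hline y u \<in> kernel_domain"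
  using pi_gt_zero unfolding kernel_domain_def mem_Collect_eq Re_hline Im_hline by linarith

lemma parab_in: "parab u \<in> kernel_domain"
  using pi_gt_zero by (cases "u = 0") (auto simp: kernel_domain_def)

lemma norm_parab'_le: "norm (parab' u) \<le> 2 * exp \<bar>u\<bar>"
proof -
  have "norm (parab' u) \<le> 1 + 2 * \<bar>u\<bar>"
    using cmod_le[of "parab' u"] by (simp add: parab'_def abs_mult)
  also have "\<dots> \<le> 2 * exp \<bar>u\<bar>"
    using exp_ge_add_one_self[of "\<bar>u\<bar>"] by linarith
  finally show ?thesis .
qed

lemma open_lower_slit: "open lower_slit"
proof -
  have "lower_slit = {s. Re s \<noteq> 0} \<union> {s. - pi < Im s} \<inter> {s. Im s < 0}"
    by (auto simp: lower_slit_def)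
  also have "open \<dots>"
    by (intro open_Un open_Int open_Collect_neq open_Collect_less continuous_intros)
  finally show ?thesis .
qed

lemma open_upper_slit: "open upper_slit"
proof -
  have "upper_slit = {s. Re s \<noteq> 0} \<union> {s. 0 < Im s} \<inter> {s. Im s < pi}"
    by (auto simp: upper_slit_def)
  also have "open \<dots>"
    by (intro open_Un open_Int open_Collect_neq open_Collect_less continuous_intros)
  finally show ?thesis .
qed

text \<open>The centre is a point of the window on the imaginary axis. A segment towards a point off
  the axis leaves the axis at once; a segment towards a point on it stays in the window by
  convexity.\<close>

lemma starlike_slit:
  assumes "y1 < y0" "y0 < y2"
  shows "starlike {s. Re s \<noteq> 0 \<or> (y1 < Im s \<and> Im s < y2)}" (is "starlike ?S")
  unfolding starlike_def
proof (intro bexI[of _ "Complex 0 y0"] ballI subsetI)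
  fix x s assume x: "x \<in> ?S" and "s \<in> closed_segment (Complex 0 y0) x"
  then obtain t where t: "0 \<le> t" "t \<le> 1" "s = (1 - t) *\<^sub>R Complex 0 y0 + t *\<^sub>R x"
    by (auto simp: in_segment)
  show "s \<in> ?S"
  proof (cases "Re x \<noteq> 0 \<and> t \<noteq> 0")
    case False
    then have "y1 < Im s \<and> Im s < y2"
    proof (cases "t = 0")
      case False
      with \<open>\<not> (Re x \<noteq> 0 \<and> t \<noteq> 0)\<close> x have "Im x \<in> {y1<..<y2}"
        by auto
      moreover have "y0 \<in> {y1<..<y2}"
        using assms by simp
      ultimately have "(1 - t) *\<^sub>R y0 + t *\<^sub>R Im x \<in> {y1<..<y2}"
        using t by (intro convexD_alt convex_real_interval) auto
      then show ?thesis
        using t by simp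
    qed (use assms t in auto)
    then show ?thesis
      by simp
  qed (use t in simp)
qed (use assms in auto)

lemma starlike_lower_slit: "starlike lower_slit" and starlike_upper_slit: "starlike upper_slit"
  unfolding lower_slit_def upper_slit_def
  using starlike_slit[of "- pi" "- pi / 2" 0] starlike_slit[of 0 "pi / 2" pi] pi_gt_zero by simp_all

lemma holomorphic_on_starlike_has_primitive:
  fixes f :: "complex \<Rightarrow> complex"
  assumes "open S" "starlike S" "f holomorphic_on S"
  obtains P where "\<And>z. z \<in> S \<Longrightarrow> (P has_field_derivative f z) (at z)"
proof -
  have "\<exists>g. \<forall>x \<in> S. (g has_field_derivative f x) (at x)"
    by (rule holomorphic_starlike_primitive[where k = "{}"])
       (use assms in \<open>auto intro: holomorphic_on_imp_continuous_on holomorphic_on_imp_differentiable_at\<close>)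
  then show thesis
    using that by blast
qed

lemma Re_closed_segment_eq:
  assumes "s \<in> closed_segment a b" "Re a = x" "Re b = x"
  shows "Re s = x"
proof -
  obtain t where "s = (1 - t) *\<^sub>R a + t *\<^sub>R b"
    using assms by (auto simp: in_segment)
  then have "Re s = (1 - t) * x + t * x"
    using assms by simp
  then show ?thesis
    by (simp add: algebra_simps)
qed

lemma Im_closed_segment_bounds:
  assumes "s \<in> closed_segment a b" "Im a \<in> {l..r}" "Im b \<in> {l..r}"
  shows "Im s \<in> {l..r}"
proof -
  obtain t where t: "0 \<le> t" "t \<le> 1" "s = (1 - t) *\<^sub>R a + t *\<^sub>R b"
    using assms by (auto simp: in_segment)
  have "(1 - t) *\<^sub>R Im a + t *\<^sub>R Im b \<in> {l..r}"
    using t assms by (intro convexD_alt convex_real_interval) auto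
  then show ?thesis
    using t by simp
qed

text \<open>The connecting segment at abscissa \<open>\<sigma> * x\<close> contributes at most the
  maximum \<open>E x\<close> of the integrand times the length \<open>len x\<close>. The sign
  \<open>\<sigma>\<close> allows one statement for the left and the right end.\<close>

lemma vertical_difference_tendsto_0_aux:
  fixes a b :: "real \<Rightarrow> complex" and E len :: "real \<Rightarrow> real"
  assumes lim: "((\<lambda>x. E x * len x) \<longlongrightarrow> 0) at_top"
    and Re: "\<And>x. Re (a x) = \<sigma> * x" "\<And>x. Re (b x) = \<sigma> * x" and \<sigma>: "\<bar>\<sigma>\<bar> = 1"
    and P: "\<And>x s. 1 \<le> x \<Longrightarrow> s \<in> closed_segment (a x) (b x) \<Longrightarrow> \<bar>Re s\<bar> = x \<Longrightarrow> (P has_field_derivative f s) (at s)"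
    and E: "\<And>x s. 1 \<le> x \<Longrightarrow> s \<in> closed_segment (a x) (b x) \<Longrightarrow> \<bar>Re s\<bar> = x \<Longrightarrow> norm (f s) \<le> E x"
    and len: "\<And>x. norm (a x - b x) \<le> len x"
  shows "((\<lambda>x. P (a x) - P (b x)) \<longlongrightarrow> 0) at_top"
proof (rule Lim_null_comparison[OF _ lim])
  show "\<forall>\<^sub>F x in at_top. norm (P (a x) - P (b x)) \<le> E x * len x"
    using eventually_ge_at_top[of 1]
  proof eventually_elim
    fix x :: real assume x: "1 \<le> x"
    have r: "\<bar>Re s\<bar> = x" if "s \<in> closed_segment (a x) (b x)" for s
      using Re_closed_segment_eq[OF that Re] \<sigma> x by (simp add: abs_mult)
    have "norm (P (a x) - P (b x)) \<le> E x * norm (a x - b x)"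
      by (rule field_differentiable_bound[OF convex_closed_segment])
         (auto intro: has_field_derivative_at_within P E x r)
    also have "\<dots> \<le> E x * len x"
      using E[OF x, of "a x"] r[of "a x"] by (intro mult_left_mono len) (auto intro: order_trans[OF norm_ge_zero])
    finally show "norm (P (a x) - P (b x)) \<le> E x * len x" .
  qed
qed

text \<open>Oddness excludes a 1 / s^2 term, so \<open>\<alpha>\<close> and \<open>\<beta>\<close>
  describe the whole principal part. The rate \<open>m\<close> bounds |Re c| in the horizontal
  integrals. The instances are \<open>kernelb\<close>, \<open>kernel0\<close>, the error kernel
  \<open>kernelW\<close>, and 1 / sinh s.\<close>

locale odd_kernel =
  fixes G :: "complex \<Rightarrow> complex" and \<alpha> \<beta> :: complex and m :: real
  assumes hol: "G holomorphic_on kernel_domain"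
    and odd: "\<And>s. G (- s) = - G s"
    and polar: "(\<lambda>s. G s - \<alpha> / s ^ 3 - \<beta> / s) \<in> O[at 0](\<lambda>_. 1)"
    and m_pos: "0 < m"
    and decay: "\<exists>A. \<forall>s. 1 \<le> \<bar>Re s\<bar> \<longrightarrow> norm (G s) \<le> A * exp (- m * \<bar>Re s\<bar>)"
begin

definition line_int :: "real \<Rightarrow> complex \<Rightarrow> complex" where
  "line_int y c = (LINT u|lborel. G (hline y u) * exp (c * hline y u))"

definition parab_int :: "complex \<Rightarrow> complex" where
  "parab_int c = (LINT u|lborel. G (parab u) * parab' u * exp (c * parab u))"

text \<open>The residue of \<open>exp (c s) G s\<close> at \<open>s = 0\<close>.\<close>
definition res :: "complex \<Rightarrow> complex" where
  "res c = \<alpha> * c\<^sup>2 / 2 + \<beta>"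

definition mean_int :: "complex \<Rightarrow> complex" where
  "mean_int c = (line_int (pi / 2) c + line_int (- (pi / 2)) c) / 2"

text \<open>The lower line exceeds the mean by half of the residue term
  \<open>2 * pi * \<i> * res c\<close>; hence the correction of \<open>parab_int\<close>. The upper
  half plane is prescribed by oddness, and the last case is meant for real c with |c| < m.\<close>

definition ext_int :: "complex \<Rightarrow> complex" where
  "ext_int c = (if Im c < 0 then parab_int c - pi * \<i> * res c
             else if Im c > 0 then - (parab_int (- c) - pi * \<i> * res (- c))
             else mean_int c)"

section \<open>Convergence of the line and parabola integrals, and their holomorphy in
  \<open>c\<close>\<close>

lemma curve_continuous:
  assumes "continuous_on UNIV \<gamma>" "\<And>u. \<gamma> u \<in> kernel_domain"
  shows "continuous_on UNIV (\<lambda>u. G (\<gamma> u))"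
  by (rule continuous_on_compose2[OF holomorphic_on_imp_continuous_on[OF hol] assms(1)]) (use assms in auto)

lemma curve_bound:
  fixes \<gamma> :: "real \<Rightarrow> complex"
  assumes "continuous_on UNIV \<gamma>" "\<And>u. \<gamma> u \<in> kernel_domain" "\<And>u. Re (\<gamma> u) = u"
  obtains A where "A \<ge> 0" "\<And>u. norm (G (\<gamma> u)) \<le> A * exp (- m * \<bar>u\<bar>)"
proof -
  from decay obtain A where A: "\<And>s. 1 \<le> \<bar>Re s\<bar> \<Longrightarrow> norm (G s) \<le> A * exp (- m * \<bar>Re s\<bar>)"
    by blast
  have "continuous_on {-1..1} (\<lambda>u. G (\<gamma> u))"
    using curve_continuous[OF assms(1,2)] by (rule continuous_on_subset) simp
  then have "bounded ((\<lambda>u. G (\<gamma> u)) ` {-1..1})"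
    by (intro compact_imp_bounded compact_continuous_image) auto
  then obtain B where B: "B > 0" "\<And>u. u \<in> {-1..1} \<Longrightarrow> norm (G (\<gamma> u)) \<le> B"
    unfolding bounded_pos by blast
  show thesis
  \<comment> \<open>\<open>A\<close> is the decay constant for |u| >= 1 and \<open>B\<close> the
    maximum over the compact middle piece; the factor exp m makes up for exp (- m |u|) >= exp (- m)
    there.\<close>
  proof (rule that[of "max A (B * exp m)"])
    show "max A (B * exp m) \<ge> 0"
      using B(1) by (simp add: le_max_iff_disj)
    fix u :: real
    show "norm (G (\<gamma> u)) \<le> max A (B * exp m) * exp (- m * \<bar>u\<bar>)"
    proof (cases "1 \<le> \<bar>u\<bar>")
      case True
      then have "norm (G (\<gamma> u)) \<le> A * exp (- m * \<bar>u\<bar>)"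
        using A[of "\<gamma> u"] assms(3) by simp
      also have "\<dots> \<le> max A (B * exp m) * exp (- m * \<bar>u\<bar>)"
        by (intro mult_right_mono) auto
      finally show ?thesis .
    next
      case False
      then have "norm (G (\<gamma> u)) \<le> B * 1"
        using B(2)[of u] by (auto simp: abs_if split: if_splits)
      also have "\<dots> \<le> B * (exp m * exp (- m * \<bar>u\<bar>))"
        using False B(1) m_pos by (intro mult_left_mono) (auto simp flip: exp_add)
      also have "\<dots> \<le> max A (B * exp m) * exp (- m * \<bar>u\<bar>)"
        by (simp flip: mult.assoc)
      finally show ?thesis .
    qed
  qed
qed

lemma line_int_majorant:
  assumes y: "\<bar>y\<bar> = pi / 2" and c: "\<bar>Re c\<bar> < m"
  shows "\<exists>\<rho>>0. integrable lborel (\<lambda>u. norm (G (hline y u)) * exp (Re (c * hline y u) + \<rho> * norm (hline y u)))"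
proof (intro exI conjI)
  \<comment> \<open>Half of the surplus decay is spent on the slack, the other half remains as the
    integrable factor exp (- \<open>\<rho>\<close> |u|).\<close>
  define \<rho> where "\<rho> = (m - \<bar>Re c\<bar>) / 2"
  show \<rho>: "\<rho> > 0"
    using c by (simp add: \<rho>_def)
  obtain A where A: "A \<ge> 0" "\<And>u. norm (G (hline y u)) \<le> A * exp (- m * \<bar>u\<bar>)"
    using curve_bound[OF continuous_on_hline hline_in[OF y]] by auto
  have [measurable]: "(\<lambda>u. G (hline y u)) \<in> borel_measurable borel" "hline y \<in> borel_measurable borel"
    using curve_continuous[OF continuous_on_hline hline_in[OF y]] continuous_on_hline
    by (auto intro: borel_measurable_continuous_onI)
  let ?M = "A * exp ((\<bar>Im c\<bar> + \<rho>) * \<bar>y\<bar>)"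
  show "integrable lborel (\<lambda>u. norm (G (hline y u)) * exp (Re (c * hline y u) + \<rho> * norm (hline y u)))"
  proof (rule Bochner_Integration.integrable_bound)
    show "integrable lborel (\<lambda>u. ?M * exp (- \<rho> * \<bar>u\<bar>))"
      using integrable_exp_neg_abs[OF \<rho>] by simp
    have "norm (norm (G (hline y u)) * exp (Re (c * hline y u) + \<rho> * norm (hline y u)))
        \<le> ?M * exp (- \<rho> * \<bar>u\<bar>)" for u
    proof -
      have "Re (c * hline y u) \<le> \<bar>Re c\<bar> * \<bar>u\<bar> + \<bar>Im c\<bar> * \<bar>y\<bar>"
        using abs_triangle_ineq4[of "Re c * u" "Im c * y"] by (simp add: abs_mult)
      moreover have "\<rho> * norm (hline y u) \<le> \<rho> * (\<bar>u\<bar> + \<bar>y\<bar>)"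
        using \<rho> cmod_le[of "hline y u"] by (intro mult_left_mono) auto
      ultimately have "Re (c * hline y u) + \<rho> * norm (hline y u) \<le>
          (m - \<rho>) * \<bar>u\<bar> + (\<bar>Im c\<bar> + \<rho>) * \<bar>y\<bar>"
        by (simp add: \<rho>_def field_simps)
      then have "norm (G (hline y u)) * exp (Re (c * hline y u) + \<rho> * norm (hline y u))
          \<le> (A * exp (- m * \<bar>u\<bar>)) * exp ((m - \<rho>) * \<bar>u\<bar> + (\<bar>Im c\<bar> + \<rho>) * \<bar>y\<bar>)"
        by (intro mult_mono A) (use A in auto)
      also have "\<dots> = A * exp (- m * \<bar>u\<bar> + ((m - \<rho>) * \<bar>u\<bar> + (\<bar>Im c\<bar> + \<rho>) * \<bar>y\<bar>))"
        by (simp only: exp_add mult_ac)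
      also have "- m * \<bar>u\<bar> + ((m - \<rho>) * \<bar>u\<bar> + (\<bar>Im c\<bar> + \<rho>) * \<bar>y\<bar>) = (\<bar>Im c\<bar> + \<rho>) * \<bar>y\<bar> + - \<rho> * \<bar>u\<bar>"
        by (simp add: algebra_simps)
      finally show ?thesis
        unfolding exp_add by (simp only: real_norm_def abs_mult abs_norm_cancel abs_exp_cancel mult.assoc)
    qed
    then show "AE u in lborel. norm (norm (G (hline y u)) * exp (Re (c * hline y u) + \<rho> * norm (hline y u)))
        \<le> norm (?M * exp (- \<rho> * \<bar>u\<bar>))"
      unfolding real_norm_def by (intro AE_I2) (rule order_trans[OF _ abs_ge_self])
  qed measurable
qed

lemma parab_int_majorant:
  assumes c: "Im c < 0"
  shows "\<exists>\<rho>>0. integrable lborel (\<lambda>u. norm (G (parab u) * parab' u) * exp (Re (c * parab u) + \<rho> * norm (parab u)))"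
proof (intro exI conjI)
  \<comment> \<open>Along the parabola exp (c s) decays with Gaussian rate - Im c = 2
    \<open>\<rho>\<close>. Since |s| is itself quadratic in u, the slack consumes one
    \<open>\<rho>\<close> and leaves the other.\<close>
  define \<rho> where "\<rho> = - Im c / 2"
  show \<rho>: "\<rho> > 0"
    using c by (simp add: \<rho>_def)
  obtain A where A: "A \<ge> 0" "\<And>u. norm (G (parab u)) \<le> A * exp (- m * \<bar>u\<bar>)"
    using curve_bound[OF continuous_on_parab parab_in] by auto
  have A': "norm (G (parab u)) \<le> A" for u
  proof -
    have "A * exp (- m * \<bar>u\<bar>) \<le> A * 1"
      using A(1) m_pos by (intro mult_left_mono) auto
    with A(2)[of u] show ?thesis
      by simp
  qed
  have [measurable]: "(\<lambda>u. G (parab u)) \<in> borel_measurable borel" "parab \<in> borel_measurable borel"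
     "parab' \<in> borel_measurable borel"
    using curve_continuous[OF continuous_on_parab parab_in] continuous_on_parab continuous_on_parab'
    by (auto intro: borel_measurable_continuous_onI)
  \<comment> \<open>The summand 1 accounts for the bound 2 exp |u| on the velocity of the
    parabola.\<close>
  let ?B = "\<bar>Re c\<bar> + \<rho> + 1"
  let ?M = "2 * A * exp ((?B + 1)\<^sup>2 / (4 * \<rho>))"
  show "integrable lborel (\<lambda>u. norm (G (parab u) * parab' u) * exp (Re (c * parab u) + \<rho> * norm (parab u)))"
  proof (rule Bochner_Integration.integrable_bound)
    show "integrable lborel (\<lambda>u. ?M * exp (- 1 * \<bar>u\<bar>))"
      by (intro integrable_mult_right integrable_exp_neg_abs) simp
    have "norm (norm (G (parab u) * parab' u) * exp (Re (c * parab u) + \<rho> * norm (parab u)))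
        \<le> ?M * exp (- 1 * \<bar>u\<bar>)" for u
    proof -
      have "Re c * u \<le> \<bar>Re c\<bar> * \<bar>u\<bar>"
        using abs_ge_self[of "Re c * u"] by (simp add: abs_mult)
      then have "Re (c * parab u) \<le> \<bar>Re c\<bar> * \<bar>u\<bar> - 2 * \<rho> * (pi / 2 + u\<^sup>2)"
        by (simp add: \<rho>_def algebra_simps)
      moreover have "\<rho> * norm (parab u) \<le> \<rho> * (\<bar>u\<bar> + (pi / 2 + u\<^sup>2))"
      proof (rule mult_left_mono)
        have "\<bar>Im (parab u)\<bar> = pi / 2 + u\<^sup>2"
          unfolding Im_parab abs_minus_cancel by (rule abs_of_nonneg) simp
        then show "norm (parab u) \<le> \<bar>u\<bar> + (pi / 2 + u\<^sup>2)"
          using cmod_le[of "parab u"] by simp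
      qed (use \<rho> in simp)
      moreover have "0 \<le> \<rho> * (pi / 2)"
        using \<rho> by simp
      ultimately have "Re (c * parab u) + \<rho> * norm (parab u) \<le> (\<bar>Re c\<bar> + \<rho>) * \<bar>u\<bar> - \<rho> * u\<^sup>2"
        by (simp add: algebra_simps)
      then have "norm (G (parab u) * parab' u) * exp (Re (c * parab u) + \<rho> * norm (parab u))
          \<le> (A * (2 * exp \<bar>u\<bar>)) * exp ((\<bar>Re c\<bar> + \<rho>) * \<bar>u\<bar> - \<rho> * u\<^sup>2)"
        unfolding norm_mult by (intro mult_mono A' norm_parab'_le) (use A in auto)
      also have "\<dots> = 2 * A * exp (?B * \<bar>u\<bar> - \<rho> * u\<^sup>2)"
      proof -
        have "(p + 1) * v - q = v + (p * v - q)" for p q v :: real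
          by (simp add: algebra_simps)
        note * = this[of "\<bar>Re c\<bar> + \<rho>" "\<bar>u\<bar>" "\<rho> * u\<^sup>2"]
        have "A * (2 * p) * q = 2 * A * (p * q)" for p q
          by simp
        then show ?thesis
          unfolding * exp_add[of "\<bar>u\<bar>"] .
      qed
      also have "\<dots> \<le> 2 * A * (exp ((?B + 1)\<^sup>2 / (4 * \<rho>)) * exp (- 1 * \<bar>u\<bar>))"
        by (rule mult_left_mono[OF exp_neg_square_le_exp_neg_abs[OF \<rho>]]) (use A(1) in simp)
      finally show ?thesis
        by (simp only: real_norm_def abs_mult abs_norm_cancel abs_exp_cancel mult.assoc)
    qed
    then show "AE u in lborel. norm (norm (G (parab u) * parab' u) * exp (Re (c * parab u) + \<rho> * norm (parab u)))
        \<le> norm (?M * exp (- 1 * \<bar>u\<bar>))"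
      unfolding real_norm_def by (intro AE_I2) (rule order_trans[OF _ abs_ge_self])
  qed measurable
qed

lemma
  assumes y: "\<bar>y\<bar> = pi / 2" and c: "\<bar>Re c\<bar> < m"
  shows integrable_line_int: "integrable lborel (\<lambda>u. G (hline y u) * exp (c * hline y u))"
    and integrable_line_int_deriv: "integrable lborel (\<lambda>u. G (hline y u) * hline y u * exp (c * hline y u))"
    and line_int_has_field_derivative:
      "(line_int y has_field_derivative (LINT u|lborel. G (hline y u) * hline y u * exp (c * hline y u))) (at c)"
proof -
  obtain \<rho> where \<rho>: "\<rho> > 0"
    "integrable lborel (\<lambda>u. norm (G (hline y u)) * exp (Re (c * hline y u) + \<rho> * norm (hline y u)))"
    using line_int_majorant[OF assms] by blast
  have "(\<lambda>u. G (hline y u)) \<in> borel_measurable borel" "hline y \<in> borel_measurable borel"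
    using curve_continuous[OF continuous_on_hline hline_in[OF y]] continuous_on_hline
    by (auto intro: borel_measurable_continuous_onI)
  note * = exp_integral_has_field_derivative[OF this \<rho>]
  show "integrable lborel (\<lambda>u. G (hline y u) * exp (c * hline y u))"
    "integrable lborel (\<lambda>u. G (hline y u) * hline y u * exp (c * hline y u))"
    "(line_int y has_field_derivative (LINT u|lborel. G (hline y u) * hline y u * exp (c * hline y u))) (at c)"
    unfolding line_int_def[abs_def] by (fact *)+
qed

lemma
  assumes c: "Im c < 0"
  shows integrable_parab_int: "integrable lborel (\<lambda>u. G (parab u) * parab' u * exp (c * parab u))"
    and parab_int_field_differentiable: "parab_int field_differentiable at c"
proof -
  obtain \<rho> where \<rho>: "\<rho> > 0"
    "integrable lborel (\<lambda>u. norm (G (parab u) * parab' u) * exp (Re (c * parab u) + \<rho> * norm (parab u)))"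
    using parab_int_majorant[OF assms] by blast
  have "(\<lambda>u. G (parab u) * parab' u) \<in> borel_measurable borel" "parab \<in> borel_measurable borel"
    using curve_continuous[OF continuous_on_parab parab_in] continuous_on_parab continuous_on_parab'
    by (auto intro!: borel_measurable_continuous_onI continuous_on_mult)
  note * = exp_integral_has_field_derivative[OF this \<rho>]
  show "integrable lborel (\<lambda>u. G (parab u) * parab' u * exp (c * parab u))"
    by (fact *(1))
  show "parab_int field_differentiable at c"
    using *(3) unfolding parab_int_def[abs_def] field_differentiable_def by blast
qed

lemma line_int_holomorphic: "\<bar>y\<bar> = pi / 2 \<Longrightarrow> line_int y holomorphic_on {c. \<bar>Re c\<bar> < m}"
  using line_int_has_field_derivative
  by (auto simp: holomorphic_on_def field_differentiable_def intro: has_field_derivative_at_within)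

lemma parab_int_holomorphic: "parab_int holomorphic_on {c. Im c < 0}"
  using parab_int_field_differentiable by (auto simp: holomorphic_on_def intro: field_differentiable_at_within)

lemma line_int_minus: "line_int y (- c) = - line_int (- y) c"
proof -
  have "hline y (- u) = - hline (- y) u" for u
    by (simp add: hline_def complex_eq_iff)
  then show ?thesis
    using lborel_integral_real_affine[of "- 1" "\<lambda>u. G (hline y u) * exp (- c * hline y u)" 0]
    by (simp add: line_int_def odd)
qed

lemma mean_int_minus: "mean_int (- c) = - mean_int c"
  by (simp add: mean_int_def line_int_minus field_simps)

lemma ext_int_minus: "ext_int (- c) = - ext_int c"
  by (auto simp: ext_int_def mean_int_minus)

section \<open>Contour shifts between the lines, the parabola and the real axis\<close>

lemma exp_kernel_bound:
  obtains C where "C \<ge> 0" "\<And>s. 1 \<le> \<bar>Re s\<bar> \<Longrightarrow>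
    norm (G s * exp (c * s)) \<le> C * exp (- (m - \<bar>Re c\<bar>) * \<bar>Re s\<bar>) * exp (- Im c * Im s)"
proof -
  from decay obtain A where A: "\<And>s. 1 \<le> \<bar>Re s\<bar> \<Longrightarrow> norm (G s) \<le> A * exp (- m * \<bar>Re s\<bar>)"
    by blast
  show thesis
  proof (rule that[of "\<bar>A\<bar>"])
    fix s assume s: "1 \<le> \<bar>Re s\<bar>"
    have "Re c * Re s \<le> \<bar>Re c\<bar> * \<bar>Re s\<bar>"
      using abs_ge_self[of "Re c * Re s"] by (simp add: abs_mult)
    then have "Re (c * s) \<le> \<bar>Re c\<bar> * \<bar>Re s\<bar> + - Im c * Im s"
      by simp
    moreover have "norm (G s) \<le> \<bar>A\<bar> * exp (- m * \<bar>Re s\<bar>)"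
      using A[OF s] by (rule order_trans[OF _ mult_right_mono[OF abs_ge_self]]) simp
    ultimately have "norm (G s * exp (c * s)) \<le>
        (\<bar>A\<bar> * exp (- m * \<bar>Re s\<bar>)) * exp (\<bar>Re c\<bar> * \<bar>Re s\<bar> + - Im c * Im s)"
      unfolding norm_mult norm_exp_eq_Re by (intro mult_mono) auto
    also have "\<dots> = \<bar>A\<bar> * exp (- m * \<bar>Re s\<bar> + \<bar>Re c\<bar> * \<bar>Re s\<bar>) * exp (- Im c * Im s)"
      by (simp only: exp_add mult_ac)
    also have "- m * \<bar>Re s\<bar> + \<bar>Re c\<bar> * \<bar>Re s\<bar> = - (m - \<bar>Re c\<bar>) * \<bar>Re s\<bar>"
      by (simp add: algebra_simps)
    finally show "norm (G s * exp (c * s)) \<le> \<bar>A\<bar> * exp (- (m - \<bar>Re c\<bar>) * \<bar>Re s\<bar>) * exp (- Im c * Im s)" .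
  qed simp
qed

text \<open>The length is allowed to grow quadratically because that is the distance between the
  line and the parabola; the exponential decay left by |Re c| < m wins. \<open>M\<close> controls
  the factor that depends on the height.\<close>

lemma vertical_difference_tendsto_0:
  fixes a b :: "real \<Rightarrow> complex"
  assumes c: "\<bar>Re c\<bar> < m"
    and P: "\<And>s. Re s \<noteq> 0 \<Longrightarrow> (P has_field_derivative G s * exp (c * s)) (at s)"
    and Re: "\<And>x. Re (a x) = \<sigma> * x" "\<And>x. Re (b x) = \<sigma> * x" and \<sigma>: "\<bar>\<sigma>\<bar> = 1"
    and M: "\<And>x s. s \<in> closed_segment (a x) (b x) \<Longrightarrow> - Im c * Im s \<le> M"
    and len: "\<And>x. norm (a x - b x) \<le> 2 + x\<^sup>2 + D"
  shows "((\<lambda>x. P (a x) - P (b x)) \<longlongrightarrow> 0) at_top"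
proof -
  define \<rho> where "\<rho> = m - \<bar>Re c\<bar>"
  have \<rho>: "\<rho> > 0"
    using c by (simp add: \<rho>_def)
  obtain C where C: "C \<ge> 0" "\<And>s. 1 \<le> \<bar>Re s\<bar> \<Longrightarrow>
      norm (G s * exp (c * s)) \<le> C * exp (- \<rho> * \<bar>Re s\<bar>) * exp (- Im c * Im s)"
    using exp_kernel_bound[of c] unfolding \<rho>_def by blast
  show ?thesis
  proof (rule vertical_difference_tendsto_0_aux[OF _ Re \<sigma>])
    show "((\<lambda>x. (C * exp (- \<rho> * x) * exp M) * (2 + x\<^sup>2 + D)) \<longlongrightarrow> 0) at_top"
      using \<rho> by real_asymp
    fix x s
    assume s: "1 \<le> x" "s \<in> closed_segment (a x) (b x)" "\<bar>Re s\<bar> = x"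
    then show "(P has_field_derivative G s * exp (c * s)) (at s)"
      by (intro P) auto
    have "norm (G s * exp (c * s)) \<le> C * exp (- \<rho> * x) * exp (- Im c * Im s)"
      using C(2)[of s] s by simp
    also have "\<dots> \<le> C * exp (- \<rho> * x) * exp M"
      using M[OF s(2)] C(1) by (intro mult_left_mono) auto
    finally show "norm (G s * exp (c * s)) \<le> C * exp (- \<rho> * x) * exp M" .
  qed (rule len)
qed

lemma exp_kernel_holomorphic: "S \<subseteq> kernel_domain \<Longrightarrow> (\<lambda>s. G s * exp (c * s)) holomorphic_on S"
  by (intro holomorphic_intros holomorphic_on_subset[OF hol])

lemma line_int_eq_parab_int:
  assumes c: "\<bar>Re c\<bar> < m" "Im c < 0"
  shows "line_int (- (pi / 2)) c = parab_int c"
proof -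
  let ?F = "\<lambda>s. G s * exp (c * s)"
  have "?F holomorphic_on lower_slit"
    by (rule exp_kernel_holomorphic) (auto simp: lower_slit_def kernel_domain_def)
  then obtain P where P: "\<And>s. s \<in> lower_slit \<Longrightarrow> (P has_field_derivative ?F s) (at s)"
    using holomorphic_on_starlike_has_primitive[OF open_lower_slit starlike_lower_slit] by blast
  have P': "Re s \<noteq> 0 \<Longrightarrow> (P has_field_derivative ?F s) (at s)" for s
    by (rule P) (simp add: lower_slit_def)
  have lim: "((\<lambda>x. P (hline (- (pi / 2)) (\<sigma> * x)) - P (parab (\<sigma> * x))) \<longlongrightarrow> 0) at_top" if \<sigma>: "\<bar>\<sigma>\<bar> = 1" for \<sigma>
  \<comment> \<open>\<open>M = 0\<close> works because the segments lie in the lower half plane and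
    Im c < 0, so descending only decreases |exp (c s)|.\<close>
  proof (rule vertical_difference_tendsto_0[where \<sigma> = \<sigma> and M = 0 and D = 0, OF c(1) P'])
    fix x s
    assume s: "s \<in> closed_segment (hline (- (pi / 2)) (\<sigma> * x)) (parab (\<sigma> * x))"
    have "Im s \<in> {- (pi / 2 + (\<sigma> * x)\<^sup>2)..0}"
      using s by (rule Im_closed_segment_bounds) (auto intro: order_trans[OF _ zero_le_power2])
    then show "- Im c * Im s \<le> 0"
      using c by (simp add: mult_nonpos_nonpos)
  next
    fix x
    have "\<sigma>\<^sup>2 = 1"
      using \<sigma> by (metis power2_abs one_power2)
    moreover have "hline (- (pi / 2)) u - parab u = \<i> * of_real (u\<^sup>2)" for u
      by (simp add: complex_eq_iff)
    ultimately show "norm (hline (- (pi / 2)) (\<sigma> * x) - parab (\<sigma> * x)) \<le> 2 + x\<^sup>2 + 0"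
      by (simp only: norm_mult norm_of_real) (simp add: power_mult_distrib)
  qed (use \<sigma> in auto)
  have "(LINT u|lborel. ?F (hline (- (pi / 2)) u) * 1) = (LINT u|lborel. ?F (parab u) * parab' u)"
  proof (rule integral_eq_of_common_primitive[where P = P and F = ?F, OF hline_has_vector_derivative parab_has_vector_derivative])
    show "(P has_field_derivative ?F (hline (- (pi / 2)) u)) (at (hline (- (pi / 2)) u))" for u
      by (rule P) (auto simp: lower_slit_def)
    show "(P has_field_derivative ?F (parab u)) (at (parab u))" for u
      by (rule P) (auto simp: lower_slit_def)
    show "integrable lborel (\<lambda>u. ?F (hline (- (pi / 2)) u) * 1)"
      using integrable_line_int[of "- (pi / 2)" c] c by simp
    show "integrable lborel (\<lambda>u. ?F (parab u) * parab' u)"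
      using integrable_parab_int[OF c(2)] by (simp add: mult_ac)
    show "((\<lambda>R. P (hline (- (pi / 2)) R) - P (parab R)) \<longlongrightarrow> 0) at_top"
      using lim[of 1] by simp
    show "((\<lambda>R. P (hline (- (pi / 2)) (- R)) - P (parab (- R))) \<longlongrightarrow> 0) at_top"
      using lim[of "- 1"] by simp
  qed
  then show ?thesis
    by (simp add: line_int_def parab_int_def mult_ac)
qed

text \<open>The upper line integral is read off from values of a primitive at the real points R and
  -R. This is the form that matches the indented contour, whose ends lie on the real axis.\<close>

lemma primitive_tendsto_line_int:
  assumes c: "\<bar>Re c\<bar> < m"
    and P: "\<And>s. s \<in> upper_slit \<Longrightarrow> (P has_field_derivative G s * exp (c * s)) (at s)"
  shows "((\<lambda>R. P (of_real R) - P (of_real (- R))) \<longlongrightarrow> line_int (pi / 2) c) at_top"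
proof -
  have P': "Re s \<noteq> 0 \<Longrightarrow> (P has_field_derivative G s * exp (c * s)) (at s)" for s
    by (rule P) (simp add: upper_slit_def)
  have lim: "((\<lambda>x. P (of_real (\<sigma> * x)) - P (hline (pi / 2) (\<sigma> * x))) \<longlongrightarrow> 0) at_top" if \<sigma>: "\<bar>\<sigma>\<bar> = 1" for \<sigma>
  proof (rule vertical_difference_tendsto_0[where \<sigma> = \<sigma> and M = "\<bar>Im c\<bar> * (pi / 2)" and D = "pi", OF c P'])
    fix x s
    assume s: "s \<in> closed_segment (of_real (\<sigma> * x)) (hline (pi / 2) (\<sigma> * x))"
    have "Im s \<in> {0..pi / 2}"
      using s by (rule Im_closed_segment_bounds) auto
    then show "- Im c * Im s \<le> \<bar>Im c\<bar> * (pi / 2)"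
      by (intro mult_mono) auto
  next
    fix x
    have "of_real (\<sigma> * x) - hline (pi / 2) (\<sigma> * x) = \<i> * of_real (- (pi / 2))"
      by (simp add: complex_eq_iff)
    then show "norm (of_real (\<sigma> * x) - hline (pi / 2) (\<sigma> * x)) \<le> 2 + x\<^sup>2 + pi"
      using pi_gt_zero by (simp only: norm_mult norm_of_real) (simp add: add_increasing)
  qed (use \<sigma> in auto)
  have "((\<lambda>R. P (hline (pi / 2) R) - P (hline (pi / 2) (- R))) \<longlongrightarrow>
      (LINT u|lborel. (\<lambda>s. G s * exp (c * s)) (hline (pi / 2) u) * 1)) at_top"
  proof (rule primitive_tendsto_integral[OF hline_has_vector_derivative])
    show "(P has_field_derivative G (hline (pi / 2) u) * exp (c * hline (pi / 2) u)) (at (hline (pi / 2) u))" for u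
      by (rule P) (auto simp: upper_slit_def)
    show "integrable lborel (\<lambda>u. G (hline (pi / 2) u) * exp (c * hline (pi / 2) u) * 1)"
      using integrable_line_int[of "pi / 2" c] c by simp
  qed
  from tendsto_add[OF tendsto_diff[OF lim[of 1] lim[of "- 1"]] this] show ?thesis
    by (simp add: line_int_def)
qed


section \<open>The residue at the origin\<close>

lemma polar_part_bounded:
  "(\<lambda>s. G s * exp (c * s) - (\<alpha> / s ^ 3 + \<alpha> * c / s\<^sup>2 + res c / s)) \<in> O[at 0](\<lambda>_. 1)"
proof -
  \<comment> \<open>Taylor remainders of exp: \<open>T 2\<close> is small enough against the cubic
    pole and \<open>T 0\<close> against the simple one. The Taylor terms kept produce exactly the
    principal part, with 1 / s coefficient \<open>res c\<close>.\<close>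
  define T where "T n w = exp w - (\<Sum>i\<le>n. w ^ i / fact i)" for n and w :: complex
  have T: "(\<lambda>s. T n (c * s) / s ^ Suc n) \<in> O[at 0](\<lambda>_. 1)" for n
  proof (rule bigoI)
    have near: "\<forall>\<^sub>F s in at 0. norm s \<le> 1 \<and> s \<noteq> (0::complex)"
      unfolding eventually_at by (rule exI[of _ 1]) auto
    show "\<forall>\<^sub>F s in at 0. norm (T n (c * s) / s ^ Suc n) \<le> (exp (norm c) * norm c ^ Suc n) * norm (1::complex)"
      using near
    proof eventually_elim
      fix s :: complex assume s: "norm s \<le> 1 \<and> s \<noteq> 0"
      have "norm (T n (c * s)) \<le> exp (norm (c * s)) * norm (c * s) ^ Suc n / fact n"
        unfolding T_def by (rule Taylor_exp_field)
      also have "\<dots> \<le> exp (norm (c * s)) * norm (c * s) ^ Suc n / 1"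
        by (intro divide_left_mono) auto
      also have "\<dots> \<le> exp (norm c) * norm (c * s) ^ Suc n"
        using mult_left_mono[of "norm s" 1 "norm c"] s by (simp add: norm_mult mult_right_mono)
      also have "\<dots> = exp (norm c) * norm c ^ Suc n * norm (s ^ Suc n)"
        by (simp add: norm_mult norm_power power_mult_distrib)
      finally show "norm (T n (c * s) / s ^ Suc n) \<le> (exp (norm c) * norm c ^ Suc n) * norm (1::complex)"
        using s by (simp add: norm_divide divide_le_eq del: power_Suc)
    qed
  qed
  have "((\<lambda>s. exp (c * s)) \<longlongrightarrow> exp (c * 0)) (at 0)"
    by (intro tendsto_intros)
  then have "(\<lambda>s. exp (c * s)) \<in> O[at 0](\<lambda>_. 1)"
    by (intro bigoI_tendsto[where c = "exp (c * 0)"]) auto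
  then have "(\<lambda>s. (G s - \<alpha> / s ^ 3 - \<beta> / s) * exp (c * s)) \<in> O[at 0](\<lambda>s. 1)"
    using landau_o.big.mult[OF polar] by fastforce
  moreover have "(\<lambda>s. k * (T n (c * s) / s ^ Suc n)) \<in> O[at 0](\<lambda>_. 1)" for k n
    using landau_o.big.mult[OF landau_o.big_refl[of "\<lambda>_. k"] T[of n]]
      by (rule landau_o.big_trans) (auto intro!: bigoI[of _ "norm k"])
  ultimately have "(\<lambda>s. (G s - \<alpha> / s ^ 3 - \<beta> / s) * exp (c * s) + \<alpha> * (T 2 (c * s) / s ^ Suc 2)
      + \<beta> * (T 0 (c * s) / s ^ Suc 0)) \<in> O[at 0](\<lambda>_. 1)"
    by (intro sum_in_bigo)
  also have "?this \<longleftrightarrow> ?thesis"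
  proof (rule landau_o.big.in_cong)
    show "\<forall>\<^sub>F s in at 0. (G s - \<alpha> / s ^ 3 - \<beta> / s) * exp (c * s) + \<alpha> * (T 2 (c * s) / s ^ Suc 2)
      + \<beta> * (T 0 (c * s) / s ^ Suc 0) = G s * exp (c * s) - (\<alpha> / s ^ 3 + \<alpha> * c / s\<^sup>2 + res c / s)"
      using eventually_neq_at_within[of 0]
      by eventually_elim
        (simp add: T_def res_def field_simps power2_eq_square power3_eq_cube numeral_2_eq_2)
  qed
  finally show ?thesis .
qed

text \<open>After subtraction of the principal part the integrand extends holomorphically over 0 to
  the whole strip |Im s| < pi and has a primitive \<open>P\<close> there. The principal part has
  explicit primitives on each line; only the logarithm makes the two lines differ.\<close>

lemma line_int_diff:
  assumes c: "\<bar>Re c\<bar> < m"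
  shows "line_int (- (pi / 2)) c - line_int (pi / 2) c = 2 * pi * \<i> * res c"
proof -
  let ?F = "\<lambda>s. G s * exp (c * s)"
  let ?Q = "\<lambda>s. \<alpha> / s ^ 3 + \<alpha> * c / s\<^sup>2 + res c / s"
  define S where "S = {s. \<bar>Im s\<bar> < pi}"
  have S: "open S"
    unfolding S_def by (intro open_Collect_less continuous_intros)
  have "convex S"
  proof -
    have "S = {s. Im s < pi} \<inter> {s. Im s > - pi}"
      by (auto simp: S_def)
    then show ?thesis
      by (simp add: convex_Int convex_halfspace_Im_lt convex_halfspace_Im_gt)
  qed
  have "(\<lambda>s. ?F s - ?Q s) holomorphic_on S - {0}"
  proof -
    have "S - {0} \<subseteq> kernel_domain"
      by (auto simp: S_def kernel_domain_def complex_eq_iff)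
    then show ?thesis
      by (intro holomorphic_intros holomorphic_on_subset[OF hol]) auto
  qed
  moreover have "0 \<in> interior S"
    using S by (simp add: interior_open) (simp add: S_def)
  ultimately obtain H where H: "H holomorphic_on S" "\<And>s. s \<in> S - {0} \<Longrightarrow> H s = ?F s - ?Q s"
    using holomorphic_on_extend[OF _ _ polar_part_bounded] by blast
  have "starlike S"
    using \<open>convex S\<close> by (rule convex_imp_starlike) (auto simp: S_def intro!: exI[of _ 0])
  from holomorphic_on_starlike_has_primitive[OF S this H(1)]
  obtain P where P: "\<And>s. s \<in> S \<Longrightarrow> (P has_field_derivative H s) (at s)"
    by blast
  \<comment> \<open>The sign rotates the line at height \<open>y\<close> so that
    \<open>\<sigma> * \<i> * s\<close>, with \<open>\<sigma>\<close> = - sgn y, has real part |y| >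
    0, away from the branch cut of \<open>Ln\<close>.\<close>
  define p where "p \<sigma> s = P s - \<alpha> / (2 * s\<^sup>2) - \<alpha> * c / s + res c * Ln (\<sigma> * \<i> * s)" for \<sigma> s :: complex
  have lim: "((\<lambda>R. p (of_real (- sgn y)) (hline y R) - p (of_real (- sgn y)) (hline y (- R))) \<longlongrightarrow> line_int y c) at_top"
    if y: "\<bar>y\<bar> = pi / 2" for y
  proof -
    have "y \<noteq> 0"
      using y by auto
    let ?\<sigma> = "of_real (- sgn y) :: complex"
    have "((\<lambda>R. p ?\<sigma> (hline y R) - p ?\<sigma> (hline y (- R))) \<longlongrightarrow> (LINT u|lborel. ?F (hline y u) * 1)) at_top"
    proof (rule primitive_tendsto_integral[OF hline_has_vector_derivative])
      show "integrable lborel (\<lambda>u. G (hline y u) * exp (c * hline y u) * 1)"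
        using integrable_line_int[OF y c] by simp
      fix u
      let ?s = "hline y u"
      have s: "?s \<in> S" "?s \<noteq> 0"
        using y pi_gt_zero \<open>y \<noteq> 0\<close> by (auto simp: S_def complex_eq_iff)
      have "Re (?\<sigma> * \<i> * ?s) = \<bar>y\<bar>"
        by (simp add: abs_sgn mult.commute)
      then have "?\<sigma> * \<i> * ?s \<notin> \<real>\<^sub>\<le>\<^sub>0"
        using \<open>y \<noteq> 0\<close> by (auto simp: complex_nonpos_Reals_iff)
      then have "(p ?\<sigma> has_field_derivative (H ?s + ?Q ?s)) (at ?s)"
        unfolding p_def using s \<open>y \<noteq> 0\<close>
        by (auto intro!: derivative_eq_intros P
                 simp: field_simps power2_eq_square power3_eq_cube sgn_if)
      then show "(p ?\<sigma> has_field_derivative ?F ?s) (at ?s)"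
        using H(2)[of ?s] s by simp
    qed
    then show ?thesis
      by (simp add: line_int_def)
  qed
  \<comment> \<open>The difference of the two primitives at one end, minus the jump of the
    logarithms. It tends to 0, so the jumps at the two ends give the whole value: i pi at the right,
    - i pi at the left.\<close>
  define d where "d \<sigma> x = p 1 (hline (- (pi / 2)) (\<sigma> * x)) - p (- 1) (hline (pi / 2) (\<sigma> * x))
      - res c * (Ln (Complex (pi / 2) (\<sigma> * x)) - Ln (Complex (pi / 2) (- (\<sigma> * x))))" for \<sigma> x :: real
  have d: "(d \<sigma> \<longlongrightarrow> 0) at_top" if \<sigma>: "\<bar>\<sigma>\<bar> = 1" for \<sigma>
  proof -
    let ?a = "\<lambda>x. hline (- (pi / 2)) (\<sigma> * x)" and ?b = "\<lambda>x. hline (pi / 2) (\<sigma> * x)"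
    define \<rho> where "\<rho> = m - \<bar>Re c\<bar>"
    have \<rho>: "\<rho> > 0"
      using c by (simp add: \<rho>_def)
    obtain C where C: "C \<ge> 0" "\<And>s. 1 \<le> \<bar>Re s\<bar> \<Longrightarrow>
        norm (?F s) \<le> C * exp (- \<rho> * \<bar>Re s\<bar>) * exp (- Im c * Im s)"
      using exp_kernel_bound[of c] unfolding \<rho>_def by blast
    \<comment> \<open>The subtracted principal part decays only like 1 / x, which suffices because
      the connecting segments have the fixed length pi.\<close>
    define E where "E x = C * exp (- \<rho> * x) * exp (\<bar>Im c\<bar> * (pi / 2)) + (norm \<alpha> / x ^ 3 + norm (\<alpha> * c) / x\<^sup>2 + norm (res c) / x)" for x
    have "((\<lambda>x. P (?a x) - P (?b x)) \<longlongrightarrow> 0) at_top"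
    proof (rule vertical_difference_tendsto_0_aux[where P = P and f = H and \<sigma> = \<sigma> and E = E and len = "\<lambda>_. pi"])
      show "((\<lambda>x. E x * pi) \<longlongrightarrow> 0) at_top"
        unfolding E_def using \<rho> by real_asymp
      fix x s
      assume x: "1 \<le> x" and seg: "s \<in> closed_segment (?a x) (?b x)" and r: "\<bar>Re s\<bar> = x"
      have "Im s \<in> {- (pi / 2)..pi / 2}"
        using seg by (rule Im_closed_segment_bounds) auto
      then have im: "\<bar>Im s\<bar> \<le> pi / 2"
        unfolding atLeastAtMost_iff by linarith
      then have s: "s \<in> S"
        unfolding S_def mem_Collect_eq using pi_gt_zero by linarith
      have "s \<noteq> 0"
        using x r by auto
      show "(P has_field_derivative H s) (at s)"
        using s by (intro P)
      have xs: "x \<le> norm s"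
        using r abs_Re_le_cmod[of s] by simp
      have "- Im c * Im s \<le> \<bar>Im c\<bar> * (pi / 2)"
        using abs_ge_self[of "- Im c * Im s"] mult_left_mono[OF im, of "\<bar>Im c\<bar>"] by (simp add: abs_mult)
      then have "norm (?F s) \<le> C * exp (- \<rho> * x) * exp (\<bar>Im c\<bar> * (pi / 2))"
        using C(1) x r by (intro order_trans[OF C(2)] mult_mono) auto
      moreover have "norm (?Q s) \<le> norm (\<alpha> / s ^ 3) + norm (\<alpha> * c / s\<^sup>2) + norm (res c / s)"
        by (intro order_trans[OF norm_triangle_ineq] add_right_mono norm_triangle_ineq)
      moreover have g: "norm k / norm s ^ n \<le> norm k / x ^ n" for k :: complex and n
        by (intro divide_left_mono power_mono mult_pos_pos zero_less_power) (use x xs \<open>s \<noteq> 0\<close> in auto)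
      then have "norm (\<alpha> / s ^ 3) \<le> norm \<alpha> / x ^ 3" "norm (\<alpha> * c / s\<^sup>2) \<le> norm (\<alpha> * c) / x\<^sup>2"
        "norm (res c / s) \<le> norm (res c) / x"
        using g[of \<alpha> 3] g[of "\<alpha> * c" 2] g[of "res c" 1] by (simp_all add: norm_divide norm_power)
      ultimately show "norm (H s) \<le> E x"
        unfolding E_def using norm_triangle_ineq4[of "?F s" "?Q s"] H(2)[of s] s \<open>s \<noteq> 0\<close> by simp
    next
      fix x
      have "?a x - ?b x = \<i> * of_real (- pi)"
        by (simp add: complex_eq_iff)
      then show "norm (?a x - ?b x) \<le> pi"
        by (simp only: norm_mult norm_of_real) simp
    qed (use \<sigma> in auto)
    moreover have inv: "((\<lambda>x. inverse (hline y (\<sigma> * x))) \<longlongrightarrow> 0) at_top" for y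
    proof (rule filterlim_compose[OF tendsto_inverse_0])
      show "filterlim (\<lambda>x. hline y (\<sigma> * x)) at_infinity at_top"
      proof (rule filterlim_norm_at_top_imp_at_infinity,
             rule filterlim_at_top_mono[OF filterlim_ident])
        show "\<forall>\<^sub>F x in at_top. x \<le> norm (hline y (\<sigma> * x))"
          using eventually_ge_at_top[of 0]
        proof eventually_elim
          fix x :: real assume "0 \<le> x"
          then show "x \<le> norm (hline y (\<sigma> * x))"
            using abs_Re_le_cmod[of "hline y (\<sigma> * x)"] \<sigma> by (simp add: abs_mult)
        qed
      qed
    qed
    ultimately have "((\<lambda>x. (P (?a x) - P (?b x)) - \<alpha> / 2 * ((inverse (?a x))\<^sup>2 - (inverse (?b x))\<^sup>2)
        - \<alpha> * c * (inverse (?a x) - inverse (?b x))) \<longlongrightarrow> 0 - \<alpha> / 2 * (0\<^sup>2 - 0\<^sup>2) - \<alpha> * c * (0 - 0)) at_top"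
      by (intro tendsto_intros inv)
    moreover have "d \<sigma> = (\<lambda>x. (P (?a x) - P (?b x)) - \<alpha> / 2 * ((inverse (?a x))\<^sup>2 - (inverse (?b x))\<^sup>2)
        - \<alpha> * c * (inverse (?a x) - inverse (?b x)))"
    proof
      fix x
      have "1 * \<i> * ?a x = Complex (pi / 2) (\<sigma> * x)" "- 1 * \<i> * ?b x = Complex (pi / 2) (- (\<sigma> * x))"
        by (simp_all add: complex_eq_iff)
      then show "d \<sigma> x = (P (?a x) - P (?b x)) - \<alpha> / 2 * ((inverse (?a x))\<^sup>2 - (inverse (?b x))\<^sup>2)
        - \<alpha> * c * (inverse (?a x) - inverse (?b x))"
        unfolding d_def p_def by (simp only:) (simp add: field_simps)
    qed
    ultimately show ?thesis
      by simp
  qed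
  \<comment> \<open>The arguments are conjugate: the real parts of the logarithms cancel, and twice
    the argument, an arctangent, remains.\<close>
  have Ln: "((\<lambda>x. Ln (Complex (pi / 2) x) - Ln (Complex (pi / 2) (- x))) \<longlongrightarrow> \<i> * pi) at_top"
  proof -
    have eq: "Ln (Complex (pi / 2) x) - Ln (Complex (pi / 2) (- x)) = 2 * \<i> * of_real (arctan (x / (pi / 2)))" for x
    proof -
      have nz: "Complex (pi / 2) x \<notin> \<real>\<^sub>\<le>\<^sub>0"
        by (simp add: complex_nonpos_Reals_iff not_le)
      have "Ln (Complex (pi / 2) (- x)) = cnj (Ln (Complex (pi / 2) x))"
        using cnj_Ln[OF nz] by (simp add: complex_cnj)
      moreover have "Im (Ln (Complex (pi / 2) x)) = arctan (x / (pi / 2))"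
      proof -
        have "Re (Complex (pi / 2) x) = pi / 2" "0 < pi / 2"
          by simp_all
        then have "Complex (pi / 2) x \<noteq> 0" "Re (Complex (pi / 2) x) \<noteq> 0" "0 < Re (Complex (pi / 2) x)"
          by (metis less_irrefl zero_complex.simps(1), linarith+)
        then show ?thesis
          by (simp only: Im_Ln_eq if_P not_False_eq_True complex.sel)
      qed
      ultimately show ?thesis
        by (simp add: complex_diff_cnj mult_ac)
    qed
    have "((\<lambda>x. 2 * \<i> * of_real (arctan (x / (pi / 2)))) \<longlongrightarrow> 2 * \<i> * of_real (pi / 2)) at_top"
      by (intro tendsto_intros filterlim_compose[OF tendsto_arctan_at_top]) real_asymp
    then show ?thesis
      unfolding eq by simp
  qed
  have "((\<lambda>x. d 1 x - d (- 1) x + 2 * res c * (Ln (Complex (pi / 2) x) - Ln (Complex (pi / 2) (- x))))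
      \<longlongrightarrow> 0 - 0 + 2 * res c * (\<i> * pi)) at_top"
    by (intro tendsto_intros d Ln) auto
  moreover have "((\<lambda>x. d 1 x - d (- 1) x + 2 * res c * (Ln (Complex (pi / 2) x) - Ln (Complex (pi / 2) (- x))))
      \<longlongrightarrow> line_int (- (pi / 2)) c - line_int (pi / 2) c) at_top"
    using tendsto_diff[OF lim[of "- (pi / 2)"] lim[of "pi / 2"]]
    by (simp add: d_def algebra_simps)
  ultimately show ?thesis
    using tendsto_unique[OF trivial_limit_at_top_linorder] by fastforce
qed

text \<open>The compatibility needed for gluing: in the strip of convergence the parabola may be
  straightened and the two lines differ by the residue, so all three cases of \<open>ext_int\<close>
  agree with one holomorphic function.\<close>

lemma ext_int_eq_mean_int:
  assumes "\<bar>Re c\<bar> < m"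
  shows "ext_int c = mean_int c"
proof -
  have neg: "ext_int c = mean_int c" if "\<bar>Re c\<bar> < m" "Im c < 0" for c
    using line_int_diff[OF that(1)] line_int_eq_parab_int[OF that] that(2)
    by (simp add: ext_int_def mean_int_def field_simps)
  show ?thesis
  proof (cases "Im c" "0::real" rule: linorder_cases)
    case greater
    then show ?thesis
      using neg[of "- c"] assms by (simp add: ext_int_minus mean_int_minus)
  qed (use neg assms in \<open>auto simp: ext_int_def\<close>)
qed

lemma ext_int_holomorphic: "ext_int holomorphic_on {c. Im c \<noteq> 0 \<or> \<bar>Re c\<bar> < m}"
proof -
  have res: "res holomorphic_on S" for S
    unfolding res_def by (intro holomorphic_intros) auto
  have low: "(\<lambda>c. parab_int c - pi * \<i> * res c) holomorphic_on {c. Im c < 0}"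
    by (intro holomorphic_intros res parab_int_holomorphic)
  have "ext_int holomorphic_on {c. Im c < 0}"
    using low by (rule holomorphic_transform) (simp add: ext_int_def)
  moreover have "ext_int holomorphic_on {c. 0 < Im c}"
  proof (rule holomorphic_transform)
    show "(\<lambda>c. - (parab_int (- c) - pi * \<i> * res (- c))) holomorphic_on {c. 0 < Im c}"
    proof -
      have "(\<lambda>c. parab_int c - pi * \<i> * res c) \<circ> uminus holomorphic_on {c. 0 < Im c}"
        by (rule holomorphic_on_compose_gen[OF _ low]) (auto intro: holomorphic_intros)
      then have "(\<lambda>c. - ((\<lambda>c. parab_int c - pi * \<i> * res c) \<circ> uminus) c) holomorphic_on {c. 0 < Im c}"
        by (rule holomorphic_on_minus)
      then show ?thesis
        by (simp only: o_def)
    qed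
  qed (simp add: ext_int_def)
  moreover have "ext_int holomorphic_on {c. \<bar>Re c\<bar> < m}"
  proof (rule holomorphic_transform)
    show "mean_int holomorphic_on {c. \<bar>Re c\<bar> < m}"
      unfolding mean_int_def[abs_def] by (intro holomorphic_intros line_int_holomorphic) auto
  qed (simp add: ext_int_eq_mean_int)
  moreover have "open {c. Im c < 0}" "open {c. 0 < Im c}" "open {c. \<bar>Re c\<bar> < m}"
    by (intro open_Collect_less continuous_intros)+
  ultimately have "ext_int holomorphic_on ({c. Im c < 0} \<union> {c. 0 < Im c}) \<union> {c. \<bar>Re c\<bar> < m}"
    by (intro holomorphic_on_Un open_Un)
  then show ?thesis
    by (rule holomorphic_on_subset) auto
qed

end

section \<open>The kernels of the double sine function and the dilogarithm\<close>

definition kernel0 :: "complex \<Rightarrow> complex" where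
  "kernel0 s = 1 / (4 * s\<^sup>2 * sinh s)"

text \<open>The substitution is t = 2 b s, which turns b t / 2 into b^2 s and t / (2 b) into
  s.\<close>

definition kernelb :: "real \<Rightarrow> complex \<Rightarrow> complex" where
  "kernelb b s = 1 / (4 * s * sinh s * sinh (of_real (b\<^sup>2) * s))"

definition kernelW :: "real \<Rightarrow> complex \<Rightarrow> complex" where
  "kernelW b s = of_real (b\<^sup>2) * kernelb b s - kernel0 s"

text \<open>The Laurent coefficients come from 1 / sinh z = 1 / z - z / 6 + O(z^3). In
  \<open>kernelW\<close> the cubic poles cancel and the remaining residue is itself of order b^4, so
  the residue correction respects the required error.\<close>

definition alpha0 :: complex where "alpha0 = 1 / 4"
definition beta0 :: complex where "beta0 = - 1 / 24"
definition alphab :: "real \<Rightarrow> complex" where "alphab b = of_real (1 / (4 * b\<^sup>2))"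
definition betab :: "real \<Rightarrow> complex" where "betab b = of_real (- (b\<^sup>2 + 1 / b\<^sup>2) / 24)"
definition betaW :: "real \<Rightarrow> complex" where "betaW b = of_real (- (b ^ 4) / 24)"

section \<open>Holomorphy, principal part and decay of each kernel\<close>

lemma sinh_neq_0_kernel_domain: "s \<in> kernel_domain \<Longrightarrow> sinh s \<noteq> 0"
  by (rule sinh_neq_0) (auto simp: kernel_domain_def)

lemma scaled_kernel_domain:
  assumes "0 < a" "a \<le> 1" "s \<in> kernel_domain"
  shows "of_real a * s \<in> kernel_domain"
proof -
  have "a * \<bar>Im s\<bar> \<le> \<bar>Im s\<bar>"
    using assms by (simp add: mult_left_le_one_le)
  then have "\<bar>Im s\<bar> < pi \<Longrightarrow> a * \<bar>Im s\<bar> < pi"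
    by linarith
  with assms show ?thesis
    by (auto simp: kernel_domain_def abs_mult)
qed

lemma holomorphic_on_sinh [holomorphic_intros]:
  "f holomorphic_on S \<Longrightarrow> (\<lambda>s. sinh (f s) :: complex) holomorphic_on S"
  unfolding sinh_field_def by (intro holomorphic_intros) auto

lemma near_0: "0 < r \<Longrightarrow> \<forall>\<^sub>F s in at 0. norm s < r \<and> s \<noteq> (0::complex)"
  unfolding eventually_at by (rule exI[of _ r]) auto

lemma norm_sinh_ge_exp':
  fixes s :: complex
  assumes "1 \<le> \<bar>Re s\<bar>"
  shows "exp \<bar>Re s\<bar> / 4 \<le> norm (sinh s)"
proof -
  have "exp (- 2 * 1 :: real) \<le> 1 / 2"
    using exp_ge_add_one_self[of "2::real"] by (simp add: exp_minus field_simps)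
  then have "exp \<bar>Re s\<bar> / 4 \<le> (1 - exp (- 2 * 1)) / 2 * exp (1 * \<bar>Re s\<bar>)"
    by simp
  also have "\<dots> \<le> norm (sinh (of_real 1 * s))"
    by (rule norm_sinh_ge_exp) (use assms in auto)
  finally show ?thesis
    by simp
qed

lemma norm_inverse_sinh_le:
  fixes s :: complex
  assumes "1 \<le> \<bar>Re s\<bar>"
  shows "norm (1 / sinh s) \<le> 4 * exp (- \<bar>Re s\<bar>)"
proof -
  have "norm (1 / sinh s) \<le> 1 / (exp \<bar>Re s\<bar> / 4)"
    unfolding norm_divide norm_one
    by (rule divide_left_mono[OF norm_sinh_ge_exp'[OF assms]])
       (use norm_sinh_ge_exp'[OF assms] in \<open>auto intro!: mult_pos_pos intro: less_le_trans[rotated]\<close>)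
  then show ?thesis
    by (simp add: exp_minus field_simps)
qed

text \<open>Two derivatives in \<open>c\<close> multiply the integrand by s^2 and turn
  \<open>kernel0\<close> into one quarter of this kernel, whose line integral has a closed
  form.\<close>

lemma odd_kernel_csch: "odd_kernel (\<lambda>s. 1 / sinh s) 0 1 1"
proof
  show "(\<lambda>s. 1 / sinh s) holomorphic_on kernel_domain"
    by (intro holomorphic_intros sinh_neq_0_kernel_domain)
  show "(\<lambda>s::complex. 1 / sinh s - 0 / s ^ 3 - 1 / s) \<in> O[at 0](\<lambda>_. 1)"
  proof (rule bigoI)
    show "\<forall>\<^sub>F s in at (0::complex). norm (1 / sinh s - 0 / s ^ 3 - 1 / s) \<le> 4 * norm (1::complex)"
      using near_0[OF zero_less_one]
    proof (rule eventually_mono)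
      fix s :: complex assume s: "norm s < 1 \<and> s \<noteq> 0"
      then have "norm (1 / sinh s - 1 / s) \<le> 4 * norm s"
        using abs_Im_le_cmod[of s] by (intro norm_inverse_sinh_minus_le) auto
      with s show "norm (1 / sinh s - 0 / s ^ 3 - 1 / s) \<le> 4 * norm (1::complex)"
        by simp
    qed
  qed
  show "\<exists>A. \<forall>s::complex. 1 \<le> \<bar>Re s\<bar> \<longrightarrow> norm (1 / sinh s) \<le> A * exp (- 1 * \<bar>Re s\<bar>)"
    using norm_inverse_sinh_le by (intro exI[of _ 4]) auto
qed auto

lemma odd_kernel0: "odd_kernel kernel0 alpha0 beta0 1"
  unfolding alpha0_def beta0_def
proof
  show "kernel0 holomorphic_on kernel_domain"
    unfolding kernel0_def[abs_def]
    by (intro holomorphic_intros) (auto simp: sinh_neq_0_kernel_domain, auto simp: kernel_domain_def)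
  show "(\<lambda>s. kernel0 s - (1 / 4) / s ^ 3 - (- 1 / 24) / s) \<in> O[at 0](\<lambda>_. 1)"
  proof (rule bigoI)
    show "\<forall>\<^sub>F s in at 0. norm (kernel0 s - (1 / 4) / s ^ 3 - (- 1 / 24) / s) \<le> 1 * norm (1::complex)"
      using near_0[OF zero_less_one]
    proof (rule eventually_mono)
      fix s :: complex assume s: "norm s < 1 \<and> s \<noteq> 0"
      define k where "k = 1 / sinh s - 1 / s + s / 6"
      have k: "norm k \<le> norm s ^ 3"
        unfolding k_def using s by (intro norm_inverse_sinh_expansion_le) auto
      have "1 / sinh s = 1 / s - s / 6 + k"
        by (simp add: k_def)
      moreover have "kernel0 s = (1 / sinh s) / (4 * s\<^sup>2)"
        by (simp add: kernel0_def)
      ultimately have "kernel0 s = (1 / s - s / 6 + k) / (4 * s\<^sup>2)"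
        by (simp only:)
      then have "kernel0 s - (1 / 4) / s ^ 3 - (- 1 / 24) / s = k / (4 * s\<^sup>2)"
        using s by (simp add: field_simps power2_eq_square power3_eq_cube)
      also have "norm \<dots> \<le> norm s ^ 3 / (4 * (norm s)\<^sup>2)"
        using k by (simp add: norm_divide norm_mult norm_power divide_right_mono)
      also have "\<dots> = norm s / 4"
        using s by (simp add: power2_eq_square power3_eq_cube)
      finally show "norm (kernel0 s - (1 / 4) / s ^ 3 - (- 1 / 24) / s) \<le> 1 * norm (1::complex)"
        using s by simp
    qed
  qed
  show "\<exists>A. \<forall>s. 1 \<le> \<bar>Re s\<bar> \<longrightarrow> norm (kernel0 s) \<le> A * exp (- 1 * \<bar>Re s\<bar>)"
  proof (intro exI[of _ 4] allI impI)
    fix s :: complex assume s: "1 \<le> \<bar>Re s\<bar>"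
    have "1 \<le> norm s"
      using s abs_Re_le_cmod[of s] by simp
    moreover have "s \<noteq> 0"
      using s by auto
    ultimately have "1 * 1 \<le> norm (4 * s\<^sup>2)"
      unfolding norm_mult norm_power by (intro mult_mono) (auto simp: one_le_power)
    then have "norm (kernel0 s) \<le> norm (1 / sinh s)"
      using divide_left_mono[of 1 "norm (4 * s\<^sup>2)" "norm (1 / sinh s)"] \<open>s \<noteq> 0\<close>
      by (simp add: kernel0_def norm_divide norm_mult mult.commute)
    also have "\<dots> \<le> 4 * exp (- \<bar>Re s\<bar>)"
      by (rule norm_inverse_sinh_le[OF s])
    finally show "norm (kernel0 s) \<le> 4 * exp (- 1 * \<bar>Re s\<bar>)"
      by simp
  qed
qed (auto simp: kernel0_def)

context
  fixes b :: real
  assumes b: "0 < b" "b < 1"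
begin

lemma b2: "0 < b\<^sup>2" "b\<^sup>2 < 1"
  using b by (auto simp: power_less_one_iff)

lemma odd_kernelb: "odd_kernel (kernelb b) (alphab b) (betab b) (1 + b\<^sup>2)"
  unfolding alphab_def betab_def
proof
  show "kernelb b holomorphic_on kernel_domain"
    unfolding kernelb_def[abs_def]
    using scaled_kernel_domain[of "b\<^sup>2"] b2
    by (intro holomorphic_intros) (auto simp: sinh_neq_0_kernel_domain, auto simp: kernel_domain_def)
  define a where "a = b\<^sup>2"
  have a: "0 < a" "a < 1"
    using b2 by (auto simp: a_def)
  show "(\<lambda>s. kernelb b s - of_real (1 / (4 * b\<^sup>2)) / s ^ 3 - of_real (- (b\<^sup>2 + 1 / b\<^sup>2) / 24) / s) \<in> O[at 0](\<lambda>_. 1)"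
    unfolding a_def[symmetric]
  proof (rule bigoI)
    show "\<forall>\<^sub>F s in at 0. norm (kernelb b s - of_real (1 / (4 * a)) / s ^ 3 - of_real (- (a + 1 / a) / 24) / s)
        \<le> (3 / a + 3) * norm (1::complex)"
      using near_0[OF zero_less_one]
    proof (rule eventually_mono)
      fix s :: complex assume s: "norm s < 1 \<and> s \<noteq> 0"
      let ?v = "of_real a * s"
      have v: "norm ?v \<le> norm s" "?v \<noteq> 0"
        using s a by (auto simp: norm_mult mult_left_le_one_le)
      define k where "k = 1 / sinh s - 1 / s + s / 6"
      define l where "l = 1 / sinh ?v - 1 / ?v + ?v / 6"
      have k: "norm k \<le> norm s ^ 3"
        unfolding k_def using s by (intro norm_inverse_sinh_expansion_le) auto
      have "norm l \<le> norm ?v ^ 3"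
        unfolding l_def using s v by (intro norm_inverse_sinh_expansion_le) auto
      also have "\<dots> \<le> norm s ^ 3"
        using v by (intro power_mono) auto
      finally have l: "norm l \<le> norm s ^ 3" .
      have sv: "norm ?v / 3 \<le> norm (sinh ?v)"
        using abs_Im_le_cmod[of ?v] v s by (intro norm_sinh_ge) auto
      have "norm (1 / sinh ?v) \<le> 1 / (norm ?v / 3)"
        unfolding norm_divide norm_one
      proof (rule divide_left_mono[OF sv])
        have "0 < norm ?v / 3"
          using v by simp
        then show "0 < norm (sinh ?v) * (norm ?v / 3)"
          using sv by (intro mult_pos_pos) linarith+
      qed simp
      also have "\<dots> = 3 / (a * norm s)"
        using a by (simp add: norm_mult)
      finally have Y: "norm (1 / sinh ?v) \<le> 3 / (a * norm s)" .
      have X: "norm (1 / s - s / 6) \<le> 2 / norm s"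
      proof -
        have "norm (1 / s - s / 6) \<le> 1 / norm s + norm s / 6"
          using norm_triangle_ineq4[of "1 / s" "s / 6"] by (simp add: norm_divide)
        also have "norm s / 6 \<le> 1 / norm s"
          using s mult_mono[of "norm s" 1 "norm s" 1] by (simp add: field_simps)
        finally show ?thesis
          by simp
      qed
      have eq1: "1 / sinh s = (1 / s - s / 6) + k" and eq2: "1 / sinh ?v = (1 / ?v - ?v / 6) + l"
        by (simp_all add: k_def l_def)
      have "kernelb b s = (1 / (4 * s)) * (1 / sinh s) * (1 / sinh ?v)"
        by (simp add: kernelb_def a_def)
      \<comment> \<open>Only one factor at a time is replaced by its expansion. Each cubic error
        \<open>k\<close>, \<open>l\<close> then meets a factor of order 1 / |s|, so that division by
        4 s leaves a bounded quantity.\<close>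
      also have "\<dots> = (1 / (4 * s)) * ((1 / s - s / 6) * (1 / ?v - ?v / 6) + k * (1 / sinh ?v) + (1 / s - s / 6) * l)"
      proof -
        have "X * Y = p * q + k * Y + p * l" if "X = p + k" "Y = q + l" for X Y p q :: complex
          unfolding that by (simp add: algebra_simps)
        from this[OF eq1 eq2] show ?thesis
          by (simp only: mult.assoc)
      qed
      also have "\<dots> - of_real (1 / (4 * a)) / s ^ 3 - of_real (- (a + 1 / a) / 24) / s
          = (of_real a * s\<^sup>2 / 36 + k * (1 / sinh ?v) + (1 / s - s / 6) * l) / (4 * s)"
      proof -
        have "(1 / (4 * s)) * ((1 / s - s / 6) * (1 / ?v - ?v / 6)) - of_real (1 / (4 * a)) / s ^ 3 - of_real (- (a + 1 / a) / 24) / s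
          = (of_real a * s\<^sup>2 / 36) * (1 / (4 * s))"
          using s a by (simp add: field_simps power2_eq_square power3_eq_cube)
        moreover have "t * (A + B + C) - D - E = (F + B + C) * t" if "t * A - D - E = F * t" for t A B C D E F :: complex
          using that by (simp add: algebra_simps)
        ultimately show ?thesis
          unfolding divide_inverse[of "_ + _ + _"] by (simp only: divide_inverse[of 1] mult_1_left)
      qed
      also have "norm \<dots> \<le> (a * (norm s)\<^sup>2 / 36 + norm s ^ 3 * (3 / (a * norm s)) + (2 / norm s) * norm s ^ 3) / (4 * norm s)"
      proof -
        have "norm (of_real a * s\<^sup>2 / 36 + k * (1 / sinh ?v) + (1 / s - s / 6) * l)
          \<le> norm (of_real a * s\<^sup>2 / 36) + norm (k * (1 / sinh ?v)) + norm ((1 / s - s / 6) * l)"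
          by (intro order_trans[OF norm_triangle_ineq] add_right_mono norm_triangle_ineq)
        also have "\<dots> \<le> a * (norm s)\<^sup>2 / 36 + norm s ^ 3 * (3 / (a * norm s)) + (2 / norm s) * norm s ^ 3"
        proof (intro add_mono)
          show "norm (of_real a * s\<^sup>2 / 36) \<le> a * (norm s)\<^sup>2 / 36"
            using a by (simp add: norm_mult norm_divide norm_power)
          show "norm (k * (1 / sinh ?v)) \<le> norm s ^ 3 * (3 / (a * norm s))"
            unfolding norm_mult by (intro mult_mono k Y) auto
          show "norm ((1 / s - s / 6) * l) \<le> (2 / norm s) * norm s ^ 3"
            unfolding norm_mult by (intro mult_mono l X) auto
        qed
        finally show ?thesis
          unfolding norm_divide[of _ "4 * s"] by (auto simp: norm_mult intro!: divide_right_mono)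
      qed
      also have "\<dots> = a * norm s / 144 + (3 / (4 * a)) * norm s + norm s / 2"
        using s a by (simp add: field_simps power2_eq_square power3_eq_cube)
      also have "\<dots> \<le> 1 + 3 / a + 1"
        using s a mult_mono[of a 1 "norm s" 1]
        by (intro add_mono) (auto simp: field_simps)
      finally show "norm (kernelb b s - of_real (1 / (4 * a)) / s ^ 3 - of_real (- (a + 1 / a) / 24) / s)
        \<le> (3 / a + 3) * norm (1::complex)"
        by simp
    qed
  qed
  show "0 < 1 + b\<^sup>2"
    using b2 by linarith
  define D where "D = (1 - exp (- 2 * a)) / 2"
  have D: "D > 0"
    using a by (simp add: D_def)
  show "\<exists>A. \<forall>s. 1 \<le> \<bar>Re s\<bar> \<longrightarrow> norm (kernelb b s) \<le> A * exp (- (1 + b\<^sup>2) * \<bar>Re s\<bar>)"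
  proof (intro exI[of _ "1 / D"] allI impI)
    fix s :: complex assume s: "1 \<le> \<bar>Re s\<bar>"
    have "1 \<le> norm s"
      using s abs_Re_le_cmod[of s] by simp
    then have n: "4 \<le> norm (4 * s)"
      by (simp add: norm_mult)
    have p: "D * exp (a * \<bar>Re s\<bar>) \<le> norm (sinh (of_real a * s))"
      unfolding D_def by (rule norm_sinh_ge_exp) (use a s in auto)
    have "norm (kernelb b s) = 1 / (norm (4 * s) * norm (sinh s) * norm (sinh (of_real a * s)))"
      by (simp add: kernelb_def a_def norm_divide norm_mult)
    also have "\<dots> \<le> 1 / (4 * (exp \<bar>Re s\<bar> / 4) * (D * exp (a * \<bar>Re s\<bar>)))"
    proof (rule divide_left_mono)
      show le: "4 * (exp \<bar>Re s\<bar> / 4) * (D * exp (a * \<bar>Re s\<bar>)) \<le> norm (4 * s) * norm (sinh s) * norm (sinh (of_real a * s))"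
        by (intro mult_mono n norm_sinh_ge_exp' s p) (use D in auto)
      show "0 < norm (4 * s) * norm (sinh s) * norm (sinh (of_real a * s)) * (4 * (exp \<bar>Re s\<bar> / 4) * (D * exp (a * \<bar>Re s\<bar>)))"
      proof -
        have "0 < 4 * (exp \<bar>Re s\<bar> / 4) * (D * exp (a * \<bar>Re s\<bar>))"
          using D by simp
        with less_le_trans[OF this le] show ?thesis
          by (rule mult_pos_pos)
      qed
    qed simp
    also have "\<dots> = 1 / D * (exp (- \<bar>Re s\<bar>) * exp (- (a * \<bar>Re s\<bar>)))"
      by (simp add: exp_minus field_simps)
    also have "\<dots> = 1 / D * exp (- (1 + b\<^sup>2) * \<bar>Re s\<bar>)"
      by (simp add: a_def algebra_simps flip: exp_add)
    finally show "norm (kernelb b s) \<le> 1 / D * exp (- (1 + b\<^sup>2) * \<bar>Re s\<bar>)" .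
  qed
qed (auto simp: kernelb_def)

lemma odd_kernelW: "odd_kernel (kernelW b) 0 (betaW b) 1"
proof -
  interpret K0: odd_kernel kernel0 alpha0 beta0 1
    by (rule odd_kernel0)
  interpret Kb: odd_kernel "kernelb b" "alphab b" "betab b" "1 + b\<^sup>2"
    by (rule odd_kernelb)
  show ?thesis
  proof
    show "kernelW b holomorphic_on kernel_domain"
      unfolding kernelW_def[abs_def] by (intro holomorphic_intros K0.hol Kb.hol)
    show "kernelW b (- s) = - kernelW b s" for s
      by (simp add: kernelW_def K0.odd Kb.odd)
    have "(\<lambda>s. of_real (b\<^sup>2) * (kernelb b s - of_real (1 / (4 * b\<^sup>2)) / s ^ 3 - of_real (- (b\<^sup>2 + 1 / b\<^sup>2) / 24) / s))
       \<in> O[at 0](\<lambda>_. 1)"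
      using Kb.polar[unfolded alphab_def betab_def] b by (subst landau_o.big.cmult_in_iff) auto
    from sum_in_bigo(2)[OF this K0.polar[unfolded alpha0_def beta0_def]]
    show "(\<lambda>s. kernelW b s - 0 / s ^ 3 - betaW b / s) \<in> O[at 0](\<lambda>_. 1)"
    proof (rule landau_o.big.in_cong[THEN iffD1, rotated])
      show "\<forall>\<^sub>F s in at 0. of_real (b\<^sup>2) * (kernelb b s - of_real (1 / (4 * b\<^sup>2)) / s ^ 3 - of_real (- (b\<^sup>2 + 1 / b\<^sup>2) / 24) / s) -
          (kernel0 s - 1 / 4 / s ^ 3 - - 1 / 24 / s) = kernelW b s - 0 / s ^ 3 - betaW b / s"
        using near_0[OF zero_less_one] b
        by (auto elim!: eventually_mono simp: kernelW_def betaW_def field_simps numeral_eq_Suc)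
    qed
    obtain A0 where A0: "\<And>s. 1 \<le> \<bar>Re s\<bar> \<Longrightarrow> norm (kernel0 s) \<le> A0 * exp (- 1 * \<bar>Re s\<bar>)"
      using K0.decay by blast
    obtain Ab where Ab: "\<And>s. 1 \<le> \<bar>Re s\<bar> \<Longrightarrow> norm (kernelb b s) \<le> Ab * exp (- (1 + b\<^sup>2) * \<bar>Re s\<bar>)"
      using Kb.decay by blast
    show "\<exists>A. \<forall>s. 1 \<le> \<bar>Re s\<bar> \<longrightarrow> norm (kernelW b s) \<le> A * exp (- 1 * \<bar>Re s\<bar>)"
    proof (intro exI[of _ "\<bar>Ab\<bar> + A0"] allI impI)
      fix s :: complex assume s: "1 \<le> \<bar>Re s\<bar>"
      have "norm (kernelb b s) \<le> \<bar>Ab\<bar> * exp (- 1 * \<bar>Re s\<bar>)"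
      proof (rule order_trans[OF Ab[OF s]], rule mult_mono)
        show "exp (- (1 + b\<^sup>2) * \<bar>Re s\<bar>) \<le> exp (- 1 * \<bar>Re s\<bar>)"
          unfolding exp_le_cancel_iff by (intro mult_right_mono) auto
      qed auto
      then have "b\<^sup>2 * norm (kernelb b s) \<le> 1 * (\<bar>Ab\<bar> * exp (- 1 * \<bar>Re s\<bar>))"
        using b2 by (intro mult_mono) auto
      moreover have "norm (kernelW b s) \<le> b\<^sup>2 * norm (kernelb b s) + norm (kernel0 s)"
        unfolding kernelW_def using b
        by (intro order_trans[OF norm_triangle_ineq4]) (simp add: norm_mult norm_power)
      ultimately show "norm (kernelW b s) \<le> (\<bar>Ab\<bar> + A0) * exp (- 1 * \<bar>Re s\<bar>)"
        using A0[OF s] by (simp add: algebra_simps)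
    qed
  qed simp
qed

end


section \<open>Estimates for the error kernel, uniform in \<open>b\<close>\<close>

lemma norm_kernelW:
  assumes "0 < b" "b < 1" "s \<in> kernel_domain"
  shows "norm (kernelW b s) = b\<^sup>2 * norm (1 / sinh (of_real (b\<^sup>2) * s) - 1 / (of_real (b\<^sup>2) * s))
    / (4 * norm s * norm (sinh s))"
proof -
  have nz: "s \<noteq> 0" "sinh s \<noteq> 0" "b \<noteq> 0"
    using assms sinh_neq_0_kernel_domain by (auto simp: kernel_domain_def)
  \<comment> \<open>Reading 1 / s as b^2 / (b^2 s) exposes the difference 1 / sinh v - 1 / v at v =
    b^2 s. Its bound, a multiple of b^2 |s|, supplies the second factor b^2 and cancels |s| in the
    denominator.\<close>
  then have "kernelW b s = of_real (b\<^sup>2) * (1 / sinh (of_real (b\<^sup>2) * s) - 1 / (of_real (b\<^sup>2) * s)) / (4 * s * sinh s)"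
  proof -
    have "B * (1 / (4 * x * S * T)) - 1 / (4 * x\<^sup>2 * S) = B * (1 / T - 1 / (B * x)) / (4 * x * S)"
      if "B \<noteq> 0" "x \<noteq> 0" "S \<noteq> 0" for B x S T :: complex
      using that by (cases "T = 0") (simp_all add: field_simps power2_eq_square)
    with nz show ?thesis
      by (simp only: kernelW_def kernelb_def kernel0_def of_real_eq_0_iff power_eq_0_iff simp_thms)
  qed
  then show ?thesis
    by (simp only: norm_divide norm_mult norm_of_real norm_numeral) simp
qed

lemma norm_kernelW_hline_le:
  assumes b: "0 < b" "b < 1" and y: "\<bar>y\<bar> = pi / 2"
  shows "norm (kernelW b (hline y u)) \<le> 2 * b ^ 4 * exp (- \<bar>u\<bar>)"
proof -
  let ?s = "hline y u" and ?v = "of_real (b\<^sup>2) * hline y u"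
  have s: "?s \<noteq> 0"
    using y by (auto simp: complex_eq_iff)
  have "b\<^sup>2 * \<bar>y\<bar> \<le> 1 * 2"
    using y pi_less_4 b by (intro mult_mono) (auto simp: power_le_one)
  then have v: "norm (1 / sinh ?v - 1 / ?v) \<le> 4 * norm ?v"
    using b s by (intro norm_inverse_sinh_minus_le) (auto simp: abs_mult)
  have sin: "(sin y)\<^sup>2 = 1"
  proof -
    have "y = pi / 2 \<or> y = - (pi / 2)"
      using y by linarith
    then show ?thesis
      by (elim disjE) (simp_all only: sin_minus sin_pi_half power2_minus one_power2)
  qed
  have "norm (sinh ?s) = cosh u"
    by (rule power2_eq_imp_eq) (auto simp: norm_sinh_squared sin cosh_square_eq)
  moreover have "exp \<bar>u\<bar> / 2 \<le> cosh u"
    by (cases "u \<ge> 0") (auto simp: cosh_field_def)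
  ultimately have sh: "exp \<bar>u\<bar> / 2 \<le> norm (sinh ?s)"
    by simp
  have "norm (kernelW b ?s) = b\<^sup>2 * norm (1 / sinh ?v - 1 / ?v) / (4 * norm ?s * norm (sinh ?s))"
    using assms by (intro norm_kernelW hline_in)
  also have "\<dots> \<le> b\<^sup>2 * (4 * norm ?v) / (4 * norm ?s * (exp \<bar>u\<bar> / 2))"
    using s by (intro frac_le mult_left_mono v sh) auto
  also have "\<dots> = 2 * b ^ 4 * exp (- \<bar>u\<bar>)"
    using s by (simp add: norm_mult exp_minus field_simps numeral_eq_Suc)
  finally show ?thesis .
qed

text \<open>Near the vertex the height - (pi / 2 + u^2) gives |sin| = cos (u^2) >= cos (pi / 3),
  because 1 <= pi / 3; elsewhere |Re s| > 1 is enough.\<close>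

lemma half_le_norm_sinh_parab: "1 / 2 \<le> norm (sinh (parab u))"
proof (cases "\<bar>u\<bar> \<le> 1")
  case True
  then have "u\<^sup>2 \<le> 1"
    by (simp add: abs_square_le_1)
  then have "cos (pi / 3) \<le> cos (u\<^sup>2)"
    using pi_gt3 by (intro cos_monotone_0_pi_le) auto
  then have "1 / 2 \<le> cos (u\<^sup>2)"
    by (simp add: cos_60)
  moreover have "sin (Im (parab u)) = - cos (u\<^sup>2)"
    by (simp add: sin_diff)
  ultimately show ?thesis
    using abs_sin_Im_le_norm_sinh[of "parab u"] by simp
next
  case False
  then show ?thesis
    using abs_Re_le_norm_sinh[of "parab u"] by simp
qed

text \<open>For |Im v| > 2 the point v = b^2 s may approach a nonzero zero of sinh. But then b^2 u^2
  > 2/5, so |sinh v| >= |Re v| = b^2 |u| is at least 2 / (5 |u|). The loss is one factor 1 + |u|,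
  whatever \<open>b\<close> is.\<close>

lemma norm_kernelW_parab_le:
  assumes b: "0 < b" "b < 1"
  shows "norm (kernelW b (parab u)) \<le> 2 * b ^ 4 * exp \<bar>u\<bar>"
proof -
  let ?s = "parab u" and ?v = "of_real (b\<^sup>2) * parab u"
  have s: "?s \<noteq> 0"
  proof
    assume "?s = 0"
    with parab_in[of u] show False
      by (simp only:) (simp add: kernel_domain_def)
  qed
  have v0: "?v \<noteq> 0"
    using s b by simp
  have v: "norm (1 / sinh ?v - 1 / ?v) \<le> 4 * (1 + \<bar>u\<bar>) * norm ?v"
  proof (cases "\<bar>Im ?v\<bar> \<le> 2")
    case True
    then have "norm (1 / sinh ?v - 1 / ?v) \<le> 4 * norm ?v"
      using v0 by (rule norm_inverse_sinh_minus_le)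
    also have "\<dots> \<le> 4 * (1 + \<bar>u\<bar>) * norm ?v"
      by (intro mult_right_mono) auto
    finally show ?thesis .
  next
    case False
    have "\<bar>Im ?v\<bar> = b\<^sup>2 * (pi / 2 + u\<^sup>2)"
    proof -
      have "Im ?v = - (b\<^sup>2 * (pi / 2 + u\<^sup>2))"
        by (simp add: algebra_simps)
      then show ?thesis
        by (simp only: abs_minus_cancel) (simp add: abs_of_nonneg)
    qed
    with False have "2 < b\<^sup>2 * (pi / 2) + b\<^sup>2 * u\<^sup>2"
      by (simp add: distrib_left)
    \<comment> \<open>Any bound for pi / 2 below 2 would do; 8/5 leaves 2 - 8/5 = 2/5 for b^2
      u^2.\<close>
    moreover have "b\<^sup>2 * (pi / 2) \<le> 1 * (8 / 5)"
      using b pi_approx(2) by (intro mult_mono) (auto simp: power_le_one)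
    ultimately have bu: "2 / 5 < b\<^sup>2 * u\<^sup>2"
      by simp
    then have "u \<noteq> 0"
      by auto
    have "2 / 5 / \<bar>u\<bar> \<le> b\<^sup>2 * \<bar>u\<bar>"
      using bu \<open>u \<noteq> 0\<close> by (simp add: divide_le_eq power2_eq_square[of u] mult.assoc)
    also have "\<dots> = \<bar>Re ?v\<bar>"
      by (simp add: abs_mult)
    also have "\<dots> \<le> norm (sinh ?v)"
      by (rule abs_Re_le_norm_sinh)
    finally have sh: "2 / 5 / \<bar>u\<bar> \<le> norm (sinh ?v)" .
    have v2: "2 \<le> norm ?v"
      using False abs_Im_le_cmod[of ?v] by simp
    have "norm (1 / sinh ?v - 1 / ?v) \<le> 1 / norm (sinh ?v) + 1 / norm ?v"
      using norm_triangle_ineq4[of "1 / sinh ?v" "1 / ?v"] by (simp only: norm_divide norm_one)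
    also have "\<dots> \<le> 1 / (2 / 5 / \<bar>u\<bar>) + 1 / 2"
    proof (intro add_mono divide_left_mono sh v2)
      have "0 < 2 / 5 / \<bar>u\<bar>"
        using \<open>u \<noteq> 0\<close> by simp
      then show "0 < norm (sinh ?v) * (2 / 5 / \<bar>u\<bar>)"
        using sh by (intro mult_pos_pos) linarith+
      show "0 < norm ?v * 2"
        using v2 by linarith
    qed auto
    also have "\<dots> \<le> 4 * (1 + \<bar>u\<bar>) * 2"
      by simp
    also have "\<dots> \<le> 4 * (1 + \<bar>u\<bar>) * norm ?v"
      by (intro mult_left_mono v2) auto
    finally show ?thesis .
  qed
  have "norm (kernelW b ?s) = b\<^sup>2 * norm (1 / sinh ?v - 1 / ?v) / (4 * norm ?s * norm (sinh ?s))"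
    using assms by (intro norm_kernelW parab_in)
  also have "\<dots> \<le> b\<^sup>2 * (4 * (1 + \<bar>u\<bar>) * norm ?v) / (4 * norm ?s * (1 / 2))"
    using s by (intro frac_le mult_left_mono v half_le_norm_sinh_parab) auto
  also have "\<dots> = 2 * b ^ 4 * (1 + \<bar>u\<bar>)"
  proof -
    have "B * (4 * w * (B * n)) / (4 * n * (1 / 2)) = 2 * B\<^sup>2 * w" if "n \<noteq> 0" for B w n :: real
      using that by (simp add: field_simps power2_eq_square)
    from this[of "norm ?s" "b\<^sup>2" "1 + \<bar>u\<bar>"] show ?thesis
      using s by (simp add: norm_mult norm_power mult.assoc flip: power_mult)
  qed
  also have "\<dots> \<le> 2 * b ^ 4 * exp \<bar>u\<bar>"
    by (intro mult_left_mono exp_ge_add_one_self) auto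
  finally show ?thesis .
qed

lemma norm_integral_le:
  fixes f :: "real \<Rightarrow> complex" and g :: "real \<Rightarrow> real"
  assumes "integrable lborel f" "integrable lborel g" "\<And>u. norm (f u) \<le> g u"
  shows "norm (LINT u|lborel. f u) \<le> (LINT u|lborel. g u)"
  by (rule order_trans[OF integral_norm_bound integral_mono]) (use assms in auto)

lemma mean_int_kernelW_bound:
  fixes \<eta> \<kappa> :: real
  assumes \<eta>: "0 < \<eta>"
  shows "\<exists>C. \<forall>b c. 0 < b \<and> b < 1 \<and> \<bar>Re c\<bar> \<le> 1 - \<eta> \<and> \<bar>Im c\<bar> \<le> \<kappa> \<longrightarrow>
    norm (odd_kernel.mean_int (kernelW b) c) \<le> C * b ^ 4"
proof (intro exI allI impI)
  fix b :: real and c :: complex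
  assume asm: "0 < b \<and> b < 1 \<and> \<bar>Re c\<bar> \<le> 1 - \<eta> \<and> \<bar>Im c\<bar> \<le> \<kappa>"
  interpret W: odd_kernel "kernelW b" 0 "betaW b" 1
    using asm by (intro odd_kernelW) auto
  let ?I = "LINT u|lborel. exp (- \<eta> * \<bar>u\<bar>) :: real"
  let ?C = "2 * exp (\<kappa> * (pi / 2)) * ?I"
  have line_int: "norm (W.line_int y c) \<le> ?C * b ^ 4" if y: "\<bar>y\<bar> = pi / 2" for y
  proof -
    have "norm (W.line_int y c) \<le> (LINT u|lborel. (2 * b ^ 4 * exp (\<kappa> * (pi / 2))) * exp (- \<eta> * \<bar>u\<bar>))"
      unfolding W.line_int_def
    proof (rule norm_integral_le)
      show "integrable lborel (\<lambda>u. kernelW b (hline y u) * exp (c * hline y u))"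
        using y asm \<eta> by (intro W.integrable_line_int) auto
      show "integrable lborel (\<lambda>u. (2 * b ^ 4 * exp (\<kappa> * (pi / 2))) * exp (- \<eta> * \<bar>u\<bar>))"
        by (intro integrable_mult_right integrable_exp_neg_abs \<eta>)
      fix u :: real
      have "\<bar>Im c\<bar> * (pi / 2) \<le> \<kappa> * (pi / 2)"
        by (rule mult_right_mono) (use asm in auto)
      moreover have "\<bar>Im c * y\<bar> = \<bar>Im c\<bar> * (pi / 2)"
        using y by (simp add: abs_mult)
      ultimately have "- (Im c * y) \<le> \<kappa> * (pi / 2)"
        by linarith
      moreover have "Re c * u \<le> (1 - \<eta>) * \<bar>u\<bar>"
        using abs_ge_self[of "Re c * u"] mult_right_mono[of "\<bar>Re c\<bar>" "1 - \<eta>" "\<bar>u\<bar>"] asm by (simp add: abs_mult)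
      ultimately have "Re (c * hline y u) \<le> (1 - \<eta>) * \<bar>u\<bar> + \<kappa> * (pi / 2)"
        by simp
      then have "norm (kernelW b (hline y u) * exp (c * hline y u))
          \<le> (2 * b ^ 4 * exp (- \<bar>u\<bar>)) * exp ((1 - \<eta>) * \<bar>u\<bar> + \<kappa> * (pi / 2))"
        unfolding norm_mult norm_exp_eq_Re using asm y
        by (intro mult_mono norm_kernelW_hline_le) auto
      also have "\<dots> = 2 * b ^ 4 * exp (\<kappa> * (pi / 2)) * (exp (- \<bar>u\<bar>) * exp ((1 - \<eta>) * \<bar>u\<bar>))"
        by (simp only: exp_add mult_ac)
      also have "exp (- \<bar>u\<bar>) * exp ((1 - \<eta>) * \<bar>u\<bar>) = exp (- \<eta> * \<bar>u\<bar>)"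
        unfolding exp_add[symmetric] by (simp add: algebra_simps)
      finally show "norm (kernelW b (hline y u) * exp (c * hline y u))
          \<le> (2 * b ^ 4 * exp (\<kappa> * (pi / 2))) * exp (- \<eta> * \<bar>u\<bar>)" .
    qed
    then show ?thesis
      by (simp add: mult_ac)
  qed
  have "norm (W.mean_int c) \<le> (norm (W.line_int (pi / 2) c) + norm (W.line_int (- (pi / 2)) c)) / 2"
    unfolding W.mean_int_def using norm_triangle_ineq by (simp add: norm_divide)
  also have "\<dots> \<le> ?C * b ^ 4"
    using line_int[of "pi / 2"] line_int[of "- (pi / 2)"] by simp
  finally show "norm (W.mean_int c) \<le> ?C * b ^ 4" .
qed

lemma parab_int_kernelW_bound:
  fixes \<eta> R :: real
  assumes \<eta>: "0 < \<eta>"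
  shows "\<exists>C. \<forall>b c. 0 < b \<and> b < 1 \<and> \<bar>Re c\<bar> \<le> R \<and> Im c \<le> - \<eta> \<longrightarrow>
    norm (odd_kernel.parab_int (kernelW b) c) \<le> C * b ^ 4"
proof (intro exI allI impI)
  fix b :: real and c :: complex
  assume asm: "0 < b \<and> b < 1 \<and> \<bar>Re c\<bar> \<le> R \<and> Im c \<le> - \<eta>"
  interpret W: odd_kernel "kernelW b" 0 "betaW b" 1
    using asm by (intro odd_kernelW) auto
  let ?I = "LINT u|lborel. exp (- 1 * \<bar>u\<bar>) :: real"
  \<comment> \<open>The linear rate is \<open>R\<close> from Re c, plus 1 from the kernel, plus 1
    from the velocity of the parabola; the last 1 leaves exp (- |u|) to integrate.\<close>
  let ?K = "exp ((R + 2 + 1)\<^sup>2 / (4 * \<eta>))"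
  let ?C = "4 * ?K * ?I"
  have "norm (W.parab_int c) \<le> (LINT u|lborel. (4 * b ^ 4 * ?K) * exp (- 1 * \<bar>u\<bar>))"
    unfolding W.parab_int_def
  proof (rule norm_integral_le)
    show "integrable lborel (\<lambda>u. kernelW b (parab u) * parab' u * exp (c * parab u))"
      using asm \<eta> by (intro W.integrable_parab_int) auto
    show "integrable lborel (\<lambda>u. (4 * b ^ 4 * ?K) * exp (- 1 * \<bar>u\<bar>))"
      by (intro integrable_mult_right integrable_exp_neg_abs) auto
    fix u :: real
    have "Re c * u \<le> R * \<bar>u\<bar>"
      using abs_ge_self[of "Re c * u"] mult_right_mono[of "\<bar>Re c\<bar>" R "\<bar>u\<bar>"] asm by (simp add: abs_mult)
    moreover have "Im c * (pi / 2 + u\<^sup>2) \<le> - \<eta> * (pi / 2 + u\<^sup>2)"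
      using asm by (intro mult_right_mono) auto
    moreover have "0 \<le> \<eta> * (pi / 2)"
      using \<eta> by simp
    ultimately have "Re (c * parab u) \<le> R * \<bar>u\<bar> - \<eta> * u\<^sup>2"
      by (simp add: algebra_simps)
    then have "norm (kernelW b (parab u) * parab' u * exp (c * parab u))
        \<le> (2 * b ^ 4 * exp \<bar>u\<bar>) * (2 * exp \<bar>u\<bar>) * exp (R * \<bar>u\<bar> - \<eta> * u\<^sup>2)"
      unfolding norm_mult norm_exp_eq_Re using asm
      by (intro mult_mono norm_kernelW_parab_le norm_parab'_le) auto
    also have "\<dots> = 4 * b ^ 4 * exp ((R + 2) * \<bar>u\<bar> - \<eta> * u\<^sup>2)"
    proof -
      have "(R + 2) * v - q = v + (v + (R * v - q))" for v q
        by (simp add: algebra_simps)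
      then have "exp ((R + 2) * v - q) = exp v * (exp v * exp (R * v - q))" for v q
        unfolding exp_add[symmetric] by simp
      then show ?thesis
        by simp
    qed
    also have "\<dots> \<le> 4 * b ^ 4 * (?K * exp (- 1 * \<bar>u\<bar>))"
      by (intro mult_left_mono exp_neg_square_le_exp_neg_abs \<eta>) auto
    finally show "norm (kernelW b (parab u) * parab' u * exp (c * parab u)) \<le> (4 * b ^ 4 * ?K) * exp (- 1 * \<bar>u\<bar>)"
      by (simp only: mult.assoc)
  qed
  then show "norm (W.parab_int c) \<le> ?C * b ^ 4"
    by (simp add: mult_ac)
qed

text \<open>Where |Im c| >= \<open>\<eta>\<close>, oddness leads to the lower half plane and the
  parabola. For smaller |Im c| the parabola constant would blow up, so the mean of the lines is
  used, at the price of keeping |Re c| away from 1.\<close>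

lemma ext_int_kernelW_bound:
  fixes \<eta> R :: real
  assumes \<eta>: "0 < \<eta>"
  shows "\<exists>C. \<forall>b c. 0 < b \<and> b < 1 \<and> ((\<bar>Re c\<bar> \<le> R \<and> \<eta> \<le> \<bar>Im c\<bar>) \<or> (\<bar>Re c\<bar> \<le> 1 - \<eta> \<and> \<bar>Im c\<bar> \<le> \<eta>)) \<longrightarrow>
    norm (odd_kernel.ext_int (kernelW b) 0 (betaW b) c) \<le> C * b ^ 4"
proof -
  obtain C1 where C1: "\<And>b c. 0 < b \<and> b < 1 \<and> \<bar>Re c\<bar> \<le> 1 - \<eta> \<and> \<bar>Im c\<bar> \<le> \<eta> \<Longrightarrow>
      norm (odd_kernel.mean_int (kernelW b) c) \<le> C1 * b ^ 4"
    using mean_int_kernelW_bound[OF \<eta>, of \<eta>] by blast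
  obtain C2 where C2: "\<And>b c. 0 < b \<and> b < 1 \<and> \<bar>Re c\<bar> \<le> R \<and> Im c \<le> - \<eta> \<Longrightarrow>
      norm (odd_kernel.parab_int (kernelW b) c) \<le> C2 * b ^ 4"
    using parab_int_kernelW_bound[OF \<eta>, of R] by blast
  show ?thesis
  \<comment> \<open>The term pi / 24 is the residue correction, pi times the modulus of
    \<open>betaW b\<close> divided by b^4.\<close>
  proof (intro exI[of _ "max C1 (C2 + pi / 24)"] allI impI)
    fix b :: real and c :: complex
    assume asm: "0 < b \<and> b < 1 \<and> ((\<bar>Re c\<bar> \<le> R \<and> \<eta> \<le> \<bar>Im c\<bar>) \<or> (\<bar>Re c\<bar> \<le> 1 - \<eta> \<and> \<bar>Im c\<bar> \<le> \<eta>))"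
    interpret W: odd_kernel "kernelW b" 0 "betaW b" 1
      using asm by (intro odd_kernelW) auto
    have b4: "0 \<le> b ^ 4"
      by simp
    have low: "norm (W.ext_int c) \<le> (C2 + pi / 24) * b ^ 4" if "\<bar>Re c\<bar> \<le> R" "Im c \<le> - \<eta>" for c
    proof -
      have "norm (W.ext_int c) = norm (W.parab_int c - pi * \<i> * W.res c)"
        using that \<eta> by (simp add: W.ext_int_def)
      also have "\<dots> \<le> norm (W.parab_int c) + norm (pi * \<i> * W.res c)"
        by (rule norm_triangle_ineq4)
      also have "norm (pi * \<i> * W.res c) = pi / 24 * b ^ 4"
        unfolding W.res_def unfolding betaW_def by (simp add: norm_mult norm_power)
      also have "norm (W.parab_int c) \<le> C2 * b ^ 4"
        using C2[of b c] asm that by simp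
      finally show ?thesis
        by (simp add: algebra_simps)
    qed
    have "norm (W.ext_int c) \<le> C1 * b ^ 4 \<or> norm (W.ext_int c) \<le> (C2 + pi / 24) * b ^ 4"
    proof (cases "\<bar>Re c\<bar> \<le> 1 - \<eta> \<and> \<bar>Im c\<bar> \<le> \<eta>")
      case True
      then show ?thesis
        using C1[of b c] asm \<eta> by (subst (1) W.ext_int_eq_mean_int) auto
    next
      case False
      with asm have "\<bar>Re c\<bar> \<le> R" "Im c \<le> - \<eta> \<or> Im (- c) \<le> - \<eta>"
        by (auto simp: abs_if split: if_splits)
      then show ?thesis
        using low[of c] low[of "- c"] by (auto simp: W.ext_int_minus)
    qed
    moreover have "C1 * b ^ 4 \<le> max C1 (C2 + pi / 24) * b ^ 4" "(C2 + pi / 24) * b ^ 4 \<le> max C1 (C2 + pi / 24) * b ^ 4"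
      using b4 by (auto intro!: mult_right_mono)
    ultimately show "norm (W.ext_int c) \<le> max C1 (C2 + pi / 24) * b ^ 4"
      by linarith
  qed
qed

lemma ext_int_kernelW:
  assumes b: "0 < b" "b < 1" and c: "Im c \<noteq> 0 \<or> \<bar>Re c\<bar> < 1"
  shows "odd_kernel.ext_int (kernelW b) 0 (betaW b) c =
    of_real (b\<^sup>2) * odd_kernel.ext_int (kernelb b) (alphab b) (betab b) c
    - odd_kernel.ext_int kernel0 alpha0 beta0 c"
proof -
  interpret K0: odd_kernel kernel0 alpha0 beta0 1
    by (rule odd_kernel0)
  interpret Kb: odd_kernel "kernelb b" "alphab b" "betab b" "1 + b\<^sup>2"
    by (rule odd_kernelb[OF b])
  interpret W: odd_kernel "kernelW b" 0 "betaW b" 1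
    by (rule odd_kernelW[OF b])
  have parab_int: "W.parab_int c = of_real (b\<^sup>2) * Kb.parab_int c - K0.parab_int c" if "Im c < 0" for c
  proof -
    have "W.parab_int c = (LINT u|lborel. of_real (b\<^sup>2) * (kernelb b (parab u) * parab' u * exp (c * parab u))
        - kernel0 (parab u) * parab' u * exp (c * parab u))"
      by (simp add: W.parab_int_def kernelW_def algebra_simps)
    also have "\<dots> = of_real (b\<^sup>2) * Kb.parab_int c - K0.parab_int c"
      unfolding Kb.parab_int_def K0.parab_int_def
      by (subst Bochner_Integration.integral_diff)
         (auto intro!: integrable_mult_right Kb.integrable_parab_int K0.integrable_parab_int that)
    finally show ?thesis .
  qed
  have line_int: "W.line_int y c = of_real (b\<^sup>2) * Kb.line_int y c - K0.line_int y c" if "\<bar>y\<bar> = pi / 2" "\<bar>Re c\<bar> < 1" for y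
  proof -
    have "\<bar>Re c\<bar> < 1 + b\<^sup>2"
      using that(2) zero_le_power2[of b] by linarith
    have "W.line_int y c = (LINT u|lborel. of_real (b\<^sup>2) * (kernelb b (hline y u) * exp (c * hline y u))
        - kernel0 (hline y u) * exp (c * hline y u))"
      by (simp add: W.line_int_def kernelW_def algebra_simps)
    also have "\<dots> = of_real (b\<^sup>2) * Kb.line_int y c - K0.line_int y c"
      unfolding Kb.line_int_def K0.line_int_def
      by (subst Bochner_Integration.integral_diff)
         (auto intro!: integrable_mult_right Kb.integrable_line_int K0.integrable_line_int that \<open>\<bar>Re c\<bar> < 1 + b\<^sup>2\<close>)
    finally show ?thesis .
  qed
  have res: "W.res c = of_real (b\<^sup>2) * Kb.res c - K0.res c" for c
    unfolding W.res_def Kb.res_def K0.res_def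
    unfolding alphab_def betab_def alpha0_def beta0_def betaW_def
    using b by (simp add: field_simps numeral_eq_Suc)
  show ?thesis
  proof (cases "Im c" "0::real" rule: linorder_cases)
    case equal
    with c have "\<bar>Re c\<bar> < 1" by simp
    then show ?thesis
      using equal
      by (simp add: W.ext_int_def Kb.ext_int_def K0.ext_int_def W.mean_int_def Kb.mean_int_def K0.mean_int_def line_int
            add_divide_distrib diff_divide_distrib distrib_left)
  qed (simp_all add: W.ext_int_def Kb.ext_int_def K0.ext_int_def parab_int res algebra_simps)
qed

section \<open>Second derivatives, and passage to the variable \<open>x\<close>\<close>

context odd_kernel
begin

lemma line_int_deriv_has_field_derivative:
  assumes y: "\<bar>y\<bar> = pi / 2" and c: "\<bar>Re c\<bar> < m"
  shows "((\<lambda>c. LINT u|lborel. G (hline y u) * hline y u * exp (c * hline y u)) has_field_derivative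
    (LINT u|lborel. G (hline y u) * hline y u * hline y u * exp (c * hline y u))) (at c)"
proof -
  obtain \<rho> where \<rho>: "\<rho> > 0"
    "integrable lborel (\<lambda>u. norm (G (hline y u)) * exp (Re (c * hline y u) + \<rho> * norm (hline y u)))"
    using line_int_majorant[OF assms] by blast
  have "(\<lambda>u. G (hline y u)) \<in> borel_measurable borel" "hline y \<in> borel_measurable borel"
    using curve_continuous[OF continuous_on_hline hline_in[OF y]] continuous_on_hline
    by (auto intro: borel_measurable_continuous_onI)
  from exp_integral_has_second_field_derivative[OF this \<rho>] show ?thesis .
qed

lemma ext_int_slit_holomorphic:
  assumes "1 \<le> m"
  shows "(\<lambda>x. ext_int (1 - 2 * x / pi)) holomorphic_on {x. Im x \<noteq> 0 \<or> (0 < Re x \<and> Re x < pi)}" (is "_ holomorphic_on ?S")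
proof -
  have "ext_int \<circ> (\<lambda>x. 1 - 2 * x / pi) holomorphic_on ?S"
  proof (rule holomorphic_on_compose_gen[OF _ ext_int_holomorphic])
    show "(\<lambda>x. 1 - 2 * x / pi) holomorphic_on ?S"
      by (intro holomorphic_intros) auto
    show "(\<lambda>x. 1 - 2 * x / of_real pi) ` ?S \<subseteq> {c. Im c \<noteq> 0 \<or> \<bar>Re c\<bar> < m}"
    proof (rule image_subsetI, rule CollectI)
      fix x :: complex assume "x \<in> ?S"
      moreover have "\<bar>1 - 2 * Re x / pi\<bar> < 1" if "0 < Re x" "Re x < pi"
        using that by (simp add: abs_less_iff field_simps)
      ultimately show "Im (1 - 2 * x / of_real pi) \<noteq> 0 \<or> \<bar>Re (1 - 2 * x / of_real pi)\<bar> < m"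
        using assms by force
    qed
  qed
  then show ?thesis
    by (simp add: o_def)
qed

end

section \<open>The double sine function\<close>

lemma slit_plane_eq: "slit_plane = {x. Im x \<noteq> 0 \<or> (0 < Re x \<and> Re x < pi)}"
proof -
  have "x \<in> of_real ` ({..0} \<union> {pi..}) \<longleftrightarrow> Im x = 0 \<and> (Re x \<le> 0 \<or> pi \<le> Re x)" for x
    by (auto simp: image_iff complex_eq_iff intro: exI[of _ "Re x"])
  then show ?thesis
    by (auto simp: slit_plane_def)
qed

lemma open_slit_plane: "open slit_plane"
proof -
  have "slit_plane = {x. Im x \<noteq> 0} \<union> {x. 0 < Re x} \<inter> {x. Re x < pi}"
    by (auto simp: slit_plane_eq)
  also have "open \<dots>"
    by (intro open_Un open_Int open_Collect_neq open_Collect_less continuous_intros)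
  finally show ?thesis .
qed

lemma connected_slit_plane: "connected slit_plane"
  unfolding slit_plane_def
  by (intro starlike_imp_connected starlike_doubly_slotted_complex_plane) simp

text \<open>The identity theorem makes the choice operator harmless: it suffices to exhibit one
  extension \<open>h\<close>.\<close>

lemma holomorphic_extension_eq:
  assumes D: "open D" "connected D" and U: "open U" "U \<noteq> {}" "U \<subseteq> D"
    and h: "h holomorphic_on D" "\<And>z. z \<in> U \<Longrightarrow> h z = f z" and z: "z \<in> D"
  shows "holomorphic_extension D U f z = h z"
proof -
  let ?g = "holomorphic_extension D U f"
  have g: "?g holomorphic_on D \<and> (\<forall>z\<in>U. ?g z = f z)"
    unfolding holomorphic_extension_def by (rule someI[of _ h]) (use h in auto)
  show ?thesis
    by (rule analytic_continuation_open[OF U(1) D(1) U(2) D(2) U(3) _ h(1) _ z]) (use g h in auto)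
qed

lemma half_line_primitive_tendsto:
  fixes f p :: "real \<Rightarrow> complex"
  assumes p: "\<And>t. a \<le> t \<Longrightarrow> (p has_vector_derivative f t) (at t)"
    and int: "set_integrable lborel {a..} f"
  shows "((\<lambda>R. p R - p a) \<longlongrightarrow> (LINT t:{a..}|lborel. f t)) at_top"
proof -
  have [measurable]: "(\<lambda>t. indicator {a..} t *\<^sub>R f t) \<in> borel_measurable borel"
    using int by (simp add: set_integrable_def integrable_iff_bounded)
  have lim: "((\<lambda>R. LINT t|lborel. indicator {..R} t *\<^sub>R (indicator {a..} t *\<^sub>R f t)) \<longlongrightarrow> (LINT t:{a..}|lborel. f t)) at_top"
    unfolding set_lebesgue_integral_def
    by (rule tendsto_integral_at_top) (use int in \<open>auto simp: set_integrable_def\<close>)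
  have "(LINT t|lborel. indicator {..R} t *\<^sub>R (indicator {a..} t *\<^sub>R f t)) = p R - p a" if "a \<le> R" for R
  proof -
    have "(f has_integral p R - p a) {a..R}"
      using that p by (intro fundamental_theorem_of_calculus) (auto intro: has_vector_derivative_at_within)
    moreover have "set_integrable lborel {a..R} f"
      by (rule set_integrable_subset[OF int]) auto
    ultimately have "(LINT t:{a..R}|lborel. f t) = p R - p a"
      using set_borel_integral_eq_integral(2)[of "{a..R}" f] by (simp add: integral_unique)
    also have "(LINT t:{a..R}|lborel. f t) = (LINT t|lborel. indicator {..R} t *\<^sub>R (indicator {a..} t *\<^sub>R f t))"
      unfolding set_lebesgue_integral_def by (intro Bochner_Integration.integral_cong) (auto simp: indicator_def)
    finally show ?thesis
      by simp
  qed
  then have "\<forall>\<^sub>F R in at_top. (LINT t|lborel. indicator {..R} t *\<^sub>R (indicator {a..} t *\<^sub>R f t)) = p R - p a"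
    using eventually_ge_at_top by (rule eventually_mono[rotated])
  with lim show ?thesis
    by (rule Lim_transform_eventually)
qed

context odd_kernel
begin

text \<open>A detour through the domain replaces the gap \<open>(-1/2, 1/2)\<close>, so that \<open>curve_bound\<close> applies.\<close>
lemma real_line_bound:
  obtains A where "A \<ge> 0" "\<And>u::real. 1 / 2 \<le> \<bar>u\<bar> \<Longrightarrow> norm (G (of_real u)) \<le> A * exp (- m * \<bar>u\<bar>)"
proof -
  let ?\<gamma> = "\<lambda>u. Complex u (max 0 (1 / 2 - \<bar>u\<bar>))"
  have "continuous_on UNIV ?\<gamma>"
    unfolding Complex_eq by (intro continuous_intros)
  moreover have "?\<gamma> u \<in> kernel_domain" for u
    using pi_gt3 by (auto simp: kernel_domain_def max_def)
  ultimately obtain A where A: "A \<ge> 0" "\<And>u. norm (G (?\<gamma> u)) \<le> A * exp (- m * \<bar>u\<bar>)"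
    using curve_bound[of ?\<gamma>] unfolding complex.sel by blast
  show thesis
  proof (rule that[OF A(1)])
    fix u :: real assume "1 / 2 \<le> \<bar>u\<bar>"
    then have "?\<gamma> u = of_real u"
      by (simp add: complex_eq_iff)
    with A(2)[of u] show "norm (G (of_real u)) \<le> A * exp (- m * \<bar>u\<bar>)"
      by (simp only:)
  qed
qed

text \<open>The indentation passes above 0, so both exponentials in sinh lead to the upper line;
  oddness then turns the term with - c into the lower line at c. In the variable t / (2 r) the half
  circle has radius 1/2 < pi, so no other pole is enclosed.\<close>

lemma indented_line_integral_eq_mean_int:
  assumes r: "0 < r" and c: "\<bar>Re c\<bar> < m"
  shows "indented_line_integral r (\<lambda>t. sinh (c * (t / (2 * of_real r))) * G (t / (2 * of_real r)) / (2 * of_real r)) = mean_int c"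
proof -
  let ?f = "\<lambda>t::complex. sinh (c * (t / (2 * of_real r))) * G (t / (2 * of_real r)) / (2 * of_real r)"
  have "\<exists>P. \<forall>s\<in>upper_slit. (P has_field_derivative G s * exp (c * s)) (at s)" for c
    by (rule holomorphic_on_starlike_has_primitive[OF open_upper_slit starlike_upper_slit exp_kernel_holomorphic[of _ c]])
       (auto simp: upper_slit_def kernel_domain_def)
  then obtain P where P: "\<And>c s. s \<in> upper_slit \<Longrightarrow> (P c has_field_derivative G s * exp (c * s)) (at s)"
    by metis
  define p where "p t = (P c (t / (2 * of_real r)) - P (- c) (t / (2 * of_real r))) / 2" for t :: complex
  have p: "(p has_field_derivative ?f t) (at t)" if "t / (2 * of_real r) \<in> upper_slit" for t :: complex
  proof -
    have d: "((\<lambda>t::complex. t / (2 * of_real r)) has_field_derivative 1 / (2 * of_real r)) (at t)"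
      using r by (auto intro!: derivative_eq_intros)
    have "((\<lambda>t. P k (t / (2 * of_real r))) has_field_derivative (G (t / (2 * of_real r)) * exp (k * (t / (2 * of_real r)))) * (1 / (2 * of_real r))) (at t)" for k
      using DERIV_chain2[OF P[OF that] d] .
    from DERIV_cdivide[OF DERIV_diff[OF this[of c] this[of "- c"]], of 2] show ?thesis
      unfolding p_def[abs_def] by (rule DERIV_cong) (use r in \<open>simp add: sinh_field_def field_simps\<close>)
  qed
  have real: "of_real t / (2 * of_real r) \<in> upper_slit" if "t \<noteq> 0" for t :: real
    using that r by (simp add: upper_slit_def)
  have pv: "((\<lambda>t. p (of_real t)) has_vector_derivative ?f (of_real t)) (at t)" if "t \<noteq> 0" for t :: real
  proof -
    have "((of_real :: real \<Rightarrow> complex) has_vector_derivative 1) (at t)"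
      using has_vector_derivative_of_real[OF DERIV_ident, of "at t"] by simp
    from field_vector_diff_chain_at[OF this p[OF real[OF that]]] show ?thesis
      by (simp only: o_def mult_1_left)
  qed
  have lim: "((\<lambda>R. p (of_real R) - p (of_real (- R))) \<longlongrightarrow> mean_int c) at_top"
  proof -
    have scale: "filterlim (\<lambda>R. R / (2 * r)) at_top at_top"
      using r by real_asymp
    have L: "((\<lambda>R. P k (of_real (R / (2 * r))) - P k (of_real (- (R / (2 * r))))) \<longlongrightarrow> line_int (pi / 2) k) at_top"
      if "\<bar>Re k\<bar> < m" for k
      by (rule filterlim_compose[OF primitive_tendsto_line_int[OF that P] scale])
    have "((\<lambda>R. ((P c (of_real (R / (2 * r))) - P c (of_real (- (R / (2 * r)))))
      - (P (- c) (of_real (R / (2 * r))) - P (- c) (of_real (- (R / (2 * r)))))) / 2) \<longlongrightarrow>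
      (line_int (pi / 2) c - line_int (pi / 2) (- c)) / 2) at_top"
      using c by (intro tendsto_intros L) auto
    moreover have "(line_int (pi / 2) c - line_int (pi / 2) (- c)) / 2 = mean_int c"
      by (simp add: mean_int_def line_int_minus)
    ultimately show ?thesis
      by (simp add: p_def algebra_simps diff_divide_distrib add_divide_distrib)
  qed
  obtain A where A: "A \<ge> 0" "\<And>u::real. 1 / 2 \<le> \<bar>u\<bar> \<Longrightarrow> norm (G (of_real u)) \<le> A * exp (- m * \<bar>u\<bar>)"
    using real_line_bound by blast
  define \<rho> where "\<rho> = (m - \<bar>Re c\<bar>) / (2 * r)"
  have \<rho>: "\<rho> > 0"
    using c r by (simp add: \<rho>_def)
  have bound: "norm (?f (of_real t)) \<le> A / (2 * r) * exp (- \<rho> * \<bar>t\<bar>)" if t: "r \<le> \<bar>t\<bar>" for t :: real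
  proof -
    let ?u = "t / (2 * r)"
    have u: "1 / 2 \<le> \<bar>?u\<bar>"
      using t r by (simp add: field_simps)
    have G: "norm (G (of_real ?u)) \<le> A * exp (- m * \<bar>?u\<bar>)"
      by (rule A(2)[OF u])
    have e: "norm (exp (k * of_real ?u)) \<le> exp (\<bar>Re c\<bar> * \<bar>?u\<bar>)" if "\<bar>Re k\<bar> = \<bar>Re c\<bar>" for k
      using abs_ge_self[of "Re k * ?u"] that by (simp only: norm_exp_eq_Re) (simp add: abs_mult)
    have "norm (sinh (c * of_real ?u)) \<le> (norm (exp (c * of_real ?u)) + norm (exp (- c * of_real ?u))) / 2"
      using norm_triangle_ineq4[of "exp (c * of_real ?u)" "exp (- c * of_real ?u)"]
      by (simp add: sinh_field_def norm_divide)
    also have "\<dots> \<le> exp (\<bar>Re c\<bar> * \<bar>?u\<bar>)"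
    proof -
      have "(x + y) / 2 \<le> z" if "x \<le> z" "y \<le> z" for x y z :: real
        using that by simp
      from this[OF e[of c, OF refl] e[of "- c", unfolded uminus_complex.sel abs_minus_cancel, OF refl]]
      show ?thesis .
    qed
    finally have "norm (sinh (c * of_real ?u)) * norm (G (of_real ?u)) \<le> exp (\<bar>Re c\<bar> * \<bar>?u\<bar>) * (A * exp (- m * \<bar>?u\<bar>))"
      by (intro mult_mono G) auto
    also have "\<dots> = A * exp (\<bar>Re c\<bar> * \<bar>?u\<bar> + - m * \<bar>?u\<bar>)"
      by (simp only: exp_add mult_ac)
    also have "\<bar>Re c\<bar> * \<bar>?u\<bar> + - m * \<bar>?u\<bar> = - (m - \<bar>Re c\<bar>) * \<bar>?u\<bar>"
      by (simp only: left_diff_distrib minus_diff_eq minus_mult_left[symmetric])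
    also have "\<dots> = - \<rho> * \<bar>t\<bar>"
      using r by (simp add: \<rho>_def abs_divide minus_divide_left[symmetric] minus_mult_left[symmetric] del: minus_diff_eq)
    finally have "norm (sinh (c * of_real ?u)) * norm (G (of_real ?u)) / (2 * r) \<le> A * exp (- \<rho> * \<bar>t\<bar>) / (2 * r)"
      using r by (intro divide_right_mono) auto
    then show ?thesis
      using r by (simp add: norm_divide norm_mult)
  qed
  have int: "set_integrable lborel {r..} (\<lambda>t. ?f (of_real t))"
    unfolding set_integrable_def
  proof (rule Bochner_Integration.integrable_bound)
    show "integrable lborel (\<lambda>t. A / (2 * r) * exp (- \<rho> * \<bar>t\<bar>))"
      by (intro integrable_mult_right integrable_exp_neg_abs \<rho>)
    have "continuous_on {r..} (\<lambda>t. ?f (of_real t))"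
    proof -
      have "continuous_on {r..} (\<lambda>t. G (of_real t / (2 * of_real r)))"
        by (rule continuous_on_compose2[OF holomorphic_on_imp_continuous_on[OF hol]])
           (use r in \<open>auto intro!: continuous_intros simp: kernel_domain_def\<close>)
      then show ?thesis
        using r unfolding sinh_field_def by (intro continuous_intros) auto
    qed
    then show "(\<lambda>t. indicator {r..} t *\<^sub>R ?f (of_real t)) \<in> borel_measurable lborel"
      by (simp add: borel_measurable_continuous_on_indicator)
    show "AE t in lborel. norm (indicator {r..} t *\<^sub>R ?f (of_real t)) \<le> norm (A / (2 * r) * exp (- \<rho> * \<bar>t\<bar>))"
    proof (rule AE_I2)
      fix t :: real
      have "0 \<le> A / (2 * r) * exp (- \<rho> * \<bar>t\<bar>)"
        using A(1) r by simp
      moreover have "norm (?f (of_real t)) \<le> A / (2 * r) * exp (- \<rho> * \<bar>t\<bar>)" if "r \<le> t"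
        by (rule bound) (use that r in simp)
      ultimately show "norm (indicator {r..} t *\<^sub>R ?f (of_real t)) \<le> norm (A / (2 * r) * exp (- \<rho> * \<bar>t\<bar>))"
        unfolding real_norm_def by (cases "r \<le> t") (simp_all only: abs_of_nonneg indicator_simps
            atLeast_iff not_False_eq_True scaleR_one scaleR_zero_left norm_zero)
    qed
  qed
  have even: "?f (- t) = ?f t" for t
    by (simp add: odd)
  have right: "((\<lambda>R. p (of_real R) - p (of_real r)) \<longlongrightarrow> (LINT t:{r..}|lborel. ?f (of_real t))) at_top"
    by (rule half_line_primitive_tendsto[OF pv int]) (use r in auto)
  \<comment> \<open>Evenness of the integrand makes t |-> - p (- t) another primitive on the right
    half line, which yields the left half line.\<close>
  have left: "((\<lambda>R. - p (of_real (- R)) - - p (of_real (- r))) \<longlongrightarrow> (LINT t:{r..}|lborel. ?f (of_real t))) at_top"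
  proof (rule half_line_primitive_tendsto[OF _ int])
    fix t assume "r \<le> t"
    then have "((\<lambda>t. p (of_real t)) has_vector_derivative ?f (of_real (- t))) (at (- t))"
      using r by (intro pv) auto
    then have "((\<lambda>t. p (of_real t)) \<circ> uminus has_vector_derivative (- 1) *\<^sub>R ?f (of_real (- t))) (at t)"
      by (intro vector_diff_chain_at) (auto intro!: derivative_eq_intros)
    from has_vector_derivative_minus[OF this]
    show "((\<lambda>t. - p (of_real (- t))) has_vector_derivative ?f (of_real t)) (at t)"
      using even[of "of_real t"] by (simp add: o_def)
  qed
  have "(LINT t:{..- r}|lborel. ?f (of_real t)) = (LINT t:{r..}|lborel. ?f (of_real t))"
  proof -
    have "indicator {..- r} (- t) *\<^sub>R ?f (of_real (- t)) = indicator {r..} t *\<^sub>R ?f (of_real t)" for t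
      using even[of "of_real t"] by (simp add: indicator_def)
    then show ?thesis
      unfolding set_lebesgue_integral_def
      using lborel_integral_real_affine[of "- 1" "\<lambda>t. indicator {..- r} t *\<^sub>R ?f (of_real t)" 0]
      by simp
  qed
  moreover have "contour_integral (part_circlepath 0 r pi 0) ?f = p (of_real r) - p (of_real (- r))"
  proof (rule contour_integral_unique)
    have "(?f has_contour_integral p (pathfinish (part_circlepath 0 r pi 0)) - p (pathstart (part_circlepath 0 r pi 0)))
        (part_circlepath 0 r pi 0)"
    proof (rule contour_integral_primitive[of "{t. t / (2 * of_real r) \<in> upper_slit}"])
      show "path_image (part_circlepath 0 r pi 0) \<subseteq> {t. t / (2 * of_real r) \<in> upper_slit}"
      proof
        have "\<not> pi \<le> 0"
          using pi_gt_zero by linarith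
        then have seg: "closed_segment pi 0 = {0..pi}"
          by (simp only: closed_segment_eq_real_ivl if_False)
        fix t assume "t \<in> path_image (part_circlepath 0 r pi 0)"
        then obtain x where x: "0 \<le> x" "x \<le> pi" "t = of_real r * cis x"
          unfolding path_image_part_circlepath' seg by auto
        have eq: "of_real r * cis x / (2 * of_real r) = cis x / 2"
          using r by simp
        \<comment> \<open>The half circle meets the imaginary axis only at its top, which lands at i
          / 2, inside the window of \<open>upper_slit\<close>.\<close>
        have "sin x > 0" if "cos x = 0"
        proof -
          have "0 \<le> sin x" "sin x \<noteq> 0"
            using x that sin_cos_squared_add[of x] by (auto intro: sin_ge_zero)
          then show ?thesis by simp
        qed
        moreover have "sin x < 2 * pi"
          using sin_le_one[of x] pi_gt3 by linarith
        ultimately show "t \<in> {t. t / (2 * of_real r) \<in> upper_slit}"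
          unfolding x(3) mem_Collect_eq eq by (simp add: upper_slit_def)
      qed
    qed (simp_all only: mem_Collect_eq valid_path_part_circlepath has_field_derivative_at_within[OF p])
    then show "(?f has_contour_integral p (of_real r) - p (of_real (- r))) (part_circlepath 0 r pi 0)"
      by simp
  qed
  \<comment> \<open>The three pieces telescope: p(-r) - p(-R), then p(r) - p(-r), then p(R) -
    p(r).\<close>
  moreover have "(LINT t:{r..}|lborel. ?f (of_real t)) + (p (of_real r) - p (of_real (- r))) + (LINT t:{r..}|lborel. ?f (of_real t)) = mean_int c"
  proof (rule tendsto_unique[OF trivial_limit_at_top_linorder _ lim])
    show "((\<lambda>R. p (of_real R) - p (of_real (- R))) \<longlongrightarrow>
        (LINT t:{r..}|lborel. ?f (of_real t)) + (p (of_real r) - p (of_real (- r))) + (LINT t:{r..}|lborel. ?f (of_real t))) at_top"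
      using tendsto_add[OF tendsto_add[OF left tendsto_const[of "p (of_real r) - p (of_real (- r))"]] right]
      by (simp add: algebra_simps)
  qed
  ultimately show ?thesis
    by (simp only: indented_line_integral_def)
qed

end

lemma log_double_sine_eq:
  assumes b: "0 < b" "b < 1" and x: "x \<in> slit_plane"
  shows "log_double_sine b x = odd_kernel.ext_int (kernelb b) (alphab b) (betab b) (1 - 2 * x / pi)"
proof -
  interpret Kb: odd_kernel "kernelb b" "alphab b" "betab b" "1 + b\<^sup>2"
    by (rule odd_kernelb[OF b])
  let ?U = "{x. - (pi * b\<^sup>2 / 2) < Re x \<and> Re x < pi + pi * b\<^sup>2 / 2} \<inter> slit_plane"
  show ?thesis
    unfolding log_double_sine_def
  proof (rule holomorphic_extension_eq[OF open_slit_plane connected_slit_plane _ _ _ _ _ x])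
    have "{x. - (pi * b\<^sup>2 / 2) < Re x \<and> Re x < pi + pi * b\<^sup>2 / 2} =
        {x. - (pi * b\<^sup>2 / 2) < Re x} \<inter> {x. Re x < pi + pi * b\<^sup>2 / 2}"
      by auto
    then show "open ?U"
      by (auto intro!: open_Int open_slit_plane open_Collect_less continuous_intros)
    have "0 < pi * b\<^sup>2"
      using b by simp
    then have "of_real (pi / 2) \<in> ?U"
      using pi_gt_zero unfolding slit_plane_eq Int_iff mem_Collect_eq Re_complex_of_real by linarith
    then show "?U \<noteq> {}"
      by blast
    show "(\<lambda>x. Kb.ext_int (1 - 2 * x / pi)) holomorphic_on slit_plane"
      unfolding slit_plane_eq by (rule Kb.ext_int_slit_holomorphic) simp
    fix x assume xU: "x \<in> ?U"
    define c where "c = 1 - 2 * x / pi"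
    \<comment> \<open>The decay rate of \<open>kernelb\<close> matches the strip exactly: Re x = -
      pi b^2 / 2 and Re x = pi + pi b^2 / 2 correspond to Re c = 1 + b^2 and Re c = - (1 +
      b^2).\<close>
    have "\<bar>Re c\<bar> < 1 + b\<^sup>2"
      using xU by (simp add: c_def abs_less_iff field_simps)
    note mean_int = Kb.ext_int_eq_mean_int[OF this]
    from \<open>\<bar>Re c\<bar> < 1 + b\<^sup>2\<close> have "Kb.mean_int c = indented_line_integral b (\<lambda>t. sinh (c * (t / (2 * of_real b))) * kernelb b (t / (2 * of_real b)) / (2 * of_real b))"
      by (rule Kb.indented_line_integral_eq_mean_int[OF b(1), symmetric])
    also have "(\<lambda>t. sinh (c * (t / (2 * of_real b))) * kernelb b (t / (2 * of_real b)) / (2 * of_real b)) =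
       (\<lambda>t. sinh ((of_real ((b + 1 / b) / 2) - (x / of_real (pi * b) + of_real (b / 2))) * t)
            / (4 * t * sinh (of_real b * t / 2) * sinh (t / (2 * of_real b))))"
    proof
      fix t :: complex
      have "c * (t / (2 * of_real b)) = (of_real ((b + 1 / b) / 2) - (x / of_real (pi * b) + of_real (b / 2))) * t"
        using b by (simp add: c_def field_simps)
      moreover have "of_real (b\<^sup>2) * (t / (2 * of_real b)) = of_real b * t / 2"
        using b by (simp add: field_simps power2_eq_square)
      moreover have "4 * (t / (2 * of_real b)) * S * T * (2 * of_real b) = 4 * t * T * S" for S T
        using b by simp
      ultimately show "sinh (c * (t / (2 * of_real b))) * kernelb b (t / (2 * of_real b)) / (2 * of_real b) =
        sinh ((of_real ((b + 1 / b) / 2) - (x / of_real (pi * b) + of_real (b / 2))) * t)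
            / (4 * t * sinh (of_real b * t / 2) * sinh (t / (2 * of_real b)))"
        by (simp only: kernelb_def times_divide_eq_right divide_divide_eq_left mult_1_right)
    qed
    finally show "Kb.ext_int (1 - 2 * x / pi) = log_double_sine_strip b (x / of_real (pi * b) + of_real (b / 2))"
      unfolding log_double_sine_strip_def mean_int[unfolded c_def] c_def .
  qed auto
qed

section \<open>The dilogarithm\<close>

text \<open>The integrand extends over 0 to a holomorphic \<open>g\<close> on a star-shaped slit
  plane, so \<open>dilog\<close> is minus a primitive of \<open>g\<close>, normalised at 0.\<close>

lemma dilog_slit:
  shows dilog_has_field_derivative:
      "z \<notin> of_real ` {1..} \<Longrightarrow> z \<noteq> 0 \<Longrightarrow> (dilog has_field_derivative - (Ln (1 - z) / z)) (at z)"
    and isCont_dilog_0: "isCont dilog 0"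
    and dilog_0: "dilog 0 = 0"
proof -
  define D where "D = - (complex_of_real ` {1..})"
  have D_iff: "z \<in> D \<longleftrightarrow> Im z \<noteq> 0 \<or> Re z < 1" for z
    by (auto simp: D_def image_iff complex_eq_iff intro: exI[of _ "Re z"])
  have "D = {z. Im z \<noteq> 0} \<union> {z. Re z < 1}"
    using D_iff by auto
  then have "open D"
    by (simp only:) (intro open_Un open_Collect_neq open_Collect_less continuous_intros)
  have "starlike D"
    unfolding D_def by (rule starlike_slotted_complex_plane_right)
  let ?f = "\<lambda>u. Ln (1 - u) / u"
  have nonpos: "1 - u \<notin> \<real>\<^sub>\<le>\<^sub>0" if "u \<in> D" for u
    using that by (auto simp: D_iff complex_nonpos_Reals_iff)
  have "?f holomorphic_on D - {0}"
    by (intro holomorphic_intros) (use nonpos in auto)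
  moreover have "0 \<in> interior D"
    using \<open>open D\<close> by (simp add: interior_open D_iff)
  moreover have "((\<lambda>z. (z - 0) * ?f z) \<longlongrightarrow> 0) (at 0)"
  proof -
    have "((\<lambda>z. Ln (1 - z)) \<longlongrightarrow> Ln (1 - 0)) (at (0::complex))"
      by (intro tendsto_intros) auto
    then have "((\<lambda>z. Ln (1 - z)) \<longlongrightarrow> 0) (at (0::complex))"
      by simp
    then show ?thesis
      by (rule Lim_transform_eventually) (auto simp: eventually_at intro!: exI[of _ 1])
  qed
  ultimately obtain g where g: "g holomorphic_on D" "\<And>z. z \<in> D - {0} \<Longrightarrow> g z = ?f z"
    using holomorphic_on_extend_lim[of ?f D 0] by blast
  obtain P where P: "\<And>z. z \<in> D \<Longrightarrow> (P has_field_derivative g z) (at z)"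
    using holomorphic_on_starlike_has_primitive[OF \<open>open D\<close> \<open>starlike D\<close> g(1)] by blast
  have eq: "dilog z = P 0 - P z" if z: "z \<in> D" for z
  proof (cases "z = 0")
    case False
    have seg: "path_image (linepath 0 z) \<subseteq> D"
    proof
      fix w assume "w \<in> path_image (linepath 0 z)"
      then obtain t where t: "0 \<le> t" "t \<le> 1" "w = t *\<^sub>R z"
        by (auto simp: in_segment)
      have "Re w < 1" if "Im w = 0"
      proof (cases "t = 0")
        case False
        with that t z have "Re z < 1"
          by (auto simp: D_iff)
        moreover have "t * Re z \<le> max 0 (Re z)"
          using t by (cases "0 \<le> Re z") (auto simp: mult_left_le_one_le intro!: mult_nonneg_nonpos)
        ultimately show ?thesis
          using t by simp
      qed (use t in simp)
      then show "w \<in> D"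
        by (auto simp: D_iff)
    qed
    have "(g has_contour_integral P (pathfinish (linepath 0 z)) - P (pathstart (linepath 0 z))) (linepath 0 z)"
      by (rule contour_integral_primitive[OF _ _ seg]) (auto intro: has_field_derivative_at_within P)
    then have "((\<lambda>t. g (linepath 0 z t) * (z - 0)) has_integral P z - P 0) {0..1}"
      by (simp only: has_contour_integral_linepath pathfinish_linepath pathstart_linepath)
    \<comment> \<open>At t = 0 the quotient has the default value 0, while \<open>g\<close> takes
      its limit there; a single point does not change the integral.\<close>
    then have "((\<lambda>t. ?f (linepath 0 z t) * (z - 0)) has_integral P z - P 0) {0..1}"
    proof (rule has_integral_spike_finite[of "{0}", rotated 2])
      fix t :: real assume t: "t \<in> {0..1} - {0}"
      then have "linepath 0 z t \<in> path_image (linepath 0 z)"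
        by (auto simp: path_image_def)
      then have "linepath 0 z t \<in> D - {0}"
        using seg t False by (auto simp: linepath_def)
      from g(2)[OF this] show "?f (linepath 0 z t) * (z - 0) = g (linepath 0 z t) * (z - 0)"
        by simp
    qed simp
    then have "(?f has_contour_integral P z - P 0) (linepath 0 z)"
      by (simp only: has_contour_integral_linepath)
    then show ?thesis
      by (simp add: dilog_def contour_integral_unique)
  qed (simp add: dilog_def)
  have deriv: "(dilog has_field_derivative - g z) (at z)" if z: "z \<in> D" for z
  proof (rule has_field_derivative_transform_within_open[OF _ \<open>open D\<close> z])
    show "((\<lambda>z. P 0 - P z) has_field_derivative - g z) (at z)"
      using P[OF z] by (auto intro!: derivative_eq_intros)
  qed (simp add: eq)
  show "(dilog has_field_derivative - (Ln (1 - z) / z)) (at z)" if "z \<notin> of_real ` {1..}" "z \<noteq> 0"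
    using deriv[of z] g(2)[of z] that by (simp add: D_def)
  show "isCont dilog 0"
    by (rule DERIV_isCont[OF deriv]) (simp add: D_iff)
  show "dilog 0 = 0"
    using eq[of 0] by (simp add: D_iff)
qed

text \<open>The two lines of integration are translates of each other by a half period of \<open>sinh\<close>, so that the
  residue at the origin determines both integrals.\<close>
lemma line_int_csch:
  assumes "\<bar>Re c\<bar> < 1"
  shows "odd_kernel.line_int (\<lambda>s. 1 / sinh s) (- (pi / 2)) c * (1 + exp (\<i> * pi * c)) = 2 * pi * \<i>"
proof -
  interpret csch: odd_kernel "\<lambda>s. 1 / sinh s" 0 1 1
    by (rule odd_kernel_csch)
  have "csch.line_int (pi / 2) c = - exp (\<i> * pi * c) * csch.line_int (- (pi / 2)) c"
  proof -
    have h: "hline (pi / 2) u = hline (- (pi / 2)) u + \<i> * pi" for u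
      by (simp add: complex_eq_iff)
    have "1 / sinh (hline (pi / 2) u) * exp (c * hline (pi / 2) u) =
        - exp (\<i> * pi * c) * (1 / sinh (hline (- (pi / 2)) u) * exp (c * hline (- (pi / 2)) u))" for u
    proof -
      have "sinh (s + \<i> * pi) = - sinh s" for s
      proof -
        have "exp (s + \<i> * pi) = - exp s"
          by (simp add: exp_add)
        then show ?thesis
          unfolding sinh_field_def exp_minus by (simp add: diff_divide_distrib)
      qed
      moreover have "exp (c * (s + \<i> * pi)) = exp (\<i> * pi * c) * exp (c * s)" for s
        by (simp add: distrib_left exp_add mult_ac)
      ultimately show ?thesis
        unfolding h by (simp add: mult_ac)
    qed
    then show ?thesis
      by (simp only: csch.line_int_def integral_mult_right_zero)
  qed
  moreover have "csch.line_int (- (pi / 2)) c - csch.line_int (pi / 2) c = 2 * pi * \<i> * csch.res c"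
    using assms by (rule csch.line_int_diff)
  ultimately show ?thesis
    by (simp add: csch.res_def algebra_simps)
qed

text \<open>On the cut sin (2 Re x) = 0 would hold; since sin (Re x) > 0, this forces cos (Re x) = 0
  and hence cos (2 Re x) = -1, a negative value.\<close>

lemma exp_2ix_notin:
  fixes x :: complex
  assumes "0 < Re x" "Re x < pi"
  shows "exp (2 * \<i> * x) \<notin> of_real ` {1..}"
proof
  assume "exp (2 * \<i> * x) \<in> of_real ` {1..}"
  then obtain r where r: "1 \<le> r" "exp (2 * \<i> * x) = of_real r"
    by auto
  from arg_cong[OF r(2), of Im] have s: "sin (2 * Re x) = 0"
    by (simp add: Im_exp)
  from arg_cong[OF r(2), of Re] have "exp (- (2 * Im x)) * cos (2 * Re x) = r"
    by (simp add: Re_exp)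
  then have c: "cos (2 * Re x) > 0"
    using r(1) by (metis exp_gt_zero less_le_trans zero_less_mult_pos zero_less_one)
  have "sin (Re x) > 0"
    using assms by (intro sin_gt_zero)
  with s have "cos (Re x) = 0"
    by (simp add: sin_double)
  with c show False
    by (simp add: cos_double)
qed

lemma dilog_exp_strip:
  fixes x :: complex
  assumes x: "0 < Re x" "Re x < pi"
  shows "dilog (exp (2 * \<i> * x)) = - (2 * pi * \<i>) * odd_kernel.line_int kernel0 (- (pi / 2)) (1 - 2 * x / pi)"
proof -
  interpret K0: odd_kernel kernel0 alpha0 beta0 1
    by (rule odd_kernel0)
  define y where "y = - (pi / 2)"
  have y: "\<bar>y\<bar> = pi / 2"
    by (simp add: y_def)
  define S where "S = {x. 0 < Re x \<and> Re x < pi}"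
  have S_open: "open S"
  proof -
    have "S = {x. 0 < Re x} \<inter> {x. Re x < pi}"
      by (auto simp: S_def)
    then show ?thesis
      by (simp only:) (intro open_Int open_Collect_less continuous_intros)
  qed
  have S_convex: "convex S"
  proof -
    have "S = {x. Re x > 0} \<inter> {x. Re x < pi}"
      by (auto simp: S_def)
    then show ?thesis
      by (simp only:) (intro convex_Int convex_halfspace_Re_lt convex_halfspace_Re_gt)
  qed
  define cc where "cc x = 1 - 2 * x / of_real pi" for x :: complex
  have cc: "\<bar>Re (cc x)\<bar> < 1" if "x \<in> S" for x
    using that by (simp add: S_def cc_def abs_less_iff field_simps)
  have dcc: "(cc has_field_derivative - 2 / of_real pi) (at x)" for x
    unfolding cc_def[abs_def] by (auto intro!: derivative_eq_intros)
  define h1 where "h1 c = (LINT u|lborel. kernel0 (hline y u) * hline y u * exp (c * hline y u))" for c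
  define q where "q x = exp (2 * \<i> * x)" for x :: complex
  have dq: "(q has_field_derivative 2 * \<i> * q x) (at x)" for x
    unfolding q_def[abs_def] by (auto intro!: derivative_eq_intros)
  have q: "q x \<notin> of_real ` {1..}" "q x \<noteq> 0" if "x \<in> S" for x
    using exp_2ix_notin[of x] that by (auto simp: q_def S_def)
  have q1: "1 - q x \<notin> \<real>\<^sub>\<le>\<^sub>0" "q x \<noteq> 1" if "x \<in> S" for x
    using q(1)[OF that] by (auto simp: image_iff complex_nonpos_Reals_iff complex_eq_iff)
  define \<Delta> where "\<Delta> x = dilog (q x) + 2 * pi * \<i> * K0.line_int y (cc x)" for x
  \<comment> \<open>The derivative of \<open>\<Delta>\<close>: the factor 4 i is 2 pi i times 2 /
    pi, from the chain rule for \<open>cc\<close>.\<close>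
  define \<Delta>1 where "\<Delta>1 x = - (2 * \<i>) * Ln (1 - q x) - 4 * \<i> * h1 (cc x)" for x
  have d1: "(\<Delta> has_field_derivative \<Delta>1 x) (at x)" if xS: "x \<in> S" for x
  proof -
    have "((\<lambda>x. dilog (q x)) has_field_derivative - (Ln (1 - q x) / q x) * (2 * \<i> * q x)) (at x)"
      by (rule DERIV_chain2[OF dilog_has_field_derivative[OF q[OF xS]] dq])
    moreover have "((\<lambda>x. K0.line_int y (cc x)) has_field_derivative h1 (cc x) * (- 2 / of_real pi)) (at x)"
      unfolding h1_def by (rule DERIV_chain2[OF K0.line_int_has_field_derivative[OF y cc[OF xS]] dcc])
    ultimately have "(\<Delta> has_field_derivative - (Ln (1 - q x) / q x) * (2 * \<i> * q x) + 2 * pi * \<i> * (h1 (cc x) * (- 2 / of_real pi))) (at x)"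
      unfolding \<Delta>_def[abs_def] by (intro DERIV_add DERIV_cmult)
    then show ?thesis
      by (rule DERIV_cong) (use q(2)[OF xS] in \<open>simp add: \<Delta>1_def field_simps\<close>)
  qed
  have d2: "(\<Delta>1 has_field_derivative 0) (at x)" if xS: "x \<in> S" for x
  proof -
    let ?T = "odd_kernel.line_int (\<lambda>s. 1 / sinh s) y (cc x)"
    have k: "kernel0 s * s * s = 1 / 4 * (1 / sinh s)" if "s \<noteq> 0" for s
      using that by (simp add: kernel0_def power2_eq_square)
    have "hline y u \<noteq> 0" for u
      using y by (auto simp: complex_eq_iff)
    then have "kernel0 (hline y u) * hline y u * hline y u * exp (cc x * hline y u) =
        1 / 4 * (1 / sinh (hline y u) * exp (cc x * hline y u))" for u
      unfolding k[OF \<open>hline y u \<noteq> 0\<close>] by (simp only: mult.assoc)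
    then have "(LINT u|lborel. kernel0 (hline y u) * hline y u * hline y u * exp (cc x * hline y u)) = 1 / 4 * ?T"
      by (simp only: odd_kernel.line_int_def[OF odd_kernel_csch] integral_mult_right_zero)
    then have "(LINT u|lborel. kernel0 (hline y u) * hline y u * hline y u * exp (cc x * hline y u)) = ?T / 4"
      by simp
    with K0.line_int_deriv_has_field_derivative[OF y cc[OF xS]]
    have "(h1 has_field_derivative ?T / 4) (at (cc x))"
      by (simp only: h1_def[abs_def])
    then have "((\<lambda>x. h1 (cc x)) has_field_derivative ?T / 4 * (- 2 / of_real pi)) (at x)"
      by (rule DERIV_chain2[OF _ dcc])
    moreover have "((\<lambda>x. Ln (1 - q x)) has_field_derivative - (2 * \<i> * q x) / (1 - q x)) (at x)"
      using q1[OF xS] by (auto intro!: derivative_eq_intros dq simp: field_simps)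
    ultimately have "(\<Delta>1 has_field_derivative - (2 * \<i>) * (- (2 * \<i> * q x) / (1 - q x)) - 4 * \<i> * (?T / 4 * (- 2 / of_real pi))) (at x)"
      unfolding \<Delta>1_def[abs_def] by (intro DERIV_diff DERIV_cmult)
    moreover have "- (2 * \<i>) * (- (2 * \<i> * q x) / (1 - q x)) - 4 * \<i> * (?T / 4 * (- 2 / of_real pi)) = 0"
    proof -
      have "\<i> * of_real pi * cc x = \<i> * of_real pi - 2 * \<i> * x"
        by (simp add: cc_def field_simps)
      \<comment> \<open>This converts the closed form of the 1 / sinh integral into a rational
        function of \<open>q x\<close>, the same one that the second derivative of the dilogarithm
        produces.\<close>
      then have "exp (\<i> * of_real pi * cc x) = - 1 / q x"
        by (simp add: exp_diff q_def)
      then have "?T * (1 + - 1 / q x) = 2 * pi * \<i>"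
        using line_int_csch[OF cc[OF xS]] by (simp add: y_def)
      then have T: "?T * (q x - 1) = 2 * pi * \<i> * q x"
        using q(2)[OF xS] by (simp add: field_simps)
      have "?T = 2 * pi * \<i> * q x / (q x - 1)"
        using T q1(2)[OF xS] by (simp add: field_simps)
      then show ?thesis
        using q1(2)[OF xS] by (simp only:) (simp add: field_simps)
    qed
    ultimately show ?thesis
      by (simp only:)
  qed
  obtain a where a: "\<And>x. x \<in> S \<Longrightarrow> \<Delta>1 x = a"
    using has_field_derivative_zero_constant[OF S_convex, of \<Delta>1] d2 has_field_derivative_at_within by blast
  have "((\<lambda>x. \<Delta> x - a * x) has_field_derivative 0) (at x)" if "x \<in> S" for x
    using d1[OF that] a[OF that] by (auto intro!: derivative_eq_intros)
  then obtain e where e: "\<And>x. x \<in> S \<Longrightarrow> \<Delta> x - a * x = e"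
    using has_field_derivative_zero_constant[OF S_convex, of "\<lambda>x. \<Delta> x - a * x"] has_field_derivative_at_within by blast
  have \<Delta>: "\<Delta> x = a * x + e" if "x \<in> S" for x
    using e[OF that] by (simp add: algebra_simps)
  \<comment> \<open>On this line \<open>q\<close> equals - exp (-2 t) and c = - 2 i t / pi is purely
    imaginary, so |exp (c s)| = exp (- t) at every point s of the lower line.\<close>
  define z where "z t = Complex (pi / 2) t" for t
  have zS: "z t \<in> S" for t
    using pi_gt_zero by (simp add: z_def S_def)
  have lim: "((\<lambda>t. a * z t + e) \<longlongrightarrow> 0) at_top"
  proof -
    have "((\<lambda>t. dilog (q (z t))) \<longlongrightarrow> 0) at_top"
    proof -
      have "q (z t) = of_real (- exp (- 2 * t))" for t
        by (simp add: q_def z_def complex_eq_iff Re_exp Im_exp)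
      moreover have "((\<lambda>t. complex_of_real (- exp (- 2 * t))) \<longlongrightarrow> of_real 0) at_top"
        by (intro tendsto_of_real) real_asymp
      ultimately have "((\<lambda>t. q (z t)) \<longlongrightarrow> 0) at_top"
        by simp
      from isCont_tendsto_compose[OF isCont_dilog_0 this] show ?thesis
        by (simp add: dilog_0)
    qed
    moreover have "((\<lambda>t. K0.line_int y (cc (z t))) \<longlongrightarrow> 0) at_top"
    proof (rule Lim_null_comparison)
      let ?N = "LINT u|lborel. norm (kernel0 (hline y u))"
      have i0: "integrable lborel (\<lambda>u. norm (kernel0 (hline y u)))"
        using integrable_norm[OF K0.integrable_line_int[OF y, of 0]] by simp
      have "norm (K0.line_int y (cc (z t))) \<le> ?N * exp (- t)" for t
      proof -
        have n: "norm (kernel0 (hline y u) * exp (cc (z t) * hline y u)) = norm (kernel0 (hline y u)) * exp (- t)" for u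
          by (simp add: norm_mult cc_def z_def y_def)
        have "norm (K0.line_int y (cc (z t))) \<le> (LINT u|lborel. norm (kernel0 (hline y u) * exp (cc (z t) * hline y u)))"
          unfolding K0.line_int_def by (rule integral_norm_bound)
        then show ?thesis
          unfolding n by simp
      qed
      then show "\<forall>\<^sub>F t in at_top. norm (K0.line_int y (cc (z t))) \<le> ?N * exp (- t)"
        by simp
      show "((\<lambda>t. ?N * exp (- t)) \<longlongrightarrow> 0) at_top"
        by (rule tendsto_mult_right_zero) real_asymp
    qed
    ultimately have "((\<lambda>t. dilog (q (z t)) + 2 * pi * \<i> * K0.line_int y (cc (z t))) \<longlongrightarrow> 0 + 2 * pi * \<i> * 0) at_top"
      by (intro tendsto_intros)
    then show ?thesis
      using \<Delta>[OF zS] by (simp add: \<Delta>_def)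
  qed
  have "a = 0"
  proof -
    \<comment> \<open>An affine function that tends to 0 along a line has slope 0: its increment
      over a unit step is the constant a i.\<close>
    have "((\<lambda>t. a * z (t + 1) + e) \<longlongrightarrow> 0) at_top"
      by (rule filterlim_compose[OF lim]) real_asymp
    from tendsto_diff[OF this lim] have "((\<lambda>t. a * z (t + 1) - a * z t) \<longlongrightarrow> 0) at_top"
      by simp
    moreover have "a * z (t + 1) - a * z t = a * \<i>" for t
      by (simp add: z_def complex_eq_iff algebra_simps)
    ultimately show ?thesis
      by (simp add: tendsto_const_iff)
  qed
  with lim have "e = 0"
    by (simp add: tendsto_const_iff)
  have "x \<in> S"
    using x by (simp add: S_def)
  from \<Delta>[OF this] \<open>a = 0\<close> \<open>e = 0\<close> have "dilog (q x) + 2 * pi * \<i> * K0.line_int y (cc x) = 0"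
    by (simp add: \<Delta>_def)
  then show ?thesis
    by (simp add: q_def cc_def y_def eq_neg_iff_add_eq_0)
qed

text \<open>The quadratic polynomial in L is the residue: \<open>2 * pi\<^sup>2 * res c\<close> with
  c = 1 - 2 x / pi equals x^2 - pi x + pi^2 / 6. It arises because \<open>ext_int\<close> is the
  lower line integral minus \<open>pi * \<i> * res c\<close>, while the dilogarithm is the lower
  line integral alone.\<close>

lemma L_fun_eq:
  assumes x: "x \<in> slit_plane"
  shows "L_fun x = 2 * of_real pi * \<i> * odd_kernel.ext_int kernel0 alpha0 beta0 (1 - 2 * x / of_real pi)"
proof -
  interpret K0: odd_kernel kernel0 alpha0 beta0 1
    by (rule odd_kernel0)
  let ?h = "\<lambda>x. x\<^sup>2 - of_real pi * x + of_real (pi\<^sup>2 / 6) - 2 * of_real pi * \<i> * K0.ext_int (1 - 2 * x / of_real pi)"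
  have "dilog_exp x = ?h x"
    unfolding dilog_exp_def
  proof (rule holomorphic_extension_eq[OF open_slit_plane connected_slit_plane _ _ _ _ _ x])
    have "{x. 0 < Re x \<and> Re x < pi} = {x. 0 < Re x} \<inter> {x. Re x < pi}"
      by auto
    then show "open {x. 0 < Re x \<and> Re x < pi}"
      by (simp only:) (intro open_Int open_Collect_less continuous_intros)
    have "of_real (pi / 2) \<in> {x. 0 < Re x \<and> Re x < pi}"
      by simp
    then show "{x. 0 < Re x \<and> Re x < pi} \<noteq> {}"
      by blast
    show "?h holomorphic_on slit_plane"
      unfolding slit_plane_eq by (intro holomorphic_intros K0.ext_int_slit_holomorphic) auto
    fix x assume xS: "x \<in> {x. 0 < Re x \<and> Re x < pi}"
    define c where "c = 1 - 2 * x / of_real pi"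
    have c: "\<bar>Re c\<bar> < 1"
      using xS by (simp add: c_def abs_less_iff field_simps)
    have "K0.ext_int c = (K0.line_int (pi / 2) c + K0.line_int (- (pi / 2)) c) / 2"
      using c by (simp add: K0.ext_int_eq_mean_int K0.mean_int_def)
    also have "\<dots> = K0.line_int (- (pi / 2)) c - pi * \<i> * K0.res c"
      using K0.line_int_diff[OF c] by (simp add: field_simps)
    finally have h: "K0.ext_int c = K0.line_int (- (pi / 2)) c - pi * \<i> * K0.res c" .
    have dil: "dilog (exp (2 * \<i> * x)) = - (2 * pi * \<i>) * K0.line_int (- (pi / 2)) c"
      unfolding c_def by (rule dilog_exp_strip) (use xS in auto)
    have "2 * of_real pi * \<i> * K0.ext_int c = - dilog (exp (2 * \<i> * x)) + 2 * (of_real pi)\<^sup>2 * K0.res c"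
      unfolding h dil by (simp add: algebra_simps power2_eq_square)
    moreover have "2 * (of_real pi)\<^sup>2 * K0.res c = x\<^sup>2 - of_real pi * x + of_real (pi\<^sup>2 / 6)"
      unfolding K0.res_def
      unfolding alpha0_def beta0_def c_def by (simp add: field_simps power2_eq_square)
    ultimately show "?h x = dilog (exp (2 * \<i> * x))"
      by (simp add: c_def)
  qed (auto simp: slit_plane_eq)
  then show ?thesis
    by (simp add: L_fun_def)
qed

section \<open>The uniform bound on \<open>H_region\<close>\<close>

lemma H_region_subset_slit_plane: "\<delta> > 0 \<Longrightarrow> H_region \<delta> K \<subseteq> slit_plane"
  by (auto simp: H_region_def slit_plane_eq)

theorem proposition2p1:
  fixes \<delta> K :: real
  assumes "\<delta> > 0" and "K > 0"
  shows "\<exists>B>0. \<forall>b::real. 0 < b \<and> b < 1 \<longrightarrow> (\<forall>x\<in>H_region \<delta> K.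
           norm (2 * of_real pi * \<i> * of_real (b\<^sup>2) * log_double_sine b x - L_fun x) < B * b ^ 4
           \<and> norm (nu b x) < B)"
proof -
  \<comment> \<open>\<open>\<eta>\<close> and \<open>R\<close> are the images of
    \<open>\<delta>\<close> and \<open>K\<close> under the map x |-> c = 1 - 2 x / pi, which scales
    lengths by 2 / pi.\<close>
  define \<eta> where "\<eta> = 2 * \<delta> / pi"
  define R where "R = 1 + 2 * K / pi"
  have \<eta>: "0 < \<eta>"
    using assms by (simp add: \<eta>_def)
  obtain C where C: "\<And>b c. 0 < b \<and> b < 1 \<and>
      ((\<bar>Re c\<bar> \<le> R \<and> \<eta> \<le> \<bar>Im c\<bar>) \<or> (\<bar>Re c\<bar> \<le> 1 - \<eta> \<and> \<bar>Im c\<bar> \<le> \<eta>)) \<Longrightarrow>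
      norm (odd_kernel.ext_int (kernelW b) 0 (betaW b) c) \<le> C * b ^ 4"
    using ext_int_kernelW_bound[OF \<eta>, of R] by blast
  \<comment> \<open>The sign of \<open>C\<close> is unknown, hence the absolute value; the added 1
    gives positivity and strict inequality.\<close>
  define B where "B = 2 * pi * \<bar>C\<bar> + 1"
  have "B > 0"
    by (simp add: B_def add_nonneg_pos)
  moreover have "norm (2 * of_real pi * \<i> * of_real (b\<^sup>2) * log_double_sine b x - L_fun x) < B * b ^ 4
      \<and> norm (nu b x) < B" if b: "0 < b \<and> b < 1" and x: "x \<in> H_region \<delta> K" for b x
  proof -
    define c where "c = 1 - 2 * x / of_real pi"
    have x': "x \<in> slit_plane"
      using H_region_subset_slit_plane[OF assms(1)] x by blast
    have Re_c: "Re c = 1 - 2 * Re x / pi" and Im_c: "\<bar>Im c\<bar> = 2 * \<bar>Im x\<bar> / pi"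
      by (simp_all add: c_def abs_mult)
    have c: "Im c \<noteq> 0 \<or> \<bar>Re c\<bar> < 1"
      using x' by (simp add: slit_plane_eq c_def abs_less_iff field_simps)
    have region: "(\<bar>Re c\<bar> \<le> R \<and> \<eta> \<le> \<bar>Im c\<bar>) \<or> (\<bar>Re c\<bar> \<le> 1 - \<eta> \<and> \<bar>Im c\<bar> \<le> \<eta>)"
    proof (cases "\<delta> \<le> \<bar>Im x\<bar>")
      case True
      then have "\<eta> \<le> \<bar>Im c\<bar>"
        unfolding Im_c \<eta>_def by (intro divide_right_mono) auto
      moreover have "\<bar>Re c\<bar> \<le> R"
      proof (cases "\<bar>Re x\<bar> \<le> K")
        case True
        have "\<bar>Re c\<bar> \<le> 1 + 2 * \<bar>Re x\<bar> / pi"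
          using abs_triangle_ineq4[of 1 "2 * Re x / pi"] by (simp add: Re_c abs_mult)
        also have "2 * \<bar>Re x\<bar> / pi \<le> 2 * K / pi"
          using True by (intro divide_right_mono) auto
        finally show ?thesis
          by (simp add: R_def)
      next
        case False
        \<comment> \<open>With |Re x| > K, membership in \<open>H_region\<close> can only come from
          the vertical strip, which maps into |Re c| <= 1 <= R.\<close>
        with x assms have "0 \<le> Re x" "Re x \<le> pi"
          by (auto simp: H_region_def)
        then have "\<bar>Re c\<bar> \<le> 1"
          by (simp add: Re_c abs_le_iff field_simps)
        then show ?thesis
          using assms by (simp add: R_def add_increasing2)
      qed
      ultimately show ?thesis
        by simp
    next
      case False
      then have "\<bar>Im c\<bar> \<le> \<eta>"
        unfolding Im_c \<eta>_def by (intro divide_right_mono) auto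
      moreover have "\<bar>Re c\<bar> \<le> 1 - \<eta>"
        using x False unfolding H_region_def Re_c \<eta>_def by (auto simp: abs_le_iff field_simps)
      ultimately show ?thesis
        by simp
    qed
    have "2 * of_real pi * \<i> * of_real (b\<^sup>2) * log_double_sine b x - L_fun x =
        2 * of_real pi * \<i> * odd_kernel.ext_int (kernelW b) 0 (betaW b) c"
    proof -
      have b': "0 < b" "b < 1"
        using b by auto
      show ?thesis
        unfolding log_double_sine_eq[OF b' x'] L_fun_eq[OF x'] c_def[symmetric] ext_int_kernelW[OF b' c]
        by (simp only: right_diff_distrib mult.assoc)
    qed
    then have "norm (2 * of_real pi * \<i> * of_real (b\<^sup>2) * log_double_sine b x - L_fun x) =
        2 * pi * norm (odd_kernel.ext_int (kernelW b) 0 (betaW b) c)"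
      by (simp only: norm_mult) simp
    also have "\<dots> \<le> 2 * pi * (C * b ^ 4)"
      using C[of b c] b region by (intro mult_left_mono) auto
    also have "\<dots> < B * b ^ 4"
    proof -
      have "2 * pi * C < B"
      proof -
        have "2 * pi * C \<le> 2 * pi * \<bar>C\<bar>"
          by (intro mult_left_mono) auto
        then show ?thesis
          unfolding B_def by linarith
      qed
      then have "2 * pi * C * b ^ 4 < B * b ^ 4"
        using b by (intro mult_strict_right_mono) auto
      then show ?thesis
        by (simp only: mult.assoc)
    qed
    finally have *: "norm (2 * of_real pi * \<i> * of_real (b\<^sup>2) * log_double_sine b x - L_fun x) < B * b ^ 4" .
    moreover have "norm (nu b x) < B"
    proof -
      have "norm (nu b x) = norm (2 * of_real pi * \<i> * of_real (b\<^sup>2) * log_double_sine b x - L_fun x) / b ^ 4"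
        unfolding nu_def norm_divide by (simp add: norm_power)
      then show ?thesis
        using * b by (simp only: pos_divide_less_eq[of "b ^ 4"] zero_less_power)
    qed
    ultimately show ?thesis
      by simp
  qed
  ultimately show ?thesis
    by blast
qed

end
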